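(* Let $(\mathcal{A},H,\mathcal{D})$ be a von Neumann spectral triple relative to $(N,J)$, where the norm closed ideal $J$ is $\sigma$-unital. Let $A=\overline{\mathcal{A}}$ be the norm closure of $\mathcal{A}$ in $N$ and let $F_{\mathcal{D}}=\mathcal{D}(1+\mathcal{D}^2)^{-1/2}\in N$. Then for all $a\in A$ the operators $[F_{\mathcal{D}},a]$, $a(1-F_{\mathcal{D}}^2)$ and $a(F_{\mathcal{D}}-F_{\mathcal{D}}^* )$ lie in $J$. Thus the pair $(\mathcal{M}_A,F_{\mathcal{D}})$ is a Kasparov $A$-$J$-module, where $\mathcal{M}_A:A\to\mathcal{L}(J)$ is left multiplication.
   Context: Von Neumann spectral triple: let $N$ be a von Neumann algebra acting on a Hilbert space $H$ and $J\subseteq N$ a norm closed (two-sided) ideal. A von Neumann spectral triple $(\mathcal{A},H,\mathcal{D})$ relative to $(N,J)$ consists of a $*$-algebra $\mathcal{A}$ represented in $N$ and a self-adjoint operator $\mathcal{D}$ affiliated to $N$ such that (1) for all $a\in\mathcal{A}$, $[\mathcal{D},a]$ is defined on $\mathrm{Dom}(\mathcal{D})$ and extends to a bounded operator on $H$; (2) $a(\lambda-\mathcal{D})^{-1}\in J$ for all $\lambda\in\mathbb{C}\setminus\mathbb{R}$ and $a\in\mathcal{A}$. $J$ is regarded as a right Hilbert $J$-module with inner product $\langle x,y\rangle=x^*y$ and right multiplication; it is countably generated since $J$ is $\sigma$-unital. $\mathcal{L}(J)$ denotes the adjointable operators and the compact operators are $\mathcal{K}(J)=J$. Elements of $N$ act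 on $J$ by left multiplication, giving elements of $\mathcal{L}(J)$. Here, an (ungraded, odd) Kasparov $A$-$J$-module is a pair $(\psi,V)$ with $\psi:A\to\mathcal{L}(E)$ a $*$-homomorphism, $E$ a countably generated right Hilbert $J$-module, and $V\in\mathcal{L}(E)$ such that $\psi(a)(V^2-1)$, $\psi(a)(V-V^* )$ and $[V,\psi(a)]$ are in $\mathcal{K}(E)$ for all $a\in A$. *)

theory Defs
  imports "HOL-Analysis.Analysis"
begin

section \<open>Complex vector spaces, Hilbert spaces, *-algebras and C*-algebras\<close>

class scaleC =
  fixes scaleC :: "complex \<Rightarrow> 'a \<Rightarrow> 'a"  (infixr \<open>*\<^sub>C\<close> 75)

class complex_vector = real_vector + scaleC +
  assumes scaleC_add_right: "c *\<^sub>C (x + y) = c *\<^sub>C x + c *\<^sub>C y"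
    and scaleC_add_left: "(c + d) *\<^sub>C x = c *\<^sub>C x + d *\<^sub>C x"
    and scaleC_scaleC: "c *\<^sub>C d *\<^sub>C x = (c * d) *\<^sub>C x"
    and scaleR_scaleC: "r *\<^sub>R x = complex_of_real r *\<^sub>C x"

text \<open>The inner product is antilinear in the first argument. Positivity, definiteness and
  completeness are inherited from the underlying real Hilbert space, whose inner product is the
  real part of the complex one.\<close>

class chilbert_space = complex_vector + real_inner + banach +
  fixes cinner :: "'a \<Rightarrow> 'a \<Rightarrow> complex"
  assumes cinner_commute: "cinner x y = cnj (cinner y x)"
    and cinner_add_right: "cinner x (y + z) = cinner x y + cinner x z"
    and cinner_scaleC_right: "cinner x (c *\<^sub>C y) = c * cinner x y"
    and inner_eq_Re_cinner: "inner x y = Re (cinner x y)"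

class star_algebra = complex_vector + ring +
  fixes star :: "'a \<Rightarrow> 'a"
  assumes scaleC_mult_left: "(c *\<^sub>C x) * y = c *\<^sub>C (x * y)"
    and scaleC_mult_right: "x * (c *\<^sub>C y) = c *\<^sub>C (x * y)"
    and star_add: "star (x + y) = star x + star y"
    and star_scaleC: "star (c *\<^sub>C x) = cnj c *\<^sub>C star x"
    and star_mult: "star (x * y) = star y * star x"
    and star_star: "star (star x) = x"

class cstar_algebra = star_algebra + real_normed_algebra + banach +
  assumes norm_scaleC: "norm (c *\<^sub>C x) = cmod c * norm x"
    and norm_star_mult: "norm (star x * x) = (norm x)\<^sup>2"

definition csubspace :: "'a::complex_vector set \<Rightarrow> bool" where
  "csubspace S \<longleftrightarrow> 0 \<in> S \<and> (\<forall>x\<in>S. \<forall>y\<in>S. x + y \<in> S) \<and> (\<forall>c. \<forall>x\<in>S. c *\<^sub>C x \<in> S)"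

definition star_subalgebra :: "'a::star_algebra set \<Rightarrow> bool" where
  "star_subalgebra S \<longleftrightarrow>
     csubspace S \<and> (\<forall>x\<in>S. \<forall>y\<in>S. x * y \<in> S) \<and> (\<forall>x\<in>S. star x \<in> S)"

definition cstar_subalgebra :: "'a::cstar_algebra set \<Rightarrow> bool" where
  "cstar_subalgebra S \<longleftrightarrow> star_subalgebra S \<and> closed S"

definition star_hom_on :: "'a::star_algebra set \<Rightarrow> ('a \<Rightarrow> 'b::star_algebra) \<Rightarrow> bool" where
  "star_hom_on S \<pi> \<longleftrightarrow>
     (\<forall>x\<in>S. \<forall>y\<in>S. \<pi> (x + y) = \<pi> x + \<pi> y \<and> \<pi> (x * y) = \<pi> x * \<pi> y) \<and>
     (\<forall>c. \<forall>x\<in>S. \<pi> (c *\<^sub>C x) = c *\<^sub>C \<pi> x) \<and>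
     (\<forall>x\<in>S. \<pi> (star x) = star (\<pi> x))"

definition positive_in :: "'a::cstar_algebra set \<Rightarrow> 'a \<Rightarrow> bool" where
  "positive_in B x \<longleftrightarrow> (\<exists>b\<in>B. x = star b * b)"

definition closed_ideal :: "'a::cstar_algebra set \<Rightarrow> 'a set \<Rightarrow> bool" where
  "closed_ideal N J \<longleftrightarrow>
     J \<subseteq> N \<and> csubspace J \<and> closed J \<and> (\<forall>n\<in>N. \<forall>x\<in>J. n * x \<in> J \<and> x * n \<in> J)"

definition sigma_unital :: "'a::cstar_algebra set \<Rightarrow> bool" where
  "sigma_unital J \<longleftrightarrow>
     (\<exists>e :: nat \<Rightarrow> 'a.
        (\<forall>n. e n \<in> J \<and> positive_in J (e n) \<and> norm (e n) \<le> 1) \<and>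
        (\<forall>x\<in>J. (\<lambda>n. e n * x) \<longlonglongrightarrow> x \<and> (\<lambda>n. x * e n) \<longlonglongrightarrow> x))"


section \<open>The C*-algebra of bounded operators on a Hilbert space\<close>

lemma scaleC_zero_right [simp]: "c *\<^sub>C (0::'a::complex_vector) = 0"
  by (metis add_cancel_right_right scaleC_add_right)

lemma scaleC_minus_right: "c *\<^sub>C (- x) = - (c *\<^sub>C (x::'a::complex_vector))"
  by (metis add.right_inverse add_eq_0_iff scaleC_add_right scaleC_zero_right)

lemma scaleC_diff_right: "c *\<^sub>C (x - y) = c *\<^sub>C x - c *\<^sub>C (y::'a::complex_vector)"
  using scaleC_add_right[of c x "- y"] by (simp add: scaleC_minus_right)

lemma scaleC_scaleR_commute: "c *\<^sub>C r *\<^sub>R x = r *\<^sub>R c *\<^sub>C (x::'a::complex_vector)"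
  by (simp add: scaleR_scaleC scaleC_scaleC mult.commute)

lemma cinner_add_left: "cinner (x + y) z = cinner x z + cinner y (z::'a::chilbert_space)"
  by (metis cinner_add_right cinner_commute complex_cnj_add)

lemma cinner_scaleC_left: "cinner (c *\<^sub>C x) y = cnj c * cinner x (y::'a::chilbert_space)"
  by (metis cinner_scaleC_right cinner_commute complex_cnj_mult)

lemma Im_cinner: "Im (cinner x y) = inner (\<i> *\<^sub>C x) (y::'a::chilbert_space)"
  by (simp add: inner_eq_Re_cinner cinner_scaleC_left)

lemma cinner_eqI: "(\<And>x. cinner x y = cinner x z) \<Longrightarrow> y = (z::'a::chilbert_space)"
  by (metis inner_eq_Re_cinner vector_eq_rdot inner_commute)

lemma norm_scaleC_chilbert: "norm (c *\<^sub>C x) = cmod c * norm (x::'a::chilbert_space)"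
proof -
  have "(norm (c *\<^sub>C x))\<^sup>2 = (cmod c * norm x)\<^sup>2"
  proof -
    have "cinner (c *\<^sub>C x) (c *\<^sub>C x) = (c * cnj c) * cinner x x"
      by (simp add: cinner_scaleC_left cinner_scaleC_right)
    also have "\<dots> = complex_of_real ((cmod c)\<^sup>2) * cinner x x"
      by (simp only: complex_norm_square)
    finally have "inner (c *\<^sub>C x) (c *\<^sub>C x) = (cmod c)\<^sup>2 * inner x x"
      by (simp add: inner_eq_Re_cinner)
    then show ?thesis
      by (simp add: power2_norm_eq_inner power_mult_distrib)
  qed
  then show ?thesis
    by (simp add: power2_eq_iff_nonneg)
qed

lemma riesz_real:
  fixes f :: "'a::{real_inner,complete_space} \<Rightarrow> real"
  assumes "bounded_linear f"
  shows "\<exists>y. \<forall>x. f x = inner x y"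
proof -
  interpret f: bounded_linear f by fact
  define Q where "Q x = inner x x - 2 * f x" for x
  obtain K where K: "\<And>x. \<bar>f x\<bar> \<le> norm x * K"
    using f.bounded by auto
  have Qlow: "- K\<^sup>2 \<le> Q x" for x
  proof -
    have "0 \<le> (norm x - K)\<^sup>2" by simp
    moreover have "f x \<le> norm x * K" using K[of x] by linarith
    ultimately show ?thesis
      by (simp add: Q_def power2_norm_eq_inner[symmetric] power2_diff)
  qed
  define m where "m = Inf (range Q)"
  have bdd: "bdd_below (range Q)"
    using Qlow by (auto intro!: bdd_belowI)
  have mle: "m \<le> Q x" for x
    unfolding m_def by (rule cInf_lower[OF _ bdd]) auto
  have "\<exists>x. Q x < m + 1 / Suc n" for n
  proof -
    have "Inf (range Q) < m + 1 / Suc n" by (simp add: m_def)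
    then show ?thesis
      by (subst (asm) cInf_less_iff[OF _ bdd]) auto
  qed
  then obtain s where s: "\<And>n. Q (s n) < m + 1 / Suc n" by metis
  have par: "(norm (x - y))\<^sup>2 = 2 * Q x + 2 * Q y - 4 * Q ((1/2) *\<^sub>R (x + y))" for x y
    by (simp add: Q_def power2_norm_eq_inner f.scaleR f.add inner_simps inner_commute algebra_simps)
  have dst: "(norm (s i - s j))\<^sup>2 \<le> 2 / Suc i + 2 / Suc j" for i j
  proof -
    have "(norm (s i - s j))\<^sup>2 \<le> 2 * Q (s i) + 2 * Q (s j) - 4 * m"
      using par[of "s i" "s j"] mle[of "(1/2) *\<^sub>R (s i + s j)"] by linarith
    also have "\<dots> \<le> 2 * (m + 1 / Suc i) + 2 * (m + 1 / Suc j) - 4 * m"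
      by (intro diff_right_mono add_mono mult_left_mono less_imp_le[OF s]) simp_all
    finally show ?thesis by simp
  qed
  have "Cauchy s"
  proof (rule metric_CauchyI)
    fix e :: real assume e: "0 < e"
    obtain M :: nat where M: "4 / e\<^sup>2 < M" using reals_Archimedean2 by blast
    have "dist (s i) (s j) < e" if "M \<le> i" "M \<le> j" for i j
    proof -
      have Mpos: "0 < real M"
        by (rule le_less_trans[OF _ M]) simp
      have "2 / real (Suc i) + 2 / real (Suc j) \<le> 2 / real M + 2 / real M"
        using that Mpos by (intro add_mono divide_left_mono) auto
      also have "\<dots> < e\<^sup>2"
        using M e Mpos by (simp add: field_simps)
      finally have "(norm (s i - s j))\<^sup>2 < e\<^sup>2" using dst[of i j] by linarith
      then show ?thesis
        using e by (simp add: dist_norm power_less_imp_less_base)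
    qed
    then show "\<exists>M. \<forall>i\<ge>M. \<forall>j\<ge>M. dist (s i) (s j) < e" by blast
  qed
  then obtain y where y: "s \<longlonglongrightarrow> y"
    using Cauchy_convergent_iff convergent_def by blast
  have "(\<lambda>n. Q (s n)) \<longlonglongrightarrow> Q y"
    unfolding Q_def by (intro tendsto_intros y f.tendsto)
  moreover have "(\<lambda>n. m + 1 / Suc n) \<longlonglongrightarrow> m + 0"
    by (intro tendsto_intros LIMSEQ_Suc[OF lim_1_over_n])
  ultimately have Qy: "Q y \<le> m"
    using LIMSEQ_le[of "\<lambda>n. Q (s n)" "Q y" "\<lambda>n. m + 1 / Suc n" m] s less_imp_le by auto
  have "f x = inner x y" for x
  proof (rule ccontr)
    assume ne: "f x \<noteq> inner x y"
    define d where "d = inner x y - f x"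
    have q: "0 \<le> t\<^sup>2 * inner x x + 2 * t * d" for t
    proof -
      have "Q (y + t *\<^sub>R x) = Q y + (t\<^sup>2 * inner x x + 2 * t * d)"
        by (simp add: Q_def d_def f.scaleR f.add inner_simps inner_commute power2_eq_square
            algebra_simps)
      then show ?thesis using mle[of "y + t *\<^sub>R x"] Qy by linarith
    qed
    have "d \<noteq> 0" using ne by (simp add: d_def)
    have pos: "0 < inner x x + 1" by (simp add: add_nonneg_pos)
    define t where "t = - d / (inner x x + 1)"
    have d: "d = - t * (inner x x + 1)"
      using pos by (simp add: t_def)
    have "t\<^sup>2 * inner x x + 2 * t * d = t\<^sup>2 * inner x x - 2 * t\<^sup>2 * (inner x x + 1)"
      unfolding d by (simp add: power2_eq_square algebra_simps)
    also have "\<dots> = - t\<^sup>2 * (inner x x + 2)"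
      by (simp add: algebra_simps)
    also have "\<dots> < 0"
    proof -
      have "0 < t\<^sup>2" "0 < inner x x + 2"
        using pos \<open>d \<noteq> 0\<close> by (auto simp: t_def)
      then have "0 < t\<^sup>2 * (inner x x + 2)" by (rule mult_pos_pos)
      then show ?thesis by simp
    qed
    finally show False using q[of t] by linarith
  qed
  then show ?thesis by blast
qed

lemma adjoint_exists:
  fixes T :: "'h::chilbert_space \<Rightarrow> 'h"
  assumes "bounded_linear T" and sc: "\<And>c x. T (c *\<^sub>C x) = c *\<^sub>C T x"
  shows "\<exists>!z. \<forall>x. cinner (T x) y = cinner x z"
proof -
  interpret T: bounded_linear T by fact
  have "bounded_linear (\<lambda>x. inner (T x) y)"
    by (intro bounded_linear_inner_left_comp T.bounded_linear_axioms)
  from riesz_real[OF this] obtain z where z: "\<And>x. inner (T x) y = inner x z" by blast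
  have "cinner (T x) y = cinner x z" for x
    using z[of x] z[of "\<i> *\<^sub>C x"]
    by (intro complex_eqI) (simp_all add: Im_cinner sc inner_eq_Re_cinner[symmetric])
  then show ?thesis by (metis cinner_eqI)
qed

typedef (overloaded) 'h bop =
  "{T :: 'h::chilbert_space \<Rightarrow>\<^sub>L 'h. \<forall>c x. blinfun_apply T (c *\<^sub>C x) = c *\<^sub>C blinfun_apply T x}"
  by (rule exI[of _ 0]) simp

setup_lifting type_definition_bop

lift_definition bop_apply :: "'h::chilbert_space bop \<Rightarrow> 'h \<Rightarrow> 'h" is blinfun_apply .

lemma bop_eqI: "(\<And>x. bop_apply S x = bop_apply T x) \<Longrightarrow> S = T"
  by transfer (rule blinfun_eqI)

lemma bounded_linear_bop_apply: "bounded_linear (bop_apply T)"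
  by transfer (rule blinfun.bounded_linear_right)

lemma bop_apply_scaleC: "bop_apply T (c *\<^sub>C x) = c *\<^sub>C bop_apply T x"
  by transfer simp

lemma bop_of_fun:
  assumes "bounded_linear f" "\<And>c x. f (c *\<^sub>C x) = c *\<^sub>C f x"
  shows "\<exists>T. bop_apply T = f"
proof -
  have "bop_apply (Abs_bop (Blinfun f)) = f"
    using assms by (simp add: bop_apply.rep_eq Abs_bop_inverse bounded_linear_Blinfun_apply)
  then show ?thesis by blast
qed

instantiation bop :: (chilbert_space) real_normed_vector
begin

lift_definition zero_bop :: "'a bop" is 0 by simp
lift_definition plus_bop :: "'a bop \<Rightarrow> 'a bop \<Rightarrow> 'a bop" is "(+)"
  by (simp add: blinfun.add_left scaleC_add_right)
lift_definition uminus_bop :: "'a bop \<Rightarrow> 'a bop" is uminus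
  by (simp add: blinfun.minus_left scaleC_minus_right)
lift_definition minus_bop :: "'a bop \<Rightarrow> 'a bop \<Rightarrow> 'a bop" is "(-)"
  by (simp add: blinfun.diff_left scaleC_diff_right)
lift_definition scaleR_bop :: "real \<Rightarrow> 'a bop \<Rightarrow> 'a bop" is scaleR
  by (simp add: blinfun.scaleR_left scaleC_scaleR_commute)
lift_definition norm_bop :: "'a bop \<Rightarrow> real" is norm .
definition dist_bop :: "'a bop \<Rightarrow> 'a bop \<Rightarrow> real" where
  "dist_bop S T = norm (S - T)"
definition sgn_bop :: "'a bop \<Rightarrow> 'a bop" where
  "sgn_bop T = inverse (norm T) *\<^sub>R T"
definition uniformity_bop :: "('a bop \<times> 'a bop) filter" where
  "uniformity_bop = (INF e\<in>{0 <..}. principal {(x, y). dist x y < e})"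
definition open_bop :: "'a bop set \<Rightarrow> bool" where
  "open_bop U \<longleftrightarrow> (\<forall>x\<in>U. \<forall>\<^sub>F (x', y) in uniformity. x' = x \<longrightarrow> y \<in> U)"

instance
proof
  fix S T U :: "'a bop" and r q :: real
  note rep = Rep_bop_inject[symmetric] zero_bop.rep_eq plus_bop.rep_eq uminus_bop.rep_eq
    minus_bop.rep_eq scaleR_bop.rep_eq norm_bop.rep_eq
  show "S + T + U = S + (T + U)" "S + T = T + S" "0 + S = S" "- S + S = 0" "S - T = S + - T"
    "r *\<^sub>R (S + T) = r *\<^sub>R S + r *\<^sub>R T" "(r + q) *\<^sub>R S = r *\<^sub>R S + q *\<^sub>R S"
    "r *\<^sub>R q *\<^sub>R S = (r * q) *\<^sub>R S" "1 *\<^sub>R S = S"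
    "norm S = 0 \<longleftrightarrow> S = 0" "norm (r *\<^sub>R S) = \<bar>r\<bar> * norm S"
    by (simp_all add: rep scaleR_add_right scaleR_add_left)
  show "norm (S + T) \<le> norm S + norm T"
    by (simp add: rep norm_triangle_ineq)
qed (simp_all add: dist_bop_def sgn_bop_def uniformity_bop_def open_bop_def)

end

instantiation bop :: (chilbert_space) "{real_normed_algebra, monoid_mult}"
begin

lift_definition times_bop :: "'a bop \<Rightarrow> 'a bop \<Rightarrow> 'a bop" is "(o\<^sub>L)" by simp
lift_definition one_bop :: "'a bop" is id_blinfun by simp

instance
proof
  fix S T U :: "'a bop" and r :: real
  note rep = Rep_bop_inject[symmetric] plus_bop.rep_eq scaleR_bop.rep_eq norm_bop.rep_eq
    times_bop.rep_eq one_bop.rep_eq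
  show "S * T * U = S * (T * U)" "(S + T) * U = S * U + T * U" "S * (T + U) = S * T + S * U"
    "(r *\<^sub>R S) * T = r *\<^sub>R (S * T)" "S * (r *\<^sub>R T) = r *\<^sub>R (S * T)" "1 * S = S" "S * 1 = S"
    unfolding rep by (rule blinfun_eqI; simp add: blinfun.bilinear_simps)+
  show "norm (S * T) \<le> norm S * norm T"
    unfolding rep by (rule norm_blinfun_compose)
qed

end

instance bop :: (chilbert_space) banach
proof
  fix X :: "nat \<Rightarrow> 'a bop"
  assume "Cauchy X"
  then have "Cauchy (\<lambda>n. Rep_bop (X n))"
    by (simp add: Cauchy_def dist_norm norm_bop.rep_eq minus_bop.rep_eq)
  then have "convergent (\<lambda>n. Rep_bop (X n))"
    by (rule Cauchy_convergent)
  then obtain L where L: "(\<lambda>n. Rep_bop (X n)) \<longlonglongrightarrow> L"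
    unfolding convergent_def by (rule exE)
  have bl: "bounded_linear (\<lambda>x::'a. c *\<^sub>C x)" for c
    by (rule bounded_linear_intro[of _ "cmod c"])
      (auto simp: scaleC_add_right scaleC_scaleR_commute norm_scaleC_chilbert mult.commute)
  have "blinfun_apply L (c *\<^sub>C x) = c *\<^sub>C blinfun_apply L x" for c x
  proof (rule LIMSEQ_unique)
    show "(\<lambda>n. blinfun_apply (Rep_bop (X n)) (c *\<^sub>C x)) \<longlonglongrightarrow> blinfun_apply L (c *\<^sub>C x)"
      by (intro tendsto_intros L)
    have "(\<lambda>n. c *\<^sub>C blinfun_apply (Rep_bop (X n)) x) \<longlonglongrightarrow> c *\<^sub>C blinfun_apply L x"
      by (intro bounded_linear.tendsto[OF bl] tendsto_intros L)
    moreover have "blinfun_apply (Rep_bop (X n)) (c *\<^sub>C x) = c *\<^sub>C blinfun_apply (Rep_bop (X n)) x"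
      for n using bop_apply_scaleC[of "X n" c x] by (simp only: bop_apply.rep_eq)
    ultimately show "(\<lambda>n. blinfun_apply (Rep_bop (X n)) (c *\<^sub>C x)) \<longlonglongrightarrow> c *\<^sub>C blinfun_apply L x"
      by (simp only:)
  qed
  then have "Rep_bop (Abs_bop L) = L" by (simp add: Abs_bop_inverse)
  then have "X \<longlonglongrightarrow> Abs_bop L"
    using L by (simp add: LIMSEQ_def dist_norm norm_bop.rep_eq minus_bop.rep_eq)
  then show "convergent X" by (auto simp: convergent_def)
qed

lemma bop_apply_simps [simp]:
  "bop_apply 0 x = 0" "bop_apply 1 x = x"
  "bop_apply (S + T) x = bop_apply S x + bop_apply T x"
  "bop_apply (S - T) x = bop_apply S x - bop_apply T x"
  "bop_apply (- T) x = - bop_apply T x"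
  "bop_apply (r *\<^sub>R T) x = r *\<^sub>R bop_apply T x"
  "bop_apply (S * T) x = bop_apply S (bop_apply T x)"
  by (simp_all add: bop_apply.rep_eq zero_bop.rep_eq one_bop.rep_eq plus_bop.rep_eq
      minus_bop.rep_eq uminus_bop.rep_eq scaleR_bop.rep_eq times_bop.rep_eq blinfun.bilinear_simps)

lemma norm_bop_apply: "norm (bop_apply T x) \<le> norm T * norm x"
  by transfer (rule norm_blinfun)

lemma norm_bop_bound: "0 \<le> b \<Longrightarrow> (\<And>x. norm (bop_apply T x) \<le> b * norm x) \<Longrightarrow> norm T \<le> b"
  by transfer (rule norm_blinfun_bound)

instantiation bop :: (chilbert_space) cstar_algebra
begin

definition scaleC_bop :: "complex \<Rightarrow> 'a bop \<Rightarrow> 'a bop" where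
  "scaleC_bop c T = (THE S. \<forall>x. bop_apply S x = c *\<^sub>C bop_apply T x)"

definition star_bop :: "'a bop \<Rightarrow> 'a bop" where
  "star_bop T = (THE S. \<forall>x y. cinner (bop_apply T x) y = cinner x (bop_apply S y))"

lemma bop_apply_scaleC_left: "bop_apply (c *\<^sub>C T) x = c *\<^sub>C bop_apply T x" for T :: "'a bop"
proof -
  have bl: "bounded_linear (\<lambda>x::'a. c *\<^sub>C x)"
    by (rule bounded_linear_intro[of _ "cmod c"])
      (auto simp: scaleC_add_right scaleC_scaleR_commute norm_scaleC_chilbert mult.commute)
  have "\<exists>S. bop_apply S = (\<lambda>x. c *\<^sub>C bop_apply T x)"
    by (rule bop_of_fun)
      (auto intro: bounded_linear_compose[OF bl bounded_linear_bop_apply]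
        simp: bop_apply_scaleC scaleC_scaleC mult.commute)
  then have "\<exists>!S. \<forall>x. bop_apply S x = c *\<^sub>C bop_apply T x"
    by (metis bop_eqI)
  from theI'[OF this] show ?thesis unfolding scaleC_bop_def by blast
qed

lemma cinner_star_right: "cinner x (bop_apply (star T) y) = cinner (bop_apply T x) y"
  for T :: "'a bop"
proof -
  have "\<forall>y. \<exists>!z. \<forall>x. cinner (bop_apply T x) y = cinner x z"
    by (intro allI adjoint_exists bounded_linear_bop_apply bop_apply_scaleC)
  then obtain g where g: "\<And>x y. cinner (bop_apply T x) y = cinner x (g y)" by metis
  have add: "g (u + v) = g u + g v" for u v
    by (rule cinner_eqI) (simp add: g[symmetric] cinner_add_right)
  have scC: "g (c *\<^sub>C u) = c *\<^sub>C g u" for c u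
    by (rule cinner_eqI) (simp add: g[symmetric] cinner_scaleC_right)
  have bd: "norm (g u) \<le> norm u * norm T" for u
  proof -
    have "(norm (g u))\<^sup>2 = inner (bop_apply T (g u)) u"
      by (simp add: power2_norm_eq_inner inner_eq_Re_cinner g)
    also have "\<dots> \<le> norm (bop_apply T (g u)) * norm u" by (rule norm_cauchy_schwarz)
    also have "\<dots> \<le> (norm T * norm (g u)) * norm u"
      by (intro mult_right_mono norm_bop_apply) simp
    finally have "norm (g u) * norm (g u) \<le> norm (g u) * (norm u * norm T)"
      by (simp add: power2_eq_square mult_ac)
    then show ?thesis
      by (cases "norm (g u) = 0") (auto simp: mult_le_cancel_left)
  qed
  have "\<exists>S. bop_apply S = g"
    by (rule bop_of_fun[OF bounded_linear_intro[OF add _ bd] scC])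
      (simp add: scaleR_scaleC scC)
  then have "\<exists>!S. \<forall>x y. cinner (bop_apply T x) y = cinner x (bop_apply S y)"
    by (metis bop_eqI cinner_eqI g)
  from theI'[OF this, rule_format, of x y] show ?thesis
    unfolding star_bop_def by (rule sym)
qed

lemma cinner_star_left: "cinner (bop_apply (star T) x) y = cinner x (bop_apply T y)"
  for T :: "'a bop"
  by (metis cinner_commute cinner_star_right)

lemma bop_cinner_eqI:
  "(\<And>x y. cinner x (bop_apply S y) = cinner x (bop_apply T y)) \<Longrightarrow> S = T" for T :: "'a bop"
  by (metis bop_eqI cinner_eqI)

lemma norm_star_mult_bop: "norm (star T * T) = (norm T)\<^sup>2" for T :: "'a bop"
proof (rule antisym)
  have sq: "(norm (bop_apply S x))\<^sup>2 \<le> norm (star S * S) * (norm x)\<^sup>2" for S :: "'a bop" and x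
  proof -
    have "(norm (bop_apply S x))\<^sup>2 = inner x (bop_apply (star S * S) x)"
      by (simp add: power2_norm_eq_inner inner_eq_Re_cinner cinner_star_right)
    also have "\<dots> \<le> norm x * norm (bop_apply (star S * S) x)" by (rule norm_cauchy_schwarz)
    also have "\<dots> \<le> norm x * (norm (star S * S) * norm x)"
      by (intro mult_left_mono norm_bop_apply) simp
    finally show ?thesis by (simp add: power2_eq_square mult_ac)
  qed
  have low: "(norm S)\<^sup>2 \<le> norm (star S * S)" for S :: "'a bop"
  proof -
    have "norm S \<le> sqrt (norm (star S * S))"
    proof (rule norm_bop_bound)
      fix x
      have "norm (bop_apply S x) = sqrt ((norm (bop_apply S x))\<^sup>2)" by simp
      also have "\<dots> \<le> sqrt (norm (star S * S) * (norm x)\<^sup>2)"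
        using sq by (rule real_sqrt_le_mono)
      finally show "norm (bop_apply S x) \<le> sqrt (norm (star S * S)) * norm x"
        by (simp add: real_sqrt_mult)
    qed simp
    then have "(norm S)\<^sup>2 \<le> (sqrt (norm (star S * S)))\<^sup>2" by (intro power_mono) auto
    then show ?thesis by simp
  qed
  have le: "norm S \<le> norm (star S)" for S :: "'a bop"
  proof -
    have "norm S * norm S \<le> norm (star S) * norm S"
      using low[of S] norm_mult_ineq[of "star S" S] by (simp add: power2_eq_square)
    then show ?thesis by (cases "norm S = 0") (auto simp: mult_le_cancel_right)
  qed
  have "star (star T) = T"
    by (rule bop_cinner_eqI) (simp add: cinner_star_right cinner_star_left)
  then have "norm (star T) = norm T" using le[of T] le[of "star T"] by simp
  then show "norm (star T * T) \<le> (norm T)\<^sup>2"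
    using norm_mult_ineq[of "star T" T] by (simp add: power2_eq_square)
  show "(norm T)\<^sup>2 \<le> norm (star T * T)" by (rule low)
qed

lemma norm_scaleC_bop: "norm (c *\<^sub>C T) = cmod c * norm T" for T :: "'a bop"
proof (rule antisym)
  have le: "norm (d *\<^sub>C S) \<le> cmod d * norm S" for d and S :: "'a bop"
  proof (rule norm_bop_bound)
    fix x
    show "norm (bop_apply (d *\<^sub>C S) x) \<le> cmod d * norm S * norm x"
      using mult_left_mono[OF norm_bop_apply[of S x], of "cmod d"]
      by (simp add: bop_apply_scaleC_left norm_scaleC_chilbert mult.assoc)
  qed simp
  show "norm (c *\<^sub>C T) \<le> cmod c * norm T" by (rule le)
  show "cmod c * norm T \<le> norm (c *\<^sub>C T)"
  proof (cases "c = 0")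
    case False
    have "T = inverse c *\<^sub>C c *\<^sub>C T"
    proof (rule bop_eqI)
      fix x
      have "complex_of_real 1 *\<^sub>C bop_apply T x = bop_apply T x"
        by (simp only: scaleR_scaleC[symmetric] scaleR_one)
      then show "bop_apply T x = bop_apply (inverse c *\<^sub>C c *\<^sub>C T) x"
        using False by (simp add: bop_apply_scaleC_left scaleC_scaleC)
    qed
    then have "norm T \<le> inverse (cmod c) * norm (c *\<^sub>C T)"
      by (metis le norm_inverse)
    then show ?thesis using False by (simp add: field_simps)
  qed simp
qed

instance
proof
  fix c d :: complex and r :: real and S T :: "'a bop"
  show "c *\<^sub>C (S + T) = c *\<^sub>C S + c *\<^sub>C T" "(c + d) *\<^sub>C S = c *\<^sub>C S + d *\<^sub>C S"
    "c *\<^sub>C d *\<^sub>C S = (c * d) *\<^sub>C S" "r *\<^sub>R S = complex_of_real r *\<^sub>C S"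
    "(c *\<^sub>C S) * T = c *\<^sub>C (S * T)" "S * (c *\<^sub>C T) = c *\<^sub>C (S * T)"
    by (rule bop_eqI; simp add: bop_apply_scaleC_left scaleC_add_right scaleC_add_left
        scaleC_scaleC scaleR_scaleC bop_apply_scaleC)+
  show "star (S + T) = star S + star T" "star (c *\<^sub>C S) = cnj c *\<^sub>C star S"
    "star (S * T) = star T * star S" "star (star S) = S"
    by (rule bop_cinner_eqI; simp add: cinner_star_right cinner_star_left cinner_add_right
        cinner_add_left cinner_scaleC_left cinner_scaleC_right bop_apply_scaleC_left)+
  show "norm (c *\<^sub>C S) = cmod c * norm S" by (rule norm_scaleC_bop)
  show "norm (star S * S) = (norm S)\<^sup>2" by (rule norm_star_mult_bop)
qed

end

definition commutant :: "'h::chilbert_space bop set \<Rightarrow> 'h bop set" where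
  "commutant S = {T. \<forall>X\<in>S. T * X = X * T}"

definition von_neumann_algebra :: "'h::chilbert_space bop set \<Rightarrow> bool" where
  "von_neumann_algebra N \<longleftrightarrow> star_subalgebra N \<and> commutant (commutant N) = N"

definition unitary :: "'h::chilbert_space bop \<Rightarrow> bool" where
  "unitary u \<longleftrightarrow> star u * u = 1 \<and> u * star u = 1"

definition positive_op :: "'h::chilbert_space bop \<Rightarrow> bool" where
  "positive_op T \<longleftrightarrow> (\<forall>x. Im (cinner x (bop_apply T x)) = 0 \<and> 0 \<le> Re (cinner x (bop_apply T x)))"

definition positive_sqrt :: "'h::chilbert_space bop \<Rightarrow> 'h bop" where
  "positive_sqrt P = (THE S. positive_op S \<and> S * S = P)"


section \<open>Unbounded operators\<close>

text \<open>The values of \<open>uapp D\<close> outside \<open>udom D\<close> carry no meaning.\<close>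

record 'h unbounded_op =
  udom :: "'h set"
  uapp :: "'h \<Rightarrow> 'h"

definition linear_op :: "'h::chilbert_space unbounded_op \<Rightarrow> bool" where
  "linear_op D \<longleftrightarrow> csubspace (udom D) \<and>
     (\<forall>x\<in>udom D. \<forall>y\<in>udom D. uapp D (x + y) = uapp D x + uapp D y) \<and>
     (\<forall>c. \<forall>x\<in>udom D. uapp D (c *\<^sub>C x) = c *\<^sub>C uapp D x)"

definition adjoint_op :: "'h::chilbert_space unbounded_op \<Rightarrow> 'h unbounded_op" where
  "adjoint_op D =
     \<lparr>udom = {y. \<exists>z. \<forall>x\<in>udom D. cinner (uapp D x) y = cinner x z},
      uapp = (\<lambda>y. THE z. \<forall>x\<in>udom D. cinner (uapp D x) y = cinner x z)\<rparr>"

definition self_adjoint_op :: "'h::chilbert_space unbounded_op \<Rightarrow> bool" where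
  "self_adjoint_op D \<longleftrightarrow> linear_op D \<and> closure (udom D) = UNIV \<and>
     udom (adjoint_op D) = udom D \<and> (\<forall>x\<in>udom D. uapp (adjoint_op D) x = uapp D x)"

text \<open>\<open>D\<close> is affiliated to \<open>N\<close> if \<open>u D u\<^sup>* = D\<close>, including domains, for all unitaries \<open>u\<close> in the
  commutant of \<open>N\<close>.\<close>

definition affiliated :: "'h::chilbert_space unbounded_op \<Rightarrow> 'h bop set \<Rightarrow> bool" where
  "affiliated D N \<longleftrightarrow>
     (\<forall>u\<in>commutant N. unitary u \<longrightarrow>
        bop_apply u ` udom D = udom D \<and>
        (\<forall>x\<in>udom D. uapp D (bop_apply u x) = bop_apply u (uapp D x)))"

definition bounded_inverse :: "'h::chilbert_space unbounded_op \<Rightarrow> 'h bop" where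
  "bounded_inverse T =
     (THE R. (\<forall>y. bop_apply R y \<in> udom T \<and> uapp T (bop_apply R y) = y) \<and>
             (\<forall>x\<in>udom T. bop_apply R (uapp T x) = x))"

definition resolvent :: "'h::chilbert_space unbounded_op \<Rightarrow> complex \<Rightarrow> 'h bop" where
  "resolvent D w = bounded_inverse \<lparr>udom = udom D, uapp = (\<lambda>x. w *\<^sub>C x - uapp D x)\<rparr>"

definition one_plus_square :: "'h::chilbert_space unbounded_op \<Rightarrow> 'h unbounded_op" where
  "one_plus_square D =
     \<lparr>udom = {x \<in> udom D. uapp D x \<in> udom D}, uapp = (\<lambda>x. x + uapp D (uapp D x))\<rparr>"

text \<open>\<open>D (1 + D\<^sup>2)\<^sup>-\<^sup>1\<^sup>/\<^sup>2\<close>, where \<open>(1 + D\<^sup>2)\<^sup>-\<^sup>1\<^sup>/\<^sup>2\<close> is the positive square root of the bounded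
  positive operator \<open>(1 + D\<^sup>2)\<^sup>-\<^sup>1\<close>.\<close>

definition bounded_transform :: "'h::chilbert_space unbounded_op \<Rightarrow> 'h bop" where
  "bounded_transform D =
     (let S = positive_sqrt (bounded_inverse (one_plus_square D)) in
      THE F. \<forall>x. bop_apply S x \<in> udom D \<and> bop_apply F x = uapp D (bop_apply S x))"


section \<open>Von Neumann spectral triples\<close>

text \<open>The *-algebra is a *-subalgebra \<open>\<A>\<close> of an arbitrary *-algebra type; \<open>\<pi>\<close> is its
  representation in \<open>N\<close>, not assumed to be faithful or nondegenerate.\<close>

definition von_neumann_spectral_triple ::
  "'h::chilbert_space bop set \<Rightarrow> 'h bop set \<Rightarrow>
   'a::star_algebra set \<Rightarrow> ('a \<Rightarrow> 'h bop) \<Rightarrow> 'h unbounded_op \<Rightarrow> bool" where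
  "von_neumann_spectral_triple N J \<A> \<pi> D \<longleftrightarrow>
     von_neumann_algebra N \<and> closed_ideal N J \<and>
     star_subalgebra \<A> \<and> star_hom_on \<A> \<pi> \<and> \<pi> ` \<A> \<subseteq> N \<and>
     self_adjoint_op D \<and> affiliated D N \<and>
     (\<forall>a\<in>\<A>. bop_apply (\<pi> a) ` udom D \<subseteq> udom D \<and>
        (\<exists>B :: 'h bop. \<forall>x\<in>udom D.
           bop_apply B x = uapp D (bop_apply (\<pi> a) x) - bop_apply (\<pi> a) (uapp D x))) \<and>
     (\<forall>a\<in>\<A>. \<forall>w. w \<notin> \<real> \<longrightarrow> \<pi> a * resolvent D w \<in> J)"


section \<open>Hilbert modules and Kasparov modules\<close>

text \<open>C*-algebras are closed *-subalgebras of types of class \<open>cstar_algebra\<close>, and the underlying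
  vector space of a Hilbert module is a subspace of a type of class \<open>complex_vector\<close>.\<close>

record ('e, 'b) pre_module =
  mcarrier :: "'e set"
  ract :: "'e \<Rightarrow> 'b \<Rightarrow> 'e"
  minner :: "'e \<Rightarrow> 'e \<Rightarrow> 'b"

definition mnorm :: "('e, 'b::cstar_algebra) pre_module \<Rightarrow> 'e \<Rightarrow> real" where
  "mnorm E x = sqrt (norm (minner E x x))"

definition right_module ::
  "'b::cstar_algebra set \<Rightarrow> ('e::complex_vector, 'b) pre_module \<Rightarrow> bool" where
  "right_module B E \<longleftrightarrow> csubspace (mcarrier E) \<and>
     (\<forall>x\<in>mcarrier E. \<forall>b\<in>B. ract E x b \<in> mcarrier E) \<and>
     (\<forall>x\<in>mcarrier E. \<forall>y\<in>mcarrier E. \<forall>b\<in>B. ract E (x + y) b = ract E x b + ract E y b) \<and>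
     (\<forall>x\<in>mcarrier E. \<forall>b\<in>B. \<forall>b'\<in>B.
        ract E x (b + b') = ract E x b + ract E x b' \<and>
        ract E x (b * b') = ract E (ract E x b) b') \<and>
     (\<forall>x\<in>mcarrier E. \<forall>b\<in>B. \<forall>c.
        ract E (c *\<^sub>C x) b = c *\<^sub>C ract E x b \<and> ract E x (c *\<^sub>C b) = c *\<^sub>C ract E x b)"

definition hilbert_module ::
  "'b::cstar_algebra set \<Rightarrow> ('e::complex_vector, 'b) pre_module \<Rightarrow> bool" where
  "hilbert_module B E \<longleftrightarrow> right_module B E \<and>
     (\<forall>x\<in>mcarrier E. \<forall>y\<in>mcarrier E. minner E x y \<in> B \<and> star (minner E x y) = minner E y x) \<and>
     (\<forall>x\<in>mcarrier E. \<forall>y\<in>mcarrier E. \<forall>z\<in>mcarrier E.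
        minner E x (y + z) = minner E x y + minner E x z) \<and>
     (\<forall>x\<in>mcarrier E. \<forall>y\<in>mcarrier E. \<forall>c. minner E x (c *\<^sub>C y) = c *\<^sub>C minner E x y) \<and>
     (\<forall>x\<in>mcarrier E. \<forall>y\<in>mcarrier E. \<forall>b\<in>B. minner E x (ract E y b) = minner E x y * b) \<and>
     (\<forall>x\<in>mcarrier E. positive_in B (minner E x x) \<and> (minner E x x = 0 \<longrightarrow> x = 0)) \<and>
     (\<forall>s :: nat \<Rightarrow> 'e. (\<forall>n. s n \<in> mcarrier E) \<longrightarrow>
        (\<forall>\<epsilon>>0. \<exists>M. \<forall>m\<ge>M. \<forall>n\<ge>M. mnorm E (s m - s n) < \<epsilon>) \<longrightarrow>
        (\<exists>x\<in>mcarrier E. (\<lambda>n. mnorm E (s n - x)) \<longlonglongrightarrow> 0))"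

definition countably_generated ::
  "'b::cstar_algebra set \<Rightarrow> ('e::complex_vector, 'b) pre_module \<Rightarrow> bool" where
  "countably_generated B E \<longleftrightarrow>
     (\<exists>G. countable G \<and> G \<subseteq> mcarrier E \<and>
        (\<forall>x\<in>mcarrier E. \<forall>\<epsilon>>0.
           \<exists>y\<in>csubspace hull {ract E g b | g b. g \<in> G \<and> b \<in> B}. mnorm E (x - y) < \<epsilon>))"

text \<open>Operators on \<open>E\<close> are functions that are extensional on the carrier, so that equality of
  operators is equality of functions.\<close>

definition is_madjoint ::
  "('e::complex_vector, 'b::cstar_algebra) pre_module \<Rightarrow> ('e \<Rightarrow> 'e) \<Rightarrow> ('e \<Rightarrow> 'e) \<Rightarrow> bool" where
  "is_madjoint E T S \<longleftrightarrow> S \<in> mcarrier E \<rightarrow>\<^sub>E mcarrier E \<and>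
     (\<forall>x\<in>mcarrier E. \<forall>y\<in>mcarrier E. minner E (T x) y = minner E x (S y))"

definition adjointable ::
  "('e::complex_vector, 'b::cstar_algebra) pre_module \<Rightarrow> ('e \<Rightarrow> 'e) set" where
  "adjointable E = {T \<in> mcarrier E \<rightarrow>\<^sub>E mcarrier E. \<exists>S. is_madjoint E T S}"

definition madjoint ::
  "('e::complex_vector, 'b::cstar_algebra) pre_module \<Rightarrow> ('e \<Rightarrow> 'e) \<Rightarrow> ('e \<Rightarrow> 'e)" where
  "madjoint E T = (THE S. is_madjoint E T S)"

definition mplus ::
  "('e::complex_vector, 'b) pre_module \<Rightarrow> ('e \<Rightarrow> 'e) \<Rightarrow> ('e \<Rightarrow> 'e) \<Rightarrow> ('e \<Rightarrow> 'e)" where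
  "mplus E S T = (\<lambda>x\<in>mcarrier E. S x + T x)"

definition mminus ::
  "('e::complex_vector, 'b) pre_module \<Rightarrow> ('e \<Rightarrow> 'e) \<Rightarrow> ('e \<Rightarrow> 'e) \<Rightarrow> ('e \<Rightarrow> 'e)" where
  "mminus E S T = (\<lambda>x\<in>mcarrier E. S x - T x)"

definition mscale ::
  "('e::complex_vector, 'b) pre_module \<Rightarrow> complex \<Rightarrow> ('e \<Rightarrow> 'e) \<Rightarrow> ('e \<Rightarrow> 'e)" where
  "mscale E c T = (\<lambda>x\<in>mcarrier E. c *\<^sub>C T x)"

definition mtimes ::
  "('e::complex_vector, 'b) pre_module \<Rightarrow> ('e \<Rightarrow> 'e) \<Rightarrow> ('e \<Rightarrow> 'e) \<Rightarrow> ('e \<Rightarrow> 'e)" where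
  "mtimes E S T = (\<lambda>x\<in>mcarrier E. S (T x))"

definition mone :: "('e::complex_vector, 'b) pre_module \<Rightarrow> ('e \<Rightarrow> 'e)" where
  "mone E = (\<lambda>x\<in>mcarrier E. x)"

text \<open>Finite sums of the operators \<open>z \<mapsto> x\<langle>y, z\<rangle>\<close>; scalar multiples are absorbed in \<open>x\<close>.\<close>

definition finite_rank ::
  "('e::complex_vector, 'b::cstar_algebra) pre_module \<Rightarrow> ('e \<Rightarrow> 'e) set" where
  "finite_rank E =
     {\<lambda>z\<in>mcarrier E. \<Sum>i<n. ract E (x i) (minner E (y i) z) | (n::nat) x y.
        \<forall>i<n. x i \<in> mcarrier E \<and> y i \<in> mcarrier E}"

text \<open>The closure of the finite rank operators in the operator norm.\<close>

definition compact_ops ::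
  "('e::complex_vector, 'b::cstar_algebra) pre_module \<Rightarrow> ('e \<Rightarrow> 'e) set" where
  "compact_ops E =
     {T \<in> adjointable E. \<forall>\<epsilon>>0. \<exists>S\<in>finite_rank E.
        \<forall>x\<in>mcarrier E. mnorm E x \<le> 1 \<longrightarrow> mnorm E (T x - S x) \<le> \<epsilon>}"

definition module_rep ::
  "'a::star_algebra set \<Rightarrow> ('e::complex_vector, 'b::cstar_algebra) pre_module \<Rightarrow>
   ('a \<Rightarrow> 'e \<Rightarrow> 'e) \<Rightarrow> bool" where
  "module_rep A E \<psi> \<longleftrightarrow> \<psi> ` A \<subseteq> adjointable E \<and>
     (\<forall>a\<in>A. \<forall>b\<in>A. \<psi> (a + b) = mplus E (\<psi> a) (\<psi> b) \<and> \<psi> (a * b) = mtimes E (\<psi> a) (\<psi> b)) \<and>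
     (\<forall>c. \<forall>a\<in>A. \<psi> (c *\<^sub>C a) = mscale E c (\<psi> a)) \<and>
     (\<forall>a\<in>A. \<psi> (star a) = madjoint E (\<psi> a))"

definition kasparov_module ::
  "'a::cstar_algebra set \<Rightarrow> 'b::cstar_algebra set \<Rightarrow> ('e::complex_vector, 'b) pre_module \<Rightarrow>
   ('a \<Rightarrow> 'e \<Rightarrow> 'e) \<Rightarrow> ('e \<Rightarrow> 'e) \<Rightarrow> bool" where
  "kasparov_module A B E \<psi> V \<longleftrightarrow>
     cstar_subalgebra A \<and> cstar_subalgebra B \<and>
     hilbert_module B E \<and> countably_generated B E \<and>
     module_rep A E \<psi> \<and> V \<in> adjointable E \<and>
     (\<forall>a\<in>A.
        mtimes E (\<psi> a) (mminus E (mtimes E V V) (mone E)) \<in> compact_ops E \<and>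
        mtimes E (\<psi> a) (mminus E V (madjoint E V)) \<in> compact_ops E \<and>
        mminus E (mtimes E V (\<psi> a)) (mtimes E (\<psi> a) V) \<in> compact_ops E)"

definition ideal_module :: "'b::cstar_algebra set \<Rightarrow> ('b, 'b) pre_module" where
  "ideal_module J = \<lparr>mcarrier = J, ract = (*), minner = (\<lambda>x y. star x * y)\<rparr>"

definition left_mult :: "'b::cstar_algebra set \<Rightarrow> 'b \<Rightarrow> 'b \<Rightarrow> 'b" where
  "left_mult J a = (\<lambda>x\<in>J. a * x)"

end

theory Submission
  imports Defs
begin

text \<open>
  Let \<open>P = (1 + D\<^sup>2)\<^sup>-\<^sup>1\<close>, \<open>S = P\<^sup>1\<^sup>/\<^sup>2\<close> and \<open>F = DS\<close>. Then \<open>F\<close> is self-adjoint with \<open>1 - F\<^sup>2 = P\<close>, and \<open>aP\<close>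
  lies in \<open>J\<close> because \<open>P\<close> is a multiple of the resolvent at \<open>i\<close>. Only the commutators need work. Let
  \<open>F\<^sub>e\<close> be the bounded transform of \<open>eD\<close>.

  The bounded transform is operator Lipschitz: the commutator of \<open>F\<^sub>e\<close> with \<open>a\<close> has norm at most
  \<open>2e\<parallel>[D, a]\<parallel>\<close>. Indeed \<open>S\<close> is a norm limit of convex combinations of the operators \<open>(1 + uD\<^sup>2)\<^sup>-\<^sup>1\<close>,
  \<open>0 < u \<le> 1\<close> (dyadic partial fractions of Newton's iteration for the square root), and the
  commutators of \<open>D(1 + uD\<^sup>2)\<^sup>-\<^sup>1\<close> with \<open>a\<close> are bounded by \<open>2\<parallel>[D, a]\<parallel>\<close>. On the other hand
  \<open>F\<^sub>e - F = XP = PX\<close> with \<open>X\<close> in \<open>N\<close>, so the commutator of \<open>F\<^sub>e - F\<close> with \<open>a\<close> lies in \<open>J\<close>. Letting \<open>e\<close>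
  tend to \<open>0\<close> puts \<open>[F, a]\<close> into the norm closed ideal \<open>J\<close>.
\<close>

section \<open>Bounded operators\<close>

text \<open>No spectral theorem enters: operators are built from \<open>P\<close> by algebra,
  inverses of strictly positive operators and norm limits, and the bicommutant of \<open>P\<close>
  keeps them commuting. Averages of resolvents replace the usual integral for \<open>S\<close> for
  the same reason.

  Both halves of the argument can be read off scalar functions. The divided difference of
  \<open>x/(1+x^2)\<close> is a sum of two products of functions of \<open>x\<close> and of
  \<open>y\<close> bounded by 1, whence the constant 2; passing to \<open>eD\<close> multiplies
  \<open>[D, a]\<close> by \<open>e\<close>. The functions \<open>ex/sqrt(1+e^2x^2)\<close> and
  \<open>x/sqrt(1+x^2)\<close> have the same limits at plus and minus infinity and differ by
  \<open>O(1/(1+x^2))\<close>, so their difference is divisible by \<open>P\<close>. Neither half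
  suffices alone: \<open>F\<close> does not vanish at infinity, so nothing puts \<open>aF\<close>
  and \<open>Fa\<close> separately into \<open>J\<close>, and a norm bound says nothing about
  \<open>J\<close>.

  An approximate unit makes \<open>J\<close> invariant under \<open>star\<close>, which turns
  \<open>aP\<close> in \<open>J\<close> into \<open>Pa\<close> in \<open>J\<close>; it also gives
  countable generation and compactness of left multiplications.\<close>

lemma star_scaleR: "star (r *\<^sub>R x) = r *\<^sub>R star (x :: 'a::star_algebra)"
  by (simp add: scaleR_scaleC star_scaleC)

lemma star_minus: "star (- x) = - star (x :: 'a::star_algebra)"
  using star_scaleR[of "-1" x] by simp

lemma star_diff: "star (x - y) = star x - star (y :: 'a::star_algebra)"
  using star_add[of x "- y"] by (simp add: star_minus)

lemma star_zero [simp]: "star 0 = (0 :: 'a::star_algebra)"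
  using star_diff[of 0 0] by simp

lemma norm_star: "norm (star x) = norm (x :: 'a::cstar_algebra)"
proof -
  have le: "norm y \<le> norm (star y)" for y :: 'a
  proof -
    have "norm y * norm y \<le> norm (star y) * norm y"
      using norm_mult_ineq[of "star y" y] by (simp add: norm_star_mult power2_eq_square)
    then show ?thesis
      by (cases "norm y = 0") (auto simp: mult_le_cancel_right)
  qed
  from le[of x] le[of "star x"] show ?thesis
    by (simp add: star_star)
qed

lemma bounded_linear_star: "bounded_linear (star :: 'a::cstar_algebra \<Rightarrow> 'a)"
  by (rule bounded_linear_intro[of _ 1]) (simp_all add: star_add star_scaleR norm_star)

lemma star_one [simp]: "star 1 = (1 :: 'h::chilbert_space bop)"
  by (rule bop_cinner_eqI) (simp add: cinner_star_right)

lemma scaleC_one [simp]: "1 *\<^sub>C x = (x :: 'a::complex_vector)"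
  using scaleR_scaleC[of 1 x] by simp

lemma scaleC_minus1: "(- 1) *\<^sub>C x = - (x :: 'a::complex_vector)"
  using scaleR_scaleC[of "-1" x] by simp

lemma scaleC_zero_left [simp]: "0 *\<^sub>C x = (0 :: 'a::complex_vector)"
  using scaleR_scaleC[of 0 x] by simp

lemma inner_star_right: "inner x (bop_apply (star T) y) = inner (bop_apply T x) y"
  by (simp add: inner_eq_Re_cinner cinner_star_right)

lemma inner_self_adjoint:
  "star T = T \<Longrightarrow> inner (bop_apply T x) y = inner x (bop_apply T y)"
  by (metis inner_star_right)

lemma bop_inner_eqI:
  "(\<And>x y. inner x (bop_apply S y) = inner x (bop_apply T y)) \<Longrightarrow> S = T"
  by (metis bop_eqI inner_commute vector_eq_ldot)

lemma bop_apply_add_right [simp]: "bop_apply T (x + y) = bop_apply T x + bop_apply T y"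
  using bounded_linear_bop_apply[of T] by (simp add: linear_simps)

lemma bop_apply_diff_right [simp]: "bop_apply T (x - y) = bop_apply T x - bop_apply T y"
  using bounded_linear_bop_apply[of T] by (simp add: linear_simps)

lemma bop_apply_minus_right [simp]: "bop_apply T (- x) = - bop_apply T x"
  using bounded_linear_bop_apply[of T] by (simp add: linear_simps)

lemma bop_apply_zero_right [simp]: "bop_apply T 0 = 0"
  using bounded_linear_bop_apply[of T] by (simp add: linear_simps)

lemma bop_apply_scaleR_right [simp]: "bop_apply T (r *\<^sub>R x) = r *\<^sub>R bop_apply T x"
  using bounded_linear_bop_apply[of T] by (simp add: linear_simps)

text \<open>Only an inequality, since \<open>1\<close> has norm \<open>0\<close> when the Hilbert
  space is trivial.\<close>

lemma norm_one_bop_le: "norm (1 :: 'h::chilbert_space bop) \<le> 1"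
  by (rule norm_bop_bound) simp_all

lemma bounded_linear_bop_apply_left: "bounded_linear (\<lambda>T. bop_apply T x)"
  by (rule bounded_linear_intro[of _ "norm x"]) (simp_all add: norm_bop_apply)

lemma tendsto_bop_apply [tendsto_intros]:
  "(f \<longlongrightarrow> T) net \<Longrightarrow> ((\<lambda>n. bop_apply (f n) x) \<longlongrightarrow> bop_apply T x) net"
  by (rule bounded_linear.tendsto[OF bounded_linear_bop_apply_left])

lemma tendsto_bop_apply_right:
  "(f \<longlongrightarrow> x) net \<Longrightarrow> ((\<lambda>n. bop_apply T (f n)) \<longlongrightarrow> bop_apply T x) net"
  by (rule bounded_linear.tendsto[OF bounded_linear_bop_apply])

section \<open>Positive operators\<close>

text \<open>Polarization: a form that is real on the diagonal is Hermitian, as comparing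
  \<open>x + y\<close> with \<open>x + i y\<close> shows. From here on positivity is handled with
  the real inner product alone.\<close>

lemma positive_op_iff:
  "positive_op T \<longleftrightarrow> star T = T \<and> (\<forall>x. 0 \<le> inner x (bop_apply T x))"
proof
  assume pos: "positive_op T"
  have im: "Im (cinner x (bop_apply T x)) = 0" for x
    using pos by (simp add: positive_op_def)
  have sym_im: "Im (cinner x (bop_apply T y)) + Im (cinner y (bop_apply T x)) = 0" for x y
    using im[of "x + y"] im[of x] im[of y] by (simp add: cinner_add_left cinner_add_right)
  have "cinner x (bop_apply T y) = cnj (cinner y (bop_apply T x))" for x y
    using sym_im[of x y] sym_im[of x "\<i> *\<^sub>C y"]
    by (intro complex_eqI)
      (simp_all add: cinner_scaleC_left cinner_scaleC_right bop_apply_scaleC)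
  then have "star T = T"
    by (intro bop_cinner_eqI) (metis cinner_commute cinner_star_right)
  then show "star T = T \<and> (\<forall>x. 0 \<le> inner x (bop_apply T x))"
    using pos by (simp add: positive_op_def inner_eq_Re_cinner)
next
  assume T: "star T = T \<and> (\<forall>x. 0 \<le> inner x (bop_apply T x))"
  have "cinner x (bop_apply T x) = cnj (cinner x (bop_apply T x))" for x
    using T by (metis cinner_commute cinner_star_right)
  then have "Im (cinner x (bop_apply T x)) = 0" for x
    by (metis Reals_cnj_iff complex_is_Real_iff)
  then show "positive_op T"
    using T by (simp add: positive_op_def inner_eq_Re_cinner)
qed

lemma positive_op_self_adjoint: "positive_op T \<Longrightarrow> star T = T"
  and positive_op_inner: "positive_op T \<Longrightarrow> 0 \<le> inner x (bop_apply T x)"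
  by (simp_all add: positive_op_iff)

lemma positive_op_add: "positive_op S \<Longrightarrow> positive_op T \<Longrightarrow> positive_op (S + T)"
  by (simp add: positive_op_iff star_add inner_add_right)

lemma positive_op_scaleR: "positive_op T \<Longrightarrow> 0 \<le> r \<Longrightarrow> positive_op (r *\<^sub>R T)"
  by (simp add: positive_op_iff star_scaleR)

lemma positive_op_zero: "positive_op 0"
  by (simp add: positive_op_iff)

lemma positive_op_one: "positive_op 1"
  by (simp add: positive_op_iff)

lemma positive_op_conj: "positive_op T \<Longrightarrow> positive_op (star C * T * C)"
  by (simp add: positive_op_iff star_mult star_star mult.assoc inner_star_right)

lemma positive_op_conj_self_adjoint: "positive_op T \<Longrightarrow> star C = C \<Longrightarrow> positive_op (C * T * C)"
  using positive_op_conj[of T C] by simp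

lemma positive_op_square: "star C = C \<Longrightarrow> positive_op (C * C)"
  using positive_op_conj_self_adjoint[OF positive_op_one, of C] by simp

lemma convex_positive_op: "convex {T. positive_op T}"
  by (rule convexI) (simp add: positive_op_add positive_op_scaleR)

lemma closed_positive_op: "closed {T. positive_op T}"
  unfolding closed_sequential_limits
proof (intro allI impI, elim conjE)
  fix X :: "nat \<Rightarrow> 'a bop" and T
  assume X: "\<forall>n. X n \<in> {T. positive_op T}" and lim: "X \<longlonglongrightarrow> T"
  have "(\<lambda>n. star (X n)) \<longlonglongrightarrow> star T"
    by (rule bounded_linear.tendsto[OF bounded_linear_star lim])
  moreover have "star (X n) = X n" for n
    using X by (simp add: positive_op_self_adjoint)
  ultimately have "star T = T"
    by (intro LIMSEQ_unique[OF _ lim]) simp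
  moreover have "0 \<le> inner x (bop_apply T x)" for x
    by (rule LIMSEQ_le_const[of "\<lambda>n. inner x (bop_apply (X n) x)"])
      (use X in \<open>auto intro!: tendsto_intros lim positive_op_inner\<close>)
  ultimately show "T \<in> {T. positive_op T}"
    by (simp add: positive_op_iff)
qed

lemma norm_self_adjoint_le:
  assumes sa: "star A = A" and "0 \<le> m"
    and num: "\<And>x. \<bar>inner x (bop_apply A x)\<bar> \<le> m * (norm x)\<^sup>2"
  shows "norm A \<le> m"
proof (rule norm_bop_bound[OF \<open>0 \<le> m\<close>])
  fix x
  \<comment> \<open>The test vector points along \<open>A x\<close> and has the length of
    \<open>x\<close>, which balances the two squares in the polarized bound.\<close>
  let ?y = "(norm x / norm (bop_apply A x)) *\<^sub>R bop_apply A x"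
  have pol: "4 * inner (bop_apply A x) y
      = inner (x + y) (bop_apply A (x + y)) - inner (x - y) (bop_apply A (x - y))" for y
    using inner_self_adjoint[OF sa, of x y]
    by (simp add: inner_simps inner_commute algebra_simps)
  have "4 * inner (bop_apply A x) y \<le> 2 * m * ((norm x)\<^sup>2 + (norm y)\<^sup>2)" for y
  proof -
    have "4 * inner (bop_apply A x) y \<le> m * (norm (x + y))\<^sup>2 + m * (norm (x - y))\<^sup>2"
      using num[of "x + y"] num[of "x - y"] by (subst pol) linarith
    also have "\<dots> = 2 * m * ((norm x)\<^sup>2 + (norm y)\<^sup>2)"
      by (simp add: power2_norm_eq_inner inner_simps inner_commute algebra_simps)
    finally show ?thesis .
  qed
  from this[of ?y] show "norm (bop_apply A x) \<le> m * norm x"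
    using \<open>0 \<le> m\<close>
    by (cases "bop_apply A x = 0"; cases "x = 0")
      (auto simp: power2_norm_eq_inner[symmetric] power2_eq_square field_simps)
qed

lemma norm_positive_op_le:
  assumes "positive_op A" "positive_op (m *\<^sub>R 1 - A)" "0 \<le> m"
  shows "norm A \<le> m"
proof (rule norm_self_adjoint_le)
  fix x
  have "0 \<le> inner x (bop_apply A x)" "inner x (bop_apply A x) \<le> m * (norm x)\<^sup>2"
    using positive_op_inner[OF assms(1)] positive_op_inner[OF assms(2), of x]
    by (auto simp: inner_diff_right power2_norm_eq_inner)
  then show "\<bar>inner x (bop_apply A x)\<bar> \<le> m * (norm x)\<^sup>2" by simp
qed (use assms positive_op_self_adjoint in auto)

lemma positive_op_one_minus:
  assumes "star A = A" "norm A \<le> 1"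
  shows "positive_op (1 - A)"
proof -
  have "inner x (bop_apply A x) \<le> inner x x" for x
  proof -
    have "inner x (bop_apply A x) \<le> norm x * norm (bop_apply A x)"
      by (rule norm_cauchy_schwarz)
    also have "\<dots> \<le> norm x * (1 * norm x)"
      by (intro mult_left_mono order_trans[OF norm_bop_apply] mult_right_mono assms) simp_all
    finally show ?thesis by (simp add: power2_norm_eq_inner[symmetric] power2_eq_square)
  qed
  then show ?thesis
    using assms by (simp add: positive_op_iff star_diff inner_diff_right)
qed

text \<open>Both the uniqueness of square roots and the convergence of approximate ones come from this:
  on an approximate eigenvector of \<open>A - B\<close> for \<open>\<plusminus>\<parallel>A - B\<parallel>\<close>, the form of
  \<open>A\<^sup>2 - B\<^sup>2\<close> is almost \<open>\<plusminus>\<parallel>A - B\<parallel>\<close> times that of \<open>A + B\<close>.\<close>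

lemma norm_diff_squared_le:
  assumes A: "positive_op A" and B: "positive_op B"
  shows "(norm (A - B))\<^sup>2 \<le> norm (A * A - B * B)"
proof -
  define X where "X = A - B"
  define m where "m = norm X"
  define d where "d = norm (A * A - B * B)"
  define c where "c = norm (A + B)"
  note saA = positive_op_self_adjoint[OF A] and saB = positive_op_self_adjoint[OF B]
  have saX: "star X = X"
    by (simp add: X_def star_diff saA saB)
  have key: "m * \<bar>inner x (bop_apply X x)\<bar>
      \<le> d + sqrt (2 * m\<^sup>2 - 2 * m * \<bar>inner x (bop_apply X x)\<bar>) * c"
    if nx: "norm x = 1" for x
  proof -
    define t where "t = inner x (bop_apply X x)"
    \<comment> \<open>\<open>l\<close> is whichever of \<open>m\<close> and \<open>- m\<close> has
      the sign of \<open>t\<close>, so that \<open>x\<close> is almost an eigenvector for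
      \<open>l\<close> when \<open>\<bar>t\<bar>\<close> is close to \<open>m\<close>.\<close>
    define l where "l = (if 0 \<le> t then m else - m)"
    have m0: "0 \<le> m" by (simp add: m_def)
    have lt: "l * t = m * \<bar>t\<bar>" and l2: "l\<^sup>2 = m\<^sup>2"
      by (auto simp: l_def)
    have "\<bar>t\<bar> \<le> inner x (bop_apply (A + B) x)"
      using positive_op_inner[OF A, of x] positive_op_inner[OF B, of x]
      by (simp add: t_def X_def inner_simps)
    then have "m * \<bar>t\<bar> \<le> \<bar>l * inner x (bop_apply (A + B) x)\<bar>"
      using m0 mult_left_mono[OF \<open>\<bar>t\<bar> \<le> _\<close> m0] by (auto simp: l_def abs_mult)
    \<comment> \<open>In the real inner product the cross terms of \<open>A x - B x\<close> against
      \<open>A x + B x\<close> cancel although \<open>A\<close> and \<open>B\<close> need not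
      commute, which leaves the form of \<open>A^2 - B^2\<close>. Then \<open>X x\<close> is split
      as \<open>l x + (X x - l x)\<close>.\<close>
    also have "l * inner x (bop_apply (A + B) x)
        = inner x (bop_apply (A * A - B * B) x)
          - inner (bop_apply X x - l *\<^sub>R x) (bop_apply (A + B) x)"
    proof -
      have "inner x (bop_apply (A * A - B * B) x)
          = inner (bop_apply A x) (bop_apply A x) - inner (bop_apply B x) (bop_apply B x)"
        by (simp add: inner_diff_right inner_self_adjoint[OF saA] inner_self_adjoint[OF saB])
      then show ?thesis
        by (simp add: X_def inner_diff_left inner_add_right distrib_left
            inner_commute[of "bop_apply B x" "bop_apply A x"])
    qed
    also have "\<bar>\<dots>\<bar> \<le> \<bar>inner x (bop_apply (A * A - B * B) x)\<bar>
        + \<bar>inner (bop_apply X x - l *\<^sub>R x) (bop_apply (A + B) x)\<bar>"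
      by (rule abs_triangle_ineq4)
    also have "\<dots> \<le> d + sqrt (2 * m\<^sup>2 - 2 * m * \<bar>t\<bar>) * c"
    proof (rule add_mono)
      show "\<bar>inner x (bop_apply (A * A - B * B) x)\<bar> \<le> d"
        using Cauchy_Schwarz_ineq2[of x "bop_apply (A * A - B * B) x"]
          norm_bop_apply[of "A * A - B * B" x] nx by (simp add: d_def)
      have "(norm (bop_apply X x))\<^sup>2 \<le> m\<^sup>2"
        using norm_bop_apply[of X x] nx by (intro power_mono) (simp_all add: m_def)
      moreover have "(norm (bop_apply X x - l *\<^sub>R x))\<^sup>2 = (norm (bop_apply X x))\<^sup>2 - 2 * (l * t) + l\<^sup>2"
      proof -
        have "(norm (v - l *\<^sub>R x))\<^sup>2 = (norm v)\<^sup>2 - 2 * (l * inner x v) + l\<^sup>2 * (norm x)\<^sup>2" for v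
          unfolding power2_norm_eq_inner inner_diff_left inner_diff_right inner_scaleR_left
            inner_scaleR_right inner_commute[of v x] power2_eq_square[of l] by (simp add: algebra_simps)
        then show ?thesis using nx by (simp add: t_def)
      qed
      ultimately have "(norm (bop_apply X x - l *\<^sub>R x))\<^sup>2 \<le> 2 * m\<^sup>2 - 2 * m * \<bar>t\<bar>"
        by (simp add: lt l2)
      then have "norm (bop_apply X x - l *\<^sub>R x) \<le> sqrt (2 * m\<^sup>2 - 2 * m * \<bar>t\<bar>)"
        by (rule real_le_rsqrt)
      moreover have "norm (bop_apply (A + B) x) \<le> c"
        using norm_bop_apply[of "A + B" x] nx by (simp add: c_def)
      ultimately have "norm (bop_apply X x - l *\<^sub>R x) * norm (bop_apply (A + B) x)
          \<le> sqrt (2 * m\<^sup>2 - 2 * m * \<bar>t\<bar>) * c"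
        by (intro mult_mono order_trans[OF norm_ge_zero]) auto
      then show "\<bar>inner (bop_apply X x - l *\<^sub>R x) (bop_apply (A + B) x)\<bar>
          \<le> sqrt (2 * m\<^sup>2 - 2 * m * \<bar>t\<bar>) * c"
        by (rule order_trans[OF Cauchy_Schwarz_ineq2])
    qed
    finally show ?thesis by (simp add: t_def)
  qed
  have ex: "\<exists>x. norm x = 1 \<and> m - e < \<bar>inner x (bop_apply X x)\<bar>" if e: "0 < e" "e \<le> m" for e
  proof (rule ccontr)
    assume none: "\<nexists>x. norm x = 1 \<and> m - e < \<bar>inner x (bop_apply X x)\<bar>"
    have "norm X \<le> m - e"
    proof (rule norm_self_adjoint_le[OF saX])
      fix x
      show "\<bar>inner x (bop_apply X x)\<bar> \<le> (m - e) * (norm x)\<^sup>2"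
      proof (cases "x = 0")
        case False
        let ?z = "(1 / norm x) *\<^sub>R x"
        have "norm ?z = 1" using False by simp
        then have "\<bar>inner ?z (bop_apply X ?z)\<bar> \<le> m - e"
          using none not_le by blast
        then show ?thesis
          using False by (simp add: abs_mult field_simps power2_eq_square)
      qed simp
    qed (use e in simp)
    then show False using e by (simp add: m_def)
  qed
  have "m\<^sup>2 \<le> d"
  proof (cases "m = 0")
    case False
    then have m: "0 < m" by (simp add: m_def)
    \<comment> \<open>Along unit vectors whose form tends to \<open>m\<close> in modulus the square
      root in \<open>key\<close> tends to \<open>0\<close>, and \<open>m^2 \<le> d\<close>
      remains.\<close>
    have "\<exists>x. norm x = 1 \<and> m - m / Suc n < \<bar>inner x (bop_apply X x)\<bar>" for n
      by (rule ex) (use m in \<open>simp_all add: field_simps\<close>)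
    then obtain x where x: "\<And>n. norm (x n) = 1"
      and xt: "\<And>n. m - m / Suc n < \<bar>inner (x n) (bop_apply X (x n))\<bar>" by metis
    have le: "m * (m - m / Suc n) \<le> d + sqrt (2 * m * (m / Suc n)) * c" for n
    proof -
      have "m * (m - m / Suc n) \<le> m * \<bar>inner (x n) (bop_apply X (x n))\<bar>"
        using m xt[of n] by (intro mult_left_mono) auto
      also have "\<dots> \<le> d + sqrt (2 * m\<^sup>2 - 2 * m * \<bar>inner (x n) (bop_apply X (x n))\<bar>) * c"
        by (rule key[OF x])
      also have "\<dots> \<le> d + sqrt (2 * m * (m / Suc n)) * c"
      proof (intro add_left_mono mult_right_mono real_sqrt_le_mono)
        show "0 \<le> c" by (simp add: c_def)
        have "2 * m * (m - m / Suc n) \<le> 2 * m * \<bar>inner (x n) (bop_apply X (x n))\<bar>"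
          using m xt[of n] by (intro mult_left_mono) auto
        then show "2 * m\<^sup>2 - 2 * m * \<bar>inner (x n) (bop_apply X (x n))\<bar> \<le> 2 * m * (m / Suc n)"
          by (simp add: power2_eq_square algebra_simps)
      qed
      finally show ?thesis .
    qed
    have inv: "(\<lambda>n. m / Suc n) \<longlonglongrightarrow> 0"
      using tendsto_mult[OF tendsto_const LIMSEQ_inverse_real_of_nat, of m]
      by (simp add: divide_inverse)
    have "(\<lambda>n. m * (m - m / Suc n)) \<longlonglongrightarrow> m * (m - 0)"
      by (intro tendsto_intros inv)
    moreover have "(\<lambda>n. d + sqrt (2 * m * (m / Suc n)) * c) \<longlonglongrightarrow> d + sqrt (2 * m * 0) * c"
      by (intro tendsto_intros inv)
    ultimately have "m * (m - 0) \<le> d + sqrt (2 * m * 0) * c"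
      by (rule LIMSEQ_le) (use le in blast)
    then show ?thesis by (simp add: power2_eq_square)
  qed (simp add: d_def)
  then show ?thesis by (simp add: m_def d_def X_def)
qed

lemma positive_sqrt_unique:
  assumes "positive_op A" "positive_op B" "A * A = B * B"
  shows "A = B"
  using norm_diff_squared_le[OF assms(1,2)] assms(3) by simp

lemma positive_sqrt_eqI:
  assumes "positive_op S" "S * S = P"
  shows "positive_sqrt P = S"
  unfolding positive_sqrt_def
  by (rule the_equality) (use assms positive_sqrt_unique in auto)

lemma norm_power_bop_le: "norm (T :: 'h::chilbert_space bop) \<le> 1 \<Longrightarrow> norm (T ^ n) \<le> 1"
proof (induction n)
  case (Suc n)
  have "norm (T ^ Suc n) \<le> norm T * norm (T ^ n)" by (simp add: norm_mult_ineq)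
  also have "\<dots> \<le> 1 * 1" using Suc by (intro mult_mono) auto
  finally show ?case by simp
qed (simp add: norm_one_bop_le)

text \<open>Neumann series: on unit vectors the form of \<open>1 - c T\<close> lies between
  \<open>0\<close> and \<open>1 - c u\<close>, so the norm is below one. The choice
  \<open>c = 1 / (norm T + u)\<close> ensures both \<open>c T \<le> 1\<close> and
  \<open>c u \<le> 1\<close>.\<close>

lemma strictly_positive_op_invertible:
  fixes T :: "'h::chilbert_space bop"
  assumes "positive_op (T - u *\<^sub>R 1)" "0 < u"
  shows "\<exists>Z. T * Z = 1 \<and> Z * T = 1"
proof -
  have saT: "star T = T"
    using positive_op_self_adjoint[OF assms(1)] by (simp add: star_diff star_scaleR)
  have low: "u * (norm x)\<^sup>2 \<le> inner x (bop_apply T x)" for x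
    using positive_op_inner[OF assms(1), of x] by (simp add: inner_diff_right power2_norm_eq_inner)
  have up: "inner x (bop_apply T x) \<le> norm T * (norm x)\<^sup>2" for x
    using norm_cauchy_schwarz[of x "bop_apply T x"]
      mult_left_mono[OF norm_bop_apply[of T x], of "norm x"]
    by (simp add: power2_eq_square mult_ac)
  define c where "c = 1 / (norm T + u)"
  have pos: "0 < norm T + u" using assms(2) by (simp add: add_nonneg_pos)
  then have c: "0 < c" "c * norm T \<le> 1" "c * u \<le> 1"
    using assms(2) by (simp_all add: c_def)
  define W where "W = 1 - c *\<^sub>R T"
  define q where "q = 1 - c * u"
  have q: "0 \<le> q" "q < 1" using c assms(2) by (simp_all add: q_def)
  have nW: "norm W \<le> q"
  proof (rule norm_self_adjoint_le)
    fix x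
    have "c * inner x (bop_apply T x) \<le> c * (norm T * (norm x)\<^sup>2)"
      using up c by (intro mult_left_mono) auto
    also have "\<dots> \<le> 1 * (norm x)\<^sup>2"
      unfolding mult.assoc[symmetric] by (intro mult_right_mono c) simp
    finally have "c * inner x (bop_apply T x) \<le> (norm x)\<^sup>2" by simp
    moreover have "c * (u * (norm x)\<^sup>2) \<le> c * inner x (bop_apply T x)"
      using low c by (intro mult_left_mono) auto
    ultimately show "\<bar>inner x (bop_apply W x)\<bar> \<le> q * (norm x)\<^sup>2"
      by (simp add: W_def q_def inner_diff_right power2_norm_eq_inner[symmetric] algebra_simps)
  qed (use saT q in \<open>simp_all add: W_def star_diff star_scaleR\<close>)
  have nWn: "norm (W ^ n) \<le> q ^ n" for n
  proof (induction n)
    case (Suc n)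
    have "norm (W ^ Suc n) \<le> norm W * norm (W ^ n)" by (simp add: norm_mult_ineq)
    also have "\<dots> \<le> q * q ^ n" using Suc nW q by (intro mult_mono) auto
    finally show ?case by simp
  qed (simp add: norm_one_bop_le)
  have sm: "summable (\<lambda>n. W ^ n)"
    by (rule summable_comparison_test'[OF summable_geometric[of q] nWn]) (use q in simp)
  define Y where "Y = (\<Sum>n. W ^ n)"
  have split: "Y = 1 + (\<Sum>n. W ^ Suc n)"
    using suminf_split_head[OF sm] by (simp add: Y_def)
  have l: "Y = 1 + W * Y"
    by (subst split) (simp add: Y_def suminf_mult[OF sm])
  have r: "Y = 1 + Y * W"
    by (subst split) (simp add: Y_def suminf_mult2[OF sm] power_commutes)
  have "c *\<^sub>R T * Y = 1" using l by (simp add: W_def algebra_simps)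
  moreover have "Y * (c *\<^sub>R T) = 1" using r by (simp add: W_def algebra_simps)
  ultimately show ?thesis by (intro exI[of _ "c *\<^sub>R Y"]) simp
qed

section \<open>Commutants\<close>

lemma commutantD: "T \<in> commutant S \<Longrightarrow> X \<in> S \<Longrightarrow> T * X = X * T"
  by (simp add: commutant_def)

lemma commutant_zero: "0 \<in> commutant S"
  and commutant_one: "1 \<in> commutant S"
  by (simp_all add: commutant_def)

lemma commutant_add: "X \<in> commutant S \<Longrightarrow> Y \<in> commutant S \<Longrightarrow> X + Y \<in> commutant S"
  by (simp add: commutant_def distrib_left distrib_right)

lemma commutant_diff: "X \<in> commutant S \<Longrightarrow> Y \<in> commutant S \<Longrightarrow> X - Y \<in> commutant S"
  by (simp add: commutant_def left_diff_distrib right_diff_distrib)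

lemma commutant_scaleR: "X \<in> commutant S \<Longrightarrow> r *\<^sub>R X \<in> commutant S"
  by (simp add: commutant_def)

lemma commutant_scaleC: "X \<in> commutant S \<Longrightarrow> c *\<^sub>C X \<in> commutant S"
  by (simp add: commutant_def scaleC_mult_left scaleC_mult_right)

lemma commutant_mult: "X \<in> commutant S \<Longrightarrow> Y \<in> commutant S \<Longrightarrow> X * Y \<in> commutant S"
  by (simp add: commutant_def) (metis mult.assoc)

lemma commutant_power: "X \<in> commutant S \<Longrightarrow> X ^ n \<in> commutant S"
  by (induction n) (simp_all add: commutant_one commutant_mult)

lemmas commutant_intros =
  commutant_zero commutant_one commutant_add commutant_diff commutant_scaleR commutant_mult
  commutant_power

lemma commutant_inverse:
  assumes "T \<in> commutant S" "T * Z = 1" "Z * T = 1"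
  shows "Z \<in> commutant S"
  unfolding commutant_def
proof (intro CollectI ballI)
  fix X assume "X \<in> S"
  have "Z * X = Z * (X * T) * Z"
    using assms(2) by (simp add: mult.assoc)
  also have "\<dots> = X * Z"
    using assms(3) commutantD[OF assms(1) \<open>X \<in> S\<close>] by (metis mult.assoc mult_1)
  finally show "Z * X = X * Z" .
qed

lemma commutant_antimono: "S \<subseteq> S' \<Longrightarrow> commutant S' \<subseteq> commutant S"
  by (auto simp: commutant_def)

lemma subset_double_commutant: "S \<subseteq> commutant (commutant S)"
  by (auto simp: commutant_def)

text \<open>Allows iteration: what is built from an operator that was itself built from
  \<open>P\<close> stays in the bicommutant of \<open>P\<close>.\<close>

lemma double_commutant_singleton_subset:
  "Q \<in> commutant (commutant S) \<Longrightarrow> commutant (commutant {Q}) \<subseteq> commutant (commutant S)"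
  by (rule commutant_antimono) (auto simp: commutant_def)

lemma double_commutant_self: "P \<in> commutant (commutant {P})"
  using subset_double_commutant[of "{P}"] by simp

text \<open>\<open>P\<close> commutes with itself, so the bicommutant of \<open>P\<close> is
  contained in the commutant of \<open>P\<close>. It is the commutative algebra in which factors may
  be reordered freely later on.\<close>

lemma double_commutant_commute:
  assumes "X \<in> commutant (commutant {P})" "Y \<in> commutant (commutant {P})"
  shows "X * Y = Y * X"
proof (rule commutantD[OF assms(1)])
  show "Y \<in> commutant {P}"
    using assms(2) by (auto simp: commutant_def)
qed

lemma convex_commutant: "convex (commutant S)"
  by (rule convexI) (intro commutant_add commutant_scaleR)

lemma closed_commutant: "closed (commutant S)"
  unfolding closed_sequential_limits
proof (intro allI impI, elim conjE)
  fix f :: "nat \<Rightarrow> 'a bop" and T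
  assume f: "\<forall>n. f n \<in> commutant S" and lim: "f \<longlonglongrightarrow> T"
  have "T * X = X * T" if "X \<in> S" for X
  proof (rule LIMSEQ_unique)
    show "(\<lambda>n. f n * X) \<longlonglongrightarrow> T * X"
      by (intro tendsto_intros lim)
    have "(\<lambda>n. X * f n) \<longlonglongrightarrow> X * T"
      by (intro tendsto_intros lim)
    moreover have "f n * X = X * f n" for n
      using f that by (blast intro: commutantD)
    ultimately show "(\<lambda>n. f n * X) \<longlonglongrightarrow> X * T" by simp
  qed
  then show "T \<in> commutant S" by (simp add: commutant_def)
qed

section \<open>Square roots\<close>

lemma inverse_self_adjoint:
  fixes T :: "'h::chilbert_space bop"
  assumes "star T = T" "T * Z = 1"
  shows "star Z = Z"
  using assms by (metis mult.assoc mult.right_neutral mult_1 star_mult star_one)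

lemma norm_inverse_strictly_positive_op:
  assumes "positive_op (T - u *\<^sub>R 1)" "0 < u" "T * Z = 1"
  shows "norm Z \<le> 1 / u"
proof (rule norm_bop_bound)
  fix y
  define x where "x = bop_apply Z y"
  have y: "y = bop_apply T x"
    using assms(3) by (metis x_def bop_apply_simps(2,7))
  have "u * (norm x * norm x) \<le> inner x (bop_apply T x)"
    using positive_op_inner[OF assms(1), of x]
    by (simp add: inner_diff_right power2_eq_square[symmetric] power2_norm_eq_inner)
  also have "\<dots> \<le> norm x * norm (bop_apply T x)"
    by (rule norm_cauchy_schwarz)
  finally have "norm x * (u * norm x) \<le> norm x * norm y"
    by (simp add: y mult_ac)
  then have "u * norm x \<le> norm y"
    by (cases "x = 0") (auto simp: mult_le_cancel_left)
  then show "norm (bop_apply Z y) \<le> 1 / u * norm y"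
    using assms(2) by (simp add: x_def field_simps)
qed (use assms in simp)

lemma self_adjoint_power: "star (T :: 'h::chilbert_space bop) = T \<Longrightarrow> star (T ^ n) = T ^ n"
  by (induction n) (simp_all add: star_mult power_commutes)

text \<open>Even powers sandwich \<open>X\<close>, odd powers sandwich \<open>Y * X\<close>. The
  parity split avoids the square root of \<open>Y\<close>, whose existence is proved only later and
  with the help of this lemma.\<close>

lemma positive_op_conj_power:
  fixes Y :: "'h::chilbert_space bop"
  assumes Y: "positive_op Y" and X: "positive_op X" "positive_op (Y * X)" and com: "Y * X = X * Y"
  shows "positive_op (Y ^ n * X)"
proof -
  have sa: "star (Y ^ i) = Y ^ i" for i
    by (rule self_adjoint_power[OF positive_op_self_adjoint[OF Y]])
  have com': "Y ^ i * X = X * Y ^ i" for i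
    by (rule power_commuting_commutes[OF com])
  have ev: "Y ^ (i + i) * X = Y ^ i * X * Y ^ i" for i
  proof -
    have "Y ^ (i + i) * X = Y ^ i * (Y ^ i * X)" by (simp add: power_add mult.assoc)
    then show ?thesis by (metis com' mult.assoc)
  qed
  have od: "Y ^ Suc (i + i) * X = Y ^ i * (Y * X) * Y ^ i" for i
  proof -
    have "Y ^ Suc (i + i) * X = (Y * Y ^ i) * (Y ^ i * X)"
      by (simp add: power_add mult.assoc)
    then show ?thesis by (metis com' power_commutes mult.assoc)
  qed
  show ?thesis
  proof (cases "even n")
    case True
    then obtain i where "n = i + i" by (metis evenE mult_2)
    then show ?thesis
      using positive_op_conj_self_adjoint[OF X(1) sa[of i]] by (simp only: ev)
  next
    case False
    then obtain i where "n = Suc (i + i)" by (metis oddE mult_2 Suc_eq_plus1)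
    then show ?thesis
      using positive_op_conj_self_adjoint[OF X(2) sa[of i]] by (simp only: od)
  qed
qed

text \<open>With \<open>Y = 1 - P\<close> the terms \<open>Y\<^sup>j P\<close> decrease in \<open>j\<close> and the first \<open>n + 1\<close> of them
  telescope to \<open>1 - Y\<^bsup>n+1\<^esup> \<le> 1\<close>.\<close>

lemma norm_power_mult_le:
  fixes P :: "'h::chilbert_space bop"
  assumes P: "positive_op P" "positive_op (1 - P)"
  shows "norm ((1 - P) ^ n * P) \<le> 1 / Suc n"
proof -
  define Y where "Y = 1 - P"
  have saP: "star P = P" and saY: "star Y = Y"
    using P positive_op_self_adjoint by (auto simp: Y_def)
  have Y: "positive_op Y" using P(2) by (simp add: Y_def)
  have YP: "Y * P = P * Y" by (simp add: Y_def algebra_simps)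
  \<comment> \<open>Since \<open>Y + P = 1\<close>, the product of these two commuting positive
    operators is a sum of sandwiches, so it is positive without any square root.\<close>
  have split: "Y * P = Y * P * Y + P * Y * P"
    by (simp add: Y_def algebra_simps)
  have posYP: "positive_op (Y * P)"
    by (subst split) (intro positive_op_add positive_op_conj_self_adjoint P Y saP saY)
  have posn: "positive_op (Y ^ n * X)"
    if "positive_op X" "positive_op (Y * X)" "Y * X = X * Y" for n X
    by (rule positive_op_conj_power[OF Y that])
  have pow: "positive_op (Y ^ n)" for n
    using posn[OF positive_op_one] Y by simp
  have f: "positive_op (Y ^ n * P)" for n
    by (rule posn[OF P(1) posYP YP])
  have dec: "positive_op (Y ^ n * P - Y ^ Suc n * P)" for n
  proof -
    have "Y ^ n * P - Y ^ Suc n * P = P * Y ^ n * P"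
    proof -
      have "Y ^ n * P = P * Y ^ n"
        by (rule power_commuting_commutes[OF YP])
      moreover have "Y ^ Suc n = Y ^ n - Y ^ n * P"
        by (simp add: power_Suc2 del: power_Suc) (simp add: Y_def algebra_simps)
      moreover have "Y ^ n * P - (Y ^ n - Y ^ n * P) * P = Y ^ n * P * P"
        by (simp add: algebra_simps)
      ultimately show ?thesis by metis
    qed
    then show ?thesis
      using positive_op_conj_self_adjoint[OF pow saP] by simp
  qed
  have tele: "(\<Sum>j<m. Y ^ j * P) = 1 - Y ^ m" for m
  proof (induction m)
    case (Suc m)
    have "Y ^ Suc m = Y ^ m - Y ^ m * P"
      by (simp add: power_Suc2 del: power_Suc) (simp add: Y_def algebra_simps)
    then show ?case using Suc by simp
  qed simp
  have mono: "positive_op (Y ^ j * P - Y ^ n * P)" if "j \<le> n" for j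
    using that
  proof (induction n rule: dec_induct)
    case (step n)
    then show ?case
      using positive_op_add[OF step.IH dec[of n]] by simp
  qed (simp add: positive_op_zero)
  have "positive_op (\<Sum>j\<in>K. Y ^ j * P - Y ^ n * P)" if "finite K" "K \<subseteq> {..n}" for K
    using that by (induction K) (auto intro!: positive_op_add mono simp: positive_op_zero)
  then have "positive_op ((\<Sum>j<Suc n. Y ^ j * P - Y ^ n * P))"
    by (metis finite_lessThan lessThan_Suc_atMost order_refl)
  then have "positive_op ((\<Sum>j<Suc n. Y ^ j * P) - real (Suc n) *\<^sub>R (Y ^ n * P))"
    by (simp only: sum_subtractf sum_constant_scaleR card_lessThan)
  then have "positive_op ((1 - real (Suc n) *\<^sub>R (Y ^ n * P) - Y ^ Suc n) + Y ^ Suc n)"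
    by (intro positive_op_add pow) (simp only: tele algebra_simps)
  then have "positive_op ((1 / Suc n) *\<^sub>R (1 - real (Suc n) *\<^sub>R (Y ^ n * P)))"
    by (intro positive_op_scaleR) simp_all
  then have "positive_op ((1 / Suc n) *\<^sub>R 1 - Y ^ n * P)"
    by (simp add: scaleR_right_diff_distrib)
  then show ?thesis
    unfolding Y_def[symmetric] by (intro norm_positive_op_le f) simp_all
qed

text \<open>The operators \<open>P (u + (1 - u) P)\<^sup>-\<^sup>1\<close> with \<open>0 < u \<le> 1\<close>. For \<open>P = (1 + D\<^sup>2)\<^sup>-\<^sup>1\<close> these are
  \<open>(1 + u D\<^sup>2)\<^sup>-\<^sup>1\<close>.\<close>

definition rescalings :: "'h::chilbert_space bop \<Rightarrow> 'h bop set" where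
  "rescalings P = {X. \<exists>u. 0 < u \<and> u \<le> 1 \<and> X * (u *\<^sub>R 1 + (1 - u) *\<^sub>R P) = P}"

lemma convex_combination_invertible:
  assumes "positive_op P" "0 < u" "u \<le> 1"
  obtains V where "(u *\<^sub>R 1 + (1 - u) *\<^sub>R P) * V = 1" "V * (u *\<^sub>R 1 + (1 - u) *\<^sub>R P) = 1"
    "V \<in> commutant (commutant {P})" "star V = V"
proof -
  let ?Q = "u *\<^sub>R 1 + (1 - u) *\<^sub>R P"
  have "positive_op (?Q - u *\<^sub>R 1)"
    using assms by (simp add: positive_op_scaleR)
  from strictly_positive_op_invertible[OF this assms(2)]
  obtain V where V: "?Q * V = 1" "V * ?Q = 1" by blast
  have "?Q \<in> commutant (commutant {P})"
    by (intro commutant_intros double_commutant_self)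
  then have "V \<in> commutant (commutant {P})"
    by (rule commutant_inverse) (rule V)+
  moreover have "star ?Q = ?Q"
    using assms(1) by (simp add: positive_op_self_adjoint star_add star_scaleR)
  then have "star V = V"
    by (rule inverse_self_adjoint) (rule V)
  ultimately show ?thesis using that V by blast
qed

lemma rescalings_double_commutant:
  assumes "positive_op P"
  shows "rescalings P \<subseteq> commutant (commutant {P})"
proof
  fix X assume "X \<in> rescalings P"
  then obtain u where u: "0 < u" "u \<le> 1" and X: "X * (u *\<^sub>R 1 + (1 - u) *\<^sub>R P) = P"
    by (auto simp: rescalings_def)
  obtain V where V: "(u *\<^sub>R 1 + (1 - u) *\<^sub>R P) * V = 1" "V \<in> commutant (commutant {P})"
    using convex_combination_invertible[OF assms u] by blast
  have "X = P * V"
    using X V(1) by (metis mult.assoc mult.right_neutral)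
  then show "X \<in> commutant (commutant {P})"
    using V(2) by (simp add: commutant_mult double_commutant_self)
qed

lemma rescalings_positive:
  assumes P: "positive_op P"
  shows "rescalings P \<subseteq> {X. positive_op X}"
proof
  fix X assume "X \<in> rescalings P"
  then obtain u where u: "0 < u" "u \<le> 1" and X: "X * (u *\<^sub>R 1 + (1 - u) *\<^sub>R P) = P"
    by (auto simp: rescalings_def)
  let ?Q = "u *\<^sub>R 1 + (1 - u) *\<^sub>R P"
  obtain V where V: "?Q * V = 1" "V * ?Q = 1" "star V = V"
    using convex_combination_invertible[OF P u] by blast
  have "X = P * V"
    using X V(1) by (metis mult.assoc mult.right_neutral)
  also have "\<dots> = V * (?Q * P) * V"
    using V(2) by (metis mult.assoc mult_1)
  also have "?Q * P = u *\<^sub>R P + (1 - u) *\<^sub>R (P * P)"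
    by (simp add: algebra_simps)
  finally have "X = V * (u *\<^sub>R P + (1 - u) *\<^sub>R (P * P)) * V" .
  moreover have "positive_op (V * (u *\<^sub>R P + (1 - u) *\<^sub>R (P * P)) * V)"
    using u positive_op_square[OF positive_op_self_adjoint[OF P]]
    by (intro positive_op_conj_self_adjoint positive_op_add positive_op_scaleR P V) auto
  ultimately show "X \<in> {X. positive_op X}" by simp
qed

lemma commuting_power_mult:
  fixes x y :: "'a::monoid_mult"
  assumes "x * y = y * x"
  shows "(x * y) ^ n = x ^ n * y ^ n"
proof (induction n)
  case (Suc n)
  have "(x * y) ^ Suc n = x * (y * x ^ n) * y ^ n"
    by (simp add: Suc mult.assoc)
  also have "y * x ^ n = x ^ n * y"
    by (rule power_commuting_commutes[symmetric]) (rule assms)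
  finally show ?case by (simp add: mult.assoc)
qed simp

text \<open>Double-angle formula: with \<open>P = tanh\<^sup>2 \<xi>\<close> the operator \<open>P' = 4P(1 + P)\<^sup>-\<^sup>2\<close> is \<open>tanh\<^sup>2 2\<xi>\<close>, and a
  rescaling of \<open>P'\<close> splits into the average of two rescalings of \<open>P\<close> by partial fractions.\<close>

lemma rescalings_doubling:
  assumes P: "positive_op P" and P': "(1 + P) * (1 + P) * P' = 4 *\<^sub>R P"
    and P'c: "P' \<in> commutant (commutant {P})" and pos': "positive_op P'"
    and X': "X' \<in> rescalings P'"
  shows "(1/2) *\<^sub>R ((1 + P) * X') \<in> convex hull (rescalings P)"
proof -
  obtain w where w: "0 < w" "w \<le> 1" and X'w: "X' * (w *\<^sub>R 1 + (1 - w) *\<^sub>R P') = P'"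
    using X' by (auto simp: rescalings_def)
  \<comment> \<open>The root of \<open>4 u (1 - u) = w\<close>. With \<open>Q1 + Q2 = T\<close> and
    \<open>4 Q1 Q2 = T^2 (w + (1 - w) P')\<close> the two parameters \<open>u\<close> and
    \<open>1 - u\<close> give the partial fractions \<open>T X' = P / Q1 + P / Q2\<close>.\<close>
  define u where "u = (1 - sqrt (1 - w)) / 2"
  have s: "0 \<le> sqrt (1 - w)" "sqrt (1 - w) < 1" "(sqrt (1 - w))\<^sup>2 = 1 - w"
    using w by auto
  have half: "0 < u" "2 * u \<le> 1"
    using s(1,2) by (simp_all add: u_def)
  have u: "0 < u" "u \<le> 1" "0 < 1 - u" "1 - u \<le> 1"
    using half by simp_all
  have uw: "4 * (u * (1 - u)) = w"
    using s(3) by (simp add: u_def power2_eq_square field_simps)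
  define T where "T = 1 + P"
  define Q1 where "Q1 = u *\<^sub>R 1 + (1 - u) *\<^sub>R P"
  define Q2 where "Q2 = (1 - u) *\<^sub>R 1 + u *\<^sub>R P"
  obtain V1 where V1: "Q1 * V1 = 1" "V1 * Q1 = 1" "V1 \<in> commutant (commutant {P})"
    using convex_combination_invertible[OF P u(1,2)] by (metis Q1_def)
  obtain V2 where V2: "Q2 * V2 = 1" "V2 * Q2 = 1" "V2 \<in> commutant (commutant {P})"
    using convex_combination_invertible[OF P u(3,4)] by (auto simp: Q2_def)
  have mem: "T \<in> commutant (commutant {P})" "Q1 \<in> commutant (commutant {P})"
    "Q2 \<in> commutant (commutant {P})" "P \<in> commutant (commutant {P})"
    unfolding T_def Q1_def Q2_def by (intro commutant_intros double_commutant_self)+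
  have TT: "T * T * P' = 4 *\<^sub>R P" using P' by (simp add: T_def)
  have X'c: "X' \<in> commutant (commutant {P})"
    using rescalings_double_commutant[OF pos'] X' double_commutant_singleton_subset[OF P'c] by blast
  note com = double_commutant_commute[of _ P]
  have Q12: "4 *\<^sub>R (Q1 * Q2) = w *\<^sub>R (T * T) + (4 * (1 - w)) *\<^sub>R P"
  proof -
    have "Q1 * Q2 = (u * (1 - u)) *\<^sub>R 1 + (u * u + (1 - u) * (1 - u)) *\<^sub>R P + (u * (1 - u)) *\<^sub>R (P * P)"
      by (simp add: Q1_def Q2_def distrib_left distrib_right scaleR_add_left scaleR_add_right
          mult.commute add_ac)
    then have "4 *\<^sub>R (Q1 * Q2) = (4 * (u * (1 - u))) *\<^sub>R 1
        + (4 * (u * u + (1 - u) * (1 - u))) *\<^sub>R P + (4 * (u * (1 - u))) *\<^sub>R (P * P)"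
      by (simp only: scaleR_add_right scaleR_scaleR)
    moreover have "4 * (u * u + (1 - u) * (1 - u)) = 4 - 2 * (4 * (u * (1 - u)))"
      by (simp add: algebra_simps)
    moreover have "w *\<^sub>R (T * T) = w *\<^sub>R 1 + (2 * w) *\<^sub>R P + w *\<^sub>R (P * P)"
      by (simp add: T_def distrib_left distrib_right scaleR_add_right scaleR_2[symmetric] add_ac
          flip: scaleR_scaleR)
    moreover have "(4 - 2 * w) *\<^sub>R P = (2 * w) *\<^sub>R P + (4 * (1 - w)) *\<^sub>R P"
      by (simp add: scaleR_add_left[symmetric])
    ultimately show ?thesis
      unfolding uw by simp
  qed
  also have "\<dots> = (w *\<^sub>R 1 + (1 - w) *\<^sub>R P') * (T * T)"
    using com[OF commutant_mult[OF mem(1,1)] P'c] TT by (simp add: algebra_simps)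
  finally have "X' * (4 *\<^sub>R (Q1 * Q2)) = P' * (T * T)"
    using X'w by (metis mult.assoc)
  also have "\<dots> = 4 *\<^sub>R P"
    using com[OF commutant_mult[OF mem(1,1)] P'c] TT by simp
  finally have XQ: "X' * (Q1 * Q2) = P" by simp
  have "X' = X' * (Q1 * Q2) * (V2 * V1)"
    using V1 V2 by (metis mult.assoc mult.right_neutral)
  then have X'eq: "X' = P * (V2 * V1)" by (simp add: XQ)
  have "T * X' = P * T * (V2 * V1)"
    unfolding X'eq using com[OF mem(1,4)] by (simp add: mult.assoc[symmetric])
  also have "P * T * (V2 * V1) = P * (Q1 * (V2 * V1)) + P * (Q2 * (V2 * V1))"
  proof -
    have "T = Q1 + Q2" by (simp add: T_def Q1_def Q2_def algebra_simps)
    then show ?thesis by (simp add: distrib_left distrib_right mult.assoc)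
  qed
  also have "Q2 * (V2 * V1) = V1"
    using V2(1) by (simp add: mult.assoc[symmetric])
  also have "Q1 * (V2 * V1) = V2"
    using V1(1) com[OF V2(3) V1(3)] by (simp add: mult.assoc[symmetric])
  finally have "(1/2) *\<^sub>R (T * X') = (1/2) *\<^sub>R (P * V2) + (1/2) *\<^sub>R (P * V1)"
    by (simp add: scaleR_add_right)
  moreover have "P * V1 \<in> rescalings P"
    unfolding rescalings_def using u V1(2) Q1_def by (force simp: mult.assoc)
  moreover have "P * V2 \<in> rescalings P"
    unfolding rescalings_def using u V2(2) Q2_def
    by (auto simp: mult.assoc intro!: exI[of _ "1 - u"])
  ultimately show ?thesis
    unfolding T_def
    by (metis convexD[OF convex_convex_hull] hull_inc half_gt_zero_iff less_imp_le zero_less_one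
        field_sum_of_halves)
qed

text \<open>For \<open>P = tanh\<^sup>2 \<xi>\<close> the induction builds
  \<open>y = tanh \<xi> tanh (2^k \<xi>)\<close>, starting from \<open>y = P\<close>. The factor
  \<open>(1 + P) / 2\<close> takes the root of \<open>P'\<close> to the root of \<open>P\<close> and
  likewise \<open>y'\<close> to \<open>y\<close>. The remainder keeps both factors \<open>P\<close>
  and \<open>(1 - P)^(2^k)\<close>, so it is small even where \<open>P\<close> is close to
  \<open>0\<close>.\<close>

lemma approximate_sqrt:
  assumes "positive_op P" "positive_op (1 - P)"
  shows "\<exists>y \<in> convex hull (rescalings P). \<exists>C \<in> commutant (commutant {P}).
    norm C \<le> 1 \<and> P - y * y = P * (1 - P) ^ (2 ^ k) * C"
  using assms
proof (induction k arbitrary: P)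
  case 0
  have "P \<in> rescalings P"
    by (auto simp: rescalings_def intro!: exI[of _ 1])
  then have "P \<in> convex hull (rescalings P)" by (rule hull_inc)
  then show ?case
    by (intro bexI[of _ P] bexI[of _ 1]) (simp_all add: norm_one_bop_le commutant_one algebra_simps)
next
  case (Suc k)
  define T where "T = 1 + P"
  note saP = positive_op_self_adjoint[OF Suc.prems(1)]
  have T1: "positive_op (T - 1 *\<^sub>R 1)" using Suc.prems(1) by (simp add: T_def)
  from strictly_positive_op_invertible[OF T1] obtain Z where Z: "T * Z = 1" "Z * T = 1" by auto
  \<comment> \<open>The bound allows all powers of \<open>Z\<close> to be absorbed into the
    contraction \<open>C\<close>.\<close>
  have nZ: "norm Z \<le> 1" using norm_inverse_strictly_positive_op[OF T1 _ Z(1)] by simp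
  have saT: "star T = T" by (simp add: T_def star_add saP)
  have saZ: "star Z = Z" by (rule inverse_self_adjoint[OF saT Z(1)])
  have mem: "P \<in> commutant (commutant {P})" "T \<in> commutant (commutant {P})"
    "1 - P \<in> commutant (commutant {P})"
    unfolding T_def by (intro commutant_intros double_commutant_self)+
  have Zc: "Z \<in> commutant (commutant {P})"
    by (rule commutant_inverse[OF mem(2) Z])
  note com = double_commutant_commute[of _ P]
  define P' where "P' = 4 *\<^sub>R (Z * P * Z)"
  have P'c: "P' \<in> commutant (commutant {P})"
    unfolding P'_def by (intro commutant_intros mem Zc)
  have posP': "positive_op P'"
    unfolding P'_def by (intro positive_op_scaleR positive_op_conj_self_adjoint Suc.prems saZ) simp
  have TTP': "T * T * P' = 4 *\<^sub>R P"
  proof -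
    have "T * T * (Z * P * Z) = T * (T * Z) * (P * Z)" by (simp add: mult.assoc)
    also have "\<dots> = P * (T * Z)" using Z(1) com[OF mem(2,1)] by (metis mult.assoc mult.right_neutral)
    finally show ?thesis by (simp add: P'_def Z)
  qed
  define W where "W = (1 - P) * Z"
  have W': "W = Z * (1 - P)" unfolding W_def by (rule com[OF mem(3) Zc])
  have saW: "star W = W"
    by (subst W_def) (simp add: star_mult star_diff saP saZ W')
  \<comment> \<open>From \<open>(1 + P)^2 - 4 P = (1 - P)^2\<close>. This square is what turns the
    exponent \<open>2^k\<close> for \<open>P'\<close> into \<open>2^(k+1)\<close> for
    \<open>P\<close>.\<close>
  have P'W: "1 - P' = W * W"
  proof -
    have e: "T * T * (1 - P') = (1 - P) * (1 - P)"
    proof -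
      have "4 *\<^sub>R P = (1 + 1 + 1 + 1) *\<^sub>R P" by simp
      also have "\<dots> = P + P + P + P" by (simp only: scaleR_add_left scaleR_one)
      finally show ?thesis
        unfolding right_diff_distrib[of "T * T"] TTP' by (simp add: T_def algebra_simps)
    qed
    have "1 - P' = Z * (Z * T) * T * (1 - P')" using Z by simp
    also have "\<dots> = Z * (Z * (T * T * (1 - P')))" by (simp add: mult.assoc)
    also have "\<dots> = Z * (Z * (1 - P)) * (1 - P)" unfolding e by (simp add: mult.assoc)
    also have "\<dots> = W * W"
      using W' W_def by (metis mult.assoc)
    finally show ?thesis .
  qed
  have pos1P': "positive_op (1 - P')"
    unfolding P'W by (rule positive_op_square[OF saW])
  from Suc.IH[OF posP' pos1P'] obtain y' C' where y': "y' \<in> convex hull (rescalings P')"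
    and C': "C' \<in> commutant (commutant {P'})" "norm C' \<le> 1"
    and eq: "P' - y' * y' = P' * (1 - P') ^ (2 ^ k) * C'" by blast
  have sub: "commutant (commutant {P'}) \<subseteq> commutant (commutant {P})"
    by (rule double_commutant_singleton_subset[OF P'c])
  have y'c: "y' \<in> commutant (commutant {P})"
    using y' hull_minimal[OF rescalings_double_commutant[OF posP'], of convex] convex_commutant sub
    by blast
  define y where "y = (1/2) *\<^sub>R (T * y')"
  have y: "y \<in> convex hull (rescalings P)"
  proof -
    have lin: "linear (\<lambda>X. (1/2) *\<^sub>R (T * X))"
      by (rule linearI) (simp_all add: algebra_simps)
    have "y \<in> (\<lambda>X. (1/2) *\<^sub>R (T * X)) ` (convex hull (rescalings P'))"
      unfolding y_def using y' by (rule imageI)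
    also have "\<dots> = convex hull ((\<lambda>X. (1/2) *\<^sub>R (T * X)) ` rescalings P')"
      by (rule convex_hull_linear_image[OF lin])
    also have "\<dots> \<subseteq> convex hull (rescalings P)"
      using rescalings_doubling[OF Suc.prems(1) _ P'c posP'] TTP'
      by (intro hull_minimal) (auto simp: T_def)
    finally show ?thesis .
  qed
  have "T * y' = y' * T" by (rule com[OF mem(2) y'c])
  then have "y * y = (1/4) *\<^sub>R (T * T * (y' * y'))"
    by (simp add: y_def mult.assoc) (metis mult.assoc)
  moreover have "P = (1/4) *\<^sub>R (T * T * P')" using TTP' by simp
  ultimately have "P - y * y = (1/4) *\<^sub>R (T * T * (P' - y' * y'))"
    by (simp add: right_diff_distrib scaleR_right_diff_distrib)
  also have "\<dots> = (1/4) *\<^sub>R (T * T * P') * (W * W) ^ (2 ^ k) * C'"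
    unfolding eq P'W by (simp add: mult.assoc)
  also have "\<dots> = P * (W * W) ^ (2 ^ k) * C'"
    using TTP' by simp
  also have "(W * W) ^ (2 ^ k) = W ^ (2 ^ Suc k)"
    by (simp add: power_mult power2_eq_square)
  also have "\<dots> = (1 - P) ^ (2 ^ Suc k) * Z ^ (2 ^ Suc k)"
    unfolding W_def by (rule commuting_power_mult[OF com[OF mem(3) Zc]])
  finally have "P - y * y = P * (1 - P) ^ (2 ^ Suc k) * (Z ^ (2 ^ Suc k) * C')"
    by (simp add: mult.assoc)
  moreover have "Z ^ (2 ^ Suc k) * C' \<in> commutant (commutant {P})"
    using C'(1) sub by (intro commutant_intros Zc) auto
  moreover have "norm (Z ^ (2 ^ Suc k) * C') \<le> 1"
  proof -
    have "norm (Z ^ (2 ^ Suc k) * C') \<le> norm (Z ^ (2 ^ Suc k)) * norm C'"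
      by (rule norm_mult_ineq)
    also have "\<dots> \<le> 1 * 1"
      by (intro mult_mono norm_power_bop_le nZ C') simp_all
    finally show ?thesis by simp
  qed
  ultimately show ?case using y by blast
qed

text \<open>The squares of the approximants tend to \<open>P\<close> at the rate of
  \<open>norm_power_mult_le\<close>, uniformly even if \<open>P\<close> is not invertible;
  \<open>norm_diff_squared_le\<close> then makes the approximants themselves a Cauchy sequence.
  Membership in the closed hull is recorded for the commutator estimate.\<close>

lemma positive_sqrt_exists:
  assumes "positive_op P" "positive_op (1 - P)"
  shows "\<exists>S. positive_op S \<and> S * S = P \<and> S \<in> commutant (commutant {P}) \<and>
    S \<in> closure (convex hull (rescalings P))"
proof -
  have "\<exists>y \<in> convex hull (rescalings P). norm (P - y * y) \<le> inverse (Suc n)" for n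
  proof -
    obtain y C where y: "y \<in> convex hull (rescalings P)" and C: "norm C \<le> 1"
      and eq: "P - y * y = P * (1 - P) ^ (2 ^ n) * C"
      using approximate_sqrt[OF assms] by blast
    have "P * (1 - P) ^ (2 ^ n) = (1 - P) ^ (2 ^ n) * P"
      by (rule power_commuting_commutes[symmetric]) (simp add: algebra_simps)
    then have "norm (P - y * y) \<le> norm ((1 - P) ^ (2 ^ n) * P) * norm C"
      unfolding eq by (simp only: norm_mult_ineq)
    also have "\<dots> \<le> 1 / Suc (2 ^ n) * 1"
      by (intro mult_mono norm_power_mult_le assms C) simp_all
    also have "\<dots> \<le> inverse (Suc n)"
    proof -
      have "real (Suc n) \<le> real (Suc (2 ^ n))"
        using less_exp[of n] by (simp only: of_nat_le_iff)
      then show ?thesis by (simp add: divide_inverse le_imp_inverse_le del: of_nat_Suc)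
    qed
    finally show ?thesis using y by blast
  qed
  then obtain y where y: "\<And>n. y n \<in> convex hull (rescalings P)"
    and ny: "\<And>n. norm (P - y n * y n) \<le> inverse (Suc n)" by metis
  have posy: "positive_op (y n)" for n
    using y[of n] hull_minimal[OF rescalings_positive[OF assms(1)], of convex] convex_positive_op
    by blast
  have lim2: "(\<lambda>n. y n * y n) \<longlonglongrightarrow> P"
  proof (rule LIM_zero_cancel, rule Lim_null_comparison)
    show "\<forall>\<^sub>F n in sequentially. norm (y n * y n - P) \<le> inverse (Suc n)"
      using ny by (simp add: norm_minus_commute)
  qed (rule LIMSEQ_inverse_real_of_nat)
  have "Cauchy y"
  proof (rule metric_CauchyI)
    fix e :: real assume e: "0 < e"
    from LIMSEQ_imp_Cauchy[OF lim2] e obtain M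
      where M: "\<And>m n. M \<le> m \<Longrightarrow> M \<le> n \<Longrightarrow> dist (y m * y m) (y n * y n) < e\<^sup>2"
      unfolding Cauchy_def by (metis zero_less_power)
    have "dist (y m) (y n) < e" if "M \<le> m" "M \<le> n" for m n
    proof -
      have "(norm (y m - y n))\<^sup>2 < e\<^sup>2"
        using norm_diff_squared_le[OF posy posy, of m n] M[OF that] by (simp add: dist_norm)
      then show ?thesis
        using e by (simp add: dist_norm power_less_imp_less_base)
    qed
    then show "\<exists>M. \<forall>m\<ge>M. \<forall>n\<ge>M. dist (y m) (y n) < e" by blast
  qed
  then obtain S where S: "y \<longlonglongrightarrow> S"
    using Cauchy_convergent_iff convergent_def by blast
  have SS: "S * S = P"
    using LIMSEQ_unique[OF tendsto_mult[OF S S] lim2] .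
  have cl: "S \<in> closure (convex hull (rescalings P))"
    using S y closure_sequential by blast
  have "positive_op S"
    using closed_positive_op S posy closed_sequentially by (metis mem_Collect_eq)
  moreover have "S \<in> commutant (commutant {P})"
  proof -
    have "y n \<in> commutant (commutant {P})" for n
      using y[of n] hull_minimal[OF rescalings_double_commutant[OF assms(1)], of convex]
        convex_commutant by blast
    then show ?thesis using closed_commutant S closed_sequentially by metis
  qed
  ultimately show ?thesis using SS cl by blast
qed

section \<open>Self-adjoint operators\<close>

text \<open>Formulated over the reals so that it applies to the graph of an operator inside the
  product space, which carries only a real inner product here.\<close>

lemma orthogonal_projection_exists:
  fixes V :: "'a::{real_inner,complete_space} set"
  assumes "subspace V" "closed V"
  shows "\<exists>p\<in>V. \<forall>v\<in>V. inner (x - p) v = 0"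
proof -
  define Q where "Q v = (norm (x - v))\<^sup>2" for v
  define m where "m = Inf (Q ` V)"
  have V0: "0 \<in> V" using assms(1) by (rule subspace_0)
  have bdd: "bdd_below (Q ` V)" by (rule bdd_belowI[of _ 0]) (auto simp: Q_def)
  have mle: "m \<le> Q v" if "v \<in> V" for v
    unfolding m_def by (rule cInf_lower[OF _ bdd]) (use that in auto)
  have "\<exists>v\<in>V. Q v < m + inverse (Suc n)" for n
  proof -
    have "Inf (Q ` V) < m + inverse (Suc n)" by (simp add: m_def)
    then show ?thesis
      by (subst (asm) cInf_less_iff[OF _ bdd]) (use V0 in auto)
  qed
  then obtain s where sV: "\<And>n. s n \<in> V" and s: "\<And>n. Q (s n) < m + inverse (Suc n)" by metis
  have par: "(norm (v - w))\<^sup>2 = 2 * Q v + 2 * Q w - 4 * Q ((1/2) *\<^sub>R (v + w))" for v w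
    unfolding Q_def power2_norm_eq_inner
    by (simp add: inner_simps inner_commute[of v x] inner_commute[of w x] inner_commute[of w v]
        algebra_simps)
  have dst: "(norm (s i - s j))\<^sup>2 \<le> 2 * inverse (Suc i) + 2 * inverse (Suc j)" for i j
  proof -
    have "(1/2) *\<^sub>R (s i + s j) \<in> V"
      using assms(1) sV by (intro subspace_scale subspace_add) auto
    then show ?thesis
      using par[of "s i" "s j"] mle[of "(1/2) *\<^sub>R (s i + s j)"] s[of i] s[of j] by linarith
  qed
  have "Cauchy s"
  proof (rule metric_CauchyI)
    fix e :: real assume e: "0 < e"
    have "(\<lambda>n. inverse (real (Suc n))) \<longlonglongrightarrow> 0" by (rule LIMSEQ_inverse_real_of_nat)
    then have "\<forall>\<^sub>F n in sequentially. inverse (real (Suc n)) < e\<^sup>2 / 4"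
      using e by (intro order_tendstoD) auto
    then obtain M where M: "\<And>n. M \<le> n \<Longrightarrow> inverse (real (Suc n)) < e\<^sup>2 / 4"
      unfolding eventually_sequentially by blast
    have "dist (s i) (s j) < e" if "M \<le> i" "M \<le> j" for i j
    proof -
      have "(norm (s i - s j))\<^sup>2 < e\<^sup>2" using dst[of i j] M[OF that(1)] M[OF that(2)] by linarith
      then show ?thesis using e by (simp add: dist_norm power_less_imp_less_base)
    qed
    then show "\<exists>M. \<forall>i\<ge>M. \<forall>j\<ge>M. dist (s i) (s j) < e" by blast
  qed
  then obtain p where p: "s \<longlonglongrightarrow> p"
    using Cauchy_convergent_iff convergent_def by blast
  have pV: "p \<in> V" using assms(2) p sV closed_sequentially by blast
  have "(\<lambda>n. Q (s n)) \<longlonglongrightarrow> Q p"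
    unfolding Q_def by (intro tendsto_intros p)
  moreover have "(\<lambda>n. m + inverse (Suc n)) \<longlonglongrightarrow> m + 0"
    by (intro tendsto_intros LIMSEQ_inverse_real_of_nat)
  ultimately have "Q p \<le> m + 0"
    by (rule LIMSEQ_le) (use s less_imp_le in blast)
  then have Qp: "Q p \<le> m" by simp
  have "inner (x - p) v = 0" if v: "v \<in> V" for v
  proof (rule ccontr)
    assume ne: "inner (x - p) v \<noteq> 0"
    define d where "d = inner (x - p) v"
    have q: "0 \<le> t\<^sup>2 * inner v v - 2 * t * d" for t
    proof -
      have "Q (p + t *\<^sub>R v) = Q p + (t\<^sup>2 * inner v v - 2 * t * d)"
        unfolding Q_def d_def power2_norm_eq_inner
        by (simp add: inner_simps inner_commute[of p x] inner_commute[of v x] inner_commute[of v p]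
            power2_eq_square algebra_simps)
      moreover have "p + t *\<^sub>R v \<in> V"
        using assms(1) pV v by (intro subspace_scale subspace_add) auto
      ultimately show ?thesis using mle Qp by fastforce
    qed
    have pos: "0 < inner v v + 1" by (simp add: add_nonneg_pos)
    define t where "t = d / (inner v v + 1)"
    have t: "t \<noteq> 0" using ne pos by (simp add: t_def d_def)
    have d: "d = t * (inner v v + 1)" using pos by (simp add: t_def)
    have "t\<^sup>2 * inner v v - 2 * t * d = - (t\<^sup>2 * (inner v v + 2))"
      unfolding d by (simp add: power2_eq_square algebra_simps)
    moreover have "0 < t\<^sup>2 * (inner v v + 2)"
      using t pos by (intro mult_pos_pos) auto
    ultimately show False using q[of t] by linarith
  qed
  then show ?thesis using pV by blast
qed

lemma inner_eqI_dense:
  fixes z :: "'a::real_inner"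
  assumes "closure A = UNIV" "\<And>x. x \<in> A \<Longrightarrow> inner x z = inner x z'"
  shows "z = z'"
proof -
  obtain f where f: "\<And>n. f n \<in> A" "f \<longlonglongrightarrow> z - z'"
    using assms(1) closure_sequential[of "z - z'" A] by auto
  have "(\<lambda>n. inner (f n) (z - z')) \<longlonglongrightarrow> inner (z - z') (z - z')"
    by (intro tendsto_intros f)
  moreover have "inner (f n) (z - z') = 0" for n
    using assms(2)[OF f(1)] by (simp add: inner_diff_right)
  ultimately have "inner (z - z') (z - z') = 0"
    using LIMSEQ_unique tendsto_const by fastforce
  then show ?thesis by simp
qed

lemma self_adjoint_opI:
  assumes lin: "linear_op D" and dense: "closure (udom D) = UNIV"
    and sym: "\<And>x y. x \<in> udom D \<Longrightarrow> y \<in> udom D \<Longrightarrow> cinner (uapp D x) y = cinner x (uapp D y)"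
    and max: "\<And>y z. (\<And>x. x \<in> udom D \<Longrightarrow> cinner (uapp D x) y = cinner x z) \<Longrightarrow> y \<in> udom D"
  shows "self_adjoint_op D"
proof -
  have uniq: "z = z'"
    if "\<forall>x\<in>udom D. cinner (uapp D x) y = cinner x z" "\<forall>x\<in>udom D. cinner (uapp D x) y = cinner x z'"
    for y z z'
    by (rule inner_eqI_dense[OF dense]) (use that in \<open>simp add: inner_eq_Re_cinner\<close>)
  have "uapp (adjoint_op D) y = uapp D y" if "y \<in> udom D" for y
    unfolding adjoint_op_def unbounded_op.simps
  proof (rule the_equality)
    show "\<forall>x\<in>udom D. cinner (uapp D x) y = cinner x (uapp D y)"
      using sym that by blast
    then show "z = uapp D y" if "\<forall>x\<in>udom D. cinner (uapp D x) y = cinner x z" for z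
      using uniq[OF that] by blast
  qed
  moreover have "udom (adjoint_op D) = udom D"
    unfolding adjoint_op_def using max sym by auto
  ultimately show ?thesis
    using lin dense by (simp add: self_adjoint_op_def)
qed

locale self_adjoint_operator =
  fixes D :: "'h::chilbert_space unbounded_op"
  assumes self_adjoint: "self_adjoint_op D"
begin

lemma dense_dom: "closure (udom D) = UNIV"
  using self_adjoint by (simp add: self_adjoint_op_def)

lemma dom_zero: "0 \<in> udom D"
  and dom_add: "x \<in> udom D \<Longrightarrow> y \<in> udom D \<Longrightarrow> x + y \<in> udom D"
  and dom_scaleC: "x \<in> udom D \<Longrightarrow> c *\<^sub>C x \<in> udom D"
  and app_add: "x \<in> udom D \<Longrightarrow> y \<in> udom D \<Longrightarrow> uapp D (x + y) = uapp D x + uapp D y"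
  and app_scaleC: "x \<in> udom D \<Longrightarrow> uapp D (c *\<^sub>C x) = c *\<^sub>C uapp D x"
  using self_adjoint by (auto simp: self_adjoint_op_def linear_op_def csubspace_def)

lemma dom_scaleR: "x \<in> udom D \<Longrightarrow> r *\<^sub>R x \<in> udom D"
  and app_scaleR: "x \<in> udom D \<Longrightarrow> uapp D (r *\<^sub>R x) = r *\<^sub>R uapp D x"
  by (simp_all add: scaleR_scaleC dom_scaleC app_scaleC)

lemma dom_diff: "x \<in> udom D \<Longrightarrow> y \<in> udom D \<Longrightarrow> x - y \<in> udom D"
  using dom_add[of x "(-1) *\<^sub>R y"] dom_scaleR[of y "-1"] by simp

lemma app_diff: "x \<in> udom D \<Longrightarrow> y \<in> udom D \<Longrightarrow> uapp D (x - y) = uapp D x - uapp D y"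
  using app_add[of x "(-1) *\<^sub>R y"] dom_scaleR[of y "-1"] app_scaleR[of y "-1"] by simp

lemma app_zero: "uapp D 0 = 0"
  using app_scaleR[OF dom_zero, of 0] by simp

lemma app_eqI:
  assumes "\<And>x. x \<in> udom D \<Longrightarrow> cinner (uapp D x) y = cinner x z"
  shows "y \<in> udom D" "uapp D y = z"
proof -
  have "y \<in> udom (adjoint_op D)"
    using assms by (auto simp: adjoint_op_def)
  then show y: "y \<in> udom D"
    using self_adjoint by (simp add: self_adjoint_op_def)
  have "uapp (adjoint_op D) y = z"
    unfolding adjoint_op_def unbounded_op.simps
  proof (rule the_equality)
    fix z' assume "\<forall>x\<in>udom D. cinner (uapp D x) y = cinner x z'"
    then show "z' = z"
      using assms by (intro inner_eqI_dense[OF dense_dom]) (simp add: inner_eq_Re_cinner)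
  qed (use assms in blast)
  then show "uapp D y = z"
    using self_adjoint y by (simp add: self_adjoint_op_def)
qed

lemma symmetric:
  assumes "x \<in> udom D" "y \<in> udom D"
  shows "cinner (uapp D x) y = cinner x (uapp D y)"
proof -
  have "y \<in> udom (adjoint_op D)"
    using self_adjoint assms by (simp add: self_adjoint_op_def)
  then obtain z where z: "\<And>x. x \<in> udom D \<Longrightarrow> cinner (uapp D x) y = cinner x z"
    by (auto simp: adjoint_op_def)
  then show ?thesis using app_eqI(2)[OF z] assms(1) by simp
qed

lemma symmetric_inner:
  "x \<in> udom D \<Longrightarrow> y \<in> udom D \<Longrightarrow> inner (uapp D x) y = inner x (uapp D y)"
  by (simp add: inner_eq_Re_cinner symmetric)

text \<open>Testing with \<open>\<i> *\<^sub>C x\<close> as well as \<open>x\<close> recovers the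
  imaginary part.\<close>

lemma app_eqI_inner:
  assumes "\<And>x. x \<in> udom D \<Longrightarrow> inner (uapp D x) y = inner x z"
  shows "y \<in> udom D" "uapp D y = z"
proof -
  have "cinner (uapp D x) y = cinner x z" if "x \<in> udom D" for x
    using assms[OF that] assms[OF dom_scaleC[OF that, of \<i>]]
    by (intro complex_eqI) (simp_all add: app_scaleC[OF that] Im_cinner flip: inner_eq_Re_cinner)
  then show "y \<in> udom D" "uapp D y = z" using app_eqI by blast+
qed

lemma closed_graph:
  assumes "\<And>n. f n \<in> udom D" "f \<longlonglongrightarrow> x" "(\<lambda>n. uapp D (f n)) \<longlonglongrightarrow> z"
  shows "x \<in> udom D" "uapp D x = z"
proof -
  have "inner (uapp D w) x = inner w z" if "w \<in> udom D" for w
  proof (rule LIMSEQ_unique)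
    show "(\<lambda>n. inner (uapp D w) (f n)) \<longlonglongrightarrow> inner (uapp D w) x"
      by (intro tendsto_intros assms)
    have "(\<lambda>n. inner w (uapp D (f n))) \<longlonglongrightarrow> inner w z"
      by (intro tendsto_intros assms)
    then show "(\<lambda>n. inner (uapp D w) (f n)) \<longlonglongrightarrow> inner w z"
      using symmetric_inner[OF that assms(1)] by simp
  qed
  then show "x \<in> udom D" "uapp D x = z" using app_eqI_inner by blast+
qed

text \<open>\<open>1 + D\<^sup>2\<close> is onto: if \<open>(h, Dh)\<close> is the projection of \<open>(f, 0)\<close> to the graph of \<open>D\<close>, then
  \<open>(1 + D\<^sup>2) h = f\<close>.\<close>

lemma one_plus_square_surj:
  "\<exists>h. h \<in> udom D \<and> uapp D h \<in> udom D \<and> h + uapp D (uapp D h) = f"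
proof -
  define V where "V = (\<lambda>x. (x, uapp D x)) ` udom D"
  have "subspace V"
    unfolding subspace_def V_def
    by (auto simp: zero_prod_def dom_zero app_zero app_add dom_add app_scaleR dom_scaleR image_iff)
  moreover have "closed V"
    unfolding closed_sequential_limits
  proof (intro allI impI, elim conjE)
    fix s l assume s: "\<forall>n. s n \<in> V" and lim: "s \<longlonglongrightarrow> l"
    have "fst (s n) \<in> udom D" "snd (s n) = uapp D (fst (s n))" for n
      using spec[OF s, of n] by (auto simp: V_def)
    moreover have "(\<lambda>n. fst (s n)) \<longlonglongrightarrow> fst l" "(\<lambda>n. snd (s n)) \<longlonglongrightarrow> snd l"
      by (intro tendsto_intros lim)+
    ultimately have "fst l \<in> udom D" "uapp D (fst l) = snd l"
      using closed_graph[of "\<lambda>n. fst (s n)"] by simp_all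
    then show "l \<in> V"
      unfolding V_def by (intro image_eqI[of _ _ "fst l"]) (simp_all add: prod_eq_iff)
  qed
  ultimately obtain p where p: "p \<in> V" "\<And>v. v \<in> V \<Longrightarrow> inner ((f, 0) - p) v = 0"
    using orthogonal_projection_exists by blast
  then obtain h where h: "h \<in> udom D" "p = (h, uapp D h)" by (auto simp: V_def)
  have "inner (uapp D x) (uapp D h) = inner x (f - h)" if "x \<in> udom D" for x
  proof -
    have "inner ((f, 0) - p) (x, uapp D x) = 0"
      by (rule p(2)) (use that in \<open>simp add: V_def\<close>)
    then show ?thesis
      by (simp add: h(2) inner_diff_left inner_diff_right inner_commute[of "uapp D h"]
          inner_commute[of x])
  qed
  from app_eqI_inner[OF this] show ?thesis using h(1) by (intro exI[of _ h]) simp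
qed

lemma inner_one_plus_square:
  assumes "x \<in> udom D" "uapp D x \<in> udom D" "y \<in> udom D"
  shows "inner (x + uapp D (uapp D x)) y = inner x y + inner (uapp D x) (uapp D y)"
  using symmetric_inner[OF assms(2,3)] by (simp add: inner_add_left)

text \<open>Energy estimate from \<open>(norm x)^2 + (norm (D x))^2 = inner f x\<close> with
  \<open>f = (1 + D^2) x\<close>. It yields injectivity and makes both \<open>P\<close> and
  \<open>D P\<close> contractions.\<close>

lemma one_plus_square_bound:
  assumes "x \<in> udom D" "uapp D x \<in> udom D"
  shows "norm x \<le> norm (x + uapp D (uapp D x))" "norm (uapp D x) \<le> norm (x + uapp D (uapp D x))"
proof -
  let ?f = "x + uapp D (uapp D x)"
  have eq: "(norm x)\<^sup>2 + (norm (uapp D x))\<^sup>2 = inner ?f x"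
    using inner_one_plus_square[OF assms assms(1)] by (simp add: power2_norm_eq_inner)
  also have "\<dots> \<le> norm ?f * norm x" by (rule norm_cauchy_schwarz)
  finally have le: "(norm x)\<^sup>2 + (norm (uapp D x))\<^sup>2 \<le> norm ?f * norm x" .
  then have "norm x * norm x \<le> norm ?f * norm x"
    using zero_le_power2[of "norm (uapp D x)"] unfolding power2_eq_square by linarith
  then show x: "norm x \<le> norm ?f"
    by (cases "x = 0") (auto simp: mult_le_cancel_right)
  have "norm ?f * norm x \<le> (norm ?f)\<^sup>2"
    using x by (simp add: power2_eq_square mult_left_mono)
  then have "(norm (uapp D x))\<^sup>2 \<le> (norm ?f)\<^sup>2"
    using le zero_le_power2[of "norm x"] by linarith
  then show "norm (uapp D x) \<le> norm ?f"
    by (rule power2_le_imp_le) simp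
qed

lemma one_plus_square_inj:
  assumes "x \<in> udom D" "uapp D x \<in> udom D" "y \<in> udom D" "uapp D y \<in> udom D"
    and eq: "x + uapp D (uapp D x) = y + uapp D (uapp D y)"
  shows "x = y"
proof -
  have "norm (x - y) \<le> norm (x - y + uapp D (uapp D (x - y)))"
    using assms by (intro one_plus_square_bound) (simp_all add: dom_diff app_diff)
  also have "x - y + uapp D (uapp D (x - y)) = 0"
    using assms by (simp add: dom_diff app_diff algebra_simps)
  finally show ?thesis by simp
qed

section \<open>The contractions \<open>(1 + D^2)^-1\<close> and
  \<open>D (1 + D^2)^-1\<close>\<close>

definition P :: "'h bop" where "P = bounded_inverse (one_plus_square D)"

lemma P_dom: "bop_apply P x \<in> udom D" (is ?dom)
  and P_dom2: "uapp D (bop_apply P x) \<in> udom D" (is ?dom2)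
  and P_right: "bop_apply P x + uapp D (uapp D (bop_apply P x)) = x" (is ?right)
proof -
  obtain p where p: "\<And>f. p f \<in> udom D" "\<And>f. uapp D (p f) \<in> udom D"
    "\<And>f. p f + uapp D (uapp D (p f)) = f"
    using one_plus_square_surj by metis
  have pI: "p f = h" if "h \<in> udom D" "uapp D h \<in> udom D" "h + uapp D (uapp D h) = f" for f h
    by (rule one_plus_square_inj) (simp_all add: that p)
  have "\<exists>T. bop_apply T = p"
  proof (rule bop_of_fun)
    show sc: "p (c *\<^sub>C f) = c *\<^sub>C p f" for c f
      by (rule pI) (simp_all add: p dom_scaleC app_scaleC flip: scaleC_add_right)
    show "bounded_linear p"
    proof (rule bounded_linear_intro)
      fix f g
      have "p f + p g + (uapp D (uapp D (p f)) + uapp D (uapp D (p g))) = f + g"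
        using p(3)[of f] p(3)[of g] by (metis add.assoc add.left_commute)
      then show "p (f + g) = p f + p g"
        by (intro pI) (simp_all add: p dom_add app_add)
      show "p (r *\<^sub>R f) = r *\<^sub>R p f" for r by (simp add: scaleR_scaleC sc)
      show "norm (p f) \<le> norm f * 1"
        using one_plus_square_bound(1)[OF p(1,2), of f] by (simp add: p(3))
    qed
  qed
  then obtain T where T: "bop_apply T = p" by blast
  have "P = T"
    unfolding P_def bounded_inverse_def one_plus_square_def unbounded_op.simps
  proof (rule the_equality)
    show "(\<forall>y. bop_apply T y \<in> {x \<in> udom D. uapp D x \<in> udom D} \<and>
        bop_apply T y + uapp D (uapp D (bop_apply T y)) = y) \<and>
        (\<forall>x\<in>{x \<in> udom D. uapp D x \<in> udom D}. bop_apply T (x + uapp D (uapp D x)) = x)"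
      using p pI by (auto simp: T)
  next
    fix R assume R: "(\<forall>y. bop_apply R y \<in> {x \<in> udom D. uapp D x \<in> udom D} \<and>
        bop_apply R y + uapp D (uapp D (bop_apply R y)) = y) \<and>
        (\<forall>x\<in>{x \<in> udom D. uapp D x \<in> udom D}. bop_apply R (x + uapp D (uapp D x)) = x)"
    then have "bop_apply R y = p y" for y
      by (metis (mono_tags, lifting) mem_Collect_eq pI)
    then show "R = T" by (intro bop_eqI) (simp add: T)
  qed
  then show ?dom ?dom2 ?right by (simp_all add: T p)
qed

lemma P_eqI:
  "h \<in> udom D \<Longrightarrow> uapp D h \<in> udom D \<Longrightarrow> h + uapp D (uapp D h) = f \<Longrightarrow> bop_apply P f = h"
  by (rule one_plus_square_inj) (simp_all add: P_dom P_dom2 P_right)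

lemma app_app_P: "uapp D (uapp D (bop_apply P x)) = x - bop_apply P x"
  using P_right[of x] by (metis add_diff_cancel_left')

lemma P_app_commute:
  assumes "v \<in> udom D"
  shows "bop_apply P (uapp D v) = uapp D (bop_apply P v)"
  using assms
  by (intro P_eqI) (simp_all add: P_dom P_dom2 app_app_P dom_diff app_diff)

text \<open>The operator \<open>D P\<close>, a bounded substitute for \<open>D\<close> whose
  commutators can be computed algebraically.\<close>

definition G :: "'h bop" where "G = (THE T. \<forall>x. bop_apply T x = uapp D (bop_apply P x))"

lemma G_apply: "bop_apply G x = uapp D (bop_apply P x)"
proof -
  have "\<exists>T. bop_apply T = (\<lambda>x. uapp D (bop_apply P x))"
  proof (rule bop_of_fun)
    show "bounded_linear (\<lambda>x. uapp D (bop_apply P x))"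
      using one_plus_square_bound(2)[OF P_dom P_dom2]
      by (intro bounded_linear_intro[of _ 1]) (simp_all add: P_dom app_add app_scaleR P_right)
  qed (simp add: bop_apply_scaleC P_dom app_scaleC)
  then have "\<exists>!T. \<forall>x. bop_apply T x = uapp D (bop_apply P x)"
    by (metis bop_eqI)
  from theI'[OF this] show ?thesis by (simp add: G_def)
qed

lemma norm_P: "norm P \<le> 1"
  using one_plus_square_bound(1)[OF P_dom P_dom2] by (intro norm_bop_bound) (simp_all add: P_right)

lemma norm_G: "norm G \<le> 1"
  using one_plus_square_bound(2)[OF P_dom P_dom2]
  by (intro norm_bop_bound) (simp_all add: P_right G_apply)

text \<open>The equation \<open>(1 + D^2) P x = x\<close> tested against \<open>P y\<close>. The
  right side is symmetric and nonnegative on the diagonal, so \<open>P\<close> is self-adjoint and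
  positive.\<close>

lemma P_form: "inner x (bop_apply P y) =
    inner (bop_apply P x) (bop_apply P y) + inner (bop_apply G x) (bop_apply G y)"
  using inner_one_plus_square[OF P_dom P_dom2 P_dom, of x y] by (simp add: P_right G_apply)

lemma positive_P: "positive_op P"
proof -
  have "star P = P"
  proof (rule bop_inner_eqI)
    fix x y
    show "inner x (bop_apply (star P) y) = inner x (bop_apply P y)"
      using P_form[of x y] P_form[of y x] by (simp add: inner_star_right inner_commute)
  qed
  moreover have "0 \<le> inner x (bop_apply P x)" for x
    by (subst P_form) simp
  ultimately show ?thesis by (simp add: positive_op_iff)
qed

lemma positive_one_minus_P: "positive_op (1 - P)"
  by (rule positive_op_one_minus[OF positive_op_self_adjoint[OF positive_P] norm_P])

lemma G_P_commute: "G * P = P * G"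
  by (rule bop_eqI) (simp add: G_apply P_app_commute P_dom)

lemma self_adjoint_G: "star G = G"
proof (rule bop_inner_eqI)
  fix x y
  have "inner x (bop_apply G y) = inner (bop_apply P x + uapp D (uapp D (bop_apply P x))) (bop_apply G y)"
    by (simp add: P_right)
  also have "\<dots> = inner (bop_apply P x) (bop_apply G y) + inner (bop_apply G x) (y - bop_apply P y)"
    using inner_one_plus_square[OF P_dom P_dom2, of "bop_apply G y" x] P_dom2[of y]
    by (simp add: G_apply app_app_P)
  also have "inner (bop_apply P x) (bop_apply G y) = inner (bop_apply G x) (bop_apply P y)"
    by (simp add: G_apply symmetric_inner P_dom)
  finally show "inner x (bop_apply (star G) y) = inner x (bop_apply G y)"
    by (simp add: inner_star_right inner_diff_right)
qed

lemma G_square: "G * G = (1 - P) * P"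
  by (rule bop_eqI) (simp add: G_apply P_app_commute P_dom P_dom2 app_app_P)

lemma P_inj: "bop_apply P x = bop_apply P y \<Longrightarrow> x = y"
  by (metis P_right)

lemma P_cancel_left: "P * X = P * Y \<Longrightarrow> X = Y"
  by (metis P_inj bop_apply_simps(7) bop_eqI)

text \<open>A symbol computation: \<open>D(1 + D\<^sup>2)\<^sup>-\<^sup>1\<close> has the divided difference
  \<open>(1 - xy) / ((1 + x\<^sup>2)(1 + y\<^sup>2))\<close>.\<close>

lemma G_commutator:
  assumes a: "\<And>x. x \<in> udom D \<Longrightarrow> bop_apply a x \<in> udom D"
    and B: "\<And>x. x \<in> udom D \<Longrightarrow> bop_apply B x = uapp D (bop_apply a x) - bop_apply a (uapp D x)"
  shows "G * a - a * G = P * B * P - G * B * G"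
proof (rule bop_eqI)
  fix x
  define h where "h = bop_apply P x"
  define k where "k = uapp D h"
  have h: "h \<in> udom D" "k \<in> udom D" "x = h + uapp D k"
    using P_dom P_dom2 P_right by (auto simp: h_def k_def)
  have GD: "bop_apply G (uapp D v) = v - bop_apply P v" if "v \<in> udom D" for v
    by (simp add: G_apply P_app_commute[OF that] app_app_P)
  have PD: "bop_apply P (uapp D v) = bop_apply G v" if "v \<in> udom D" for v
    by (simp add: G_apply P_app_commute[OF that])
  have "bop_apply (P * B * P - G * B * G) x
      = bop_apply P (bop_apply B h) - bop_apply G (bop_apply B k)"
    by (simp add: G_apply h_def k_def)
  \<comment> \<open>Expanding \<open>B\<close> on \<open>h\<close> and on \<open>k\<close> produces
    \<open>P (a k)\<close> twice with opposite signs; the two remaining \<open>G\<close> terms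
    recombine to \<open>G (a x)\<close>.\<close>
  also have "\<dots> = bop_apply G (bop_apply a (h + uapp D k)) - bop_apply a k"
    using h a by (simp add: B PD GD k_def[symmetric])
  finally show "bop_apply (G * a - a * G) x = bop_apply (P * B * P - G * B * G) x"
    by (simp only: h(3)[symmetric]) (simp add: G_apply h_def k_def)
qed

lemma norm_G_commutator_le:
  assumes "\<And>x. x \<in> udom D \<Longrightarrow> bop_apply a x \<in> udom D"
    and "\<And>x. x \<in> udom D \<Longrightarrow> bop_apply B x = uapp D (bop_apply a x) - bop_apply a (uapp D x)"
  shows "norm (G * a - a * G) \<le> 2 * norm B"
proof -
  have le: "norm (X * B * X) \<le> norm B" if "norm X \<le> 1" for X
  proof -
    have "norm (X * B * X) \<le> norm X * norm B * norm X"
      by (rule order_trans[OF norm_mult_ineq]) (simp add: norm_mult_ineq mult_right_mono)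
    also have "\<dots> \<le> 1 * norm B * 1"
      using that by (intro mult_mono) auto
    finally show ?thesis by simp
  qed
  have "G * a - a * G = P * B * P - G * B * G"
    by (rule G_commutator) (use assms in auto)
  then show ?thesis
    using norm_triangle_ineq4[of "P * B * P" "G * B * G"] le[OF norm_P] le[OF norm_G] by simp
qed

end

definition scale_op :: "real \<Rightarrow> 'h::chilbert_space unbounded_op \<Rightarrow> 'h unbounded_op" where
  "scale_op e D = \<lparr>udom = udom D, uapp = (\<lambda>x. e *\<^sub>R uapp D x)\<rparr>"

lemma scale_op_simps [simp]: "udom (scale_op e D) = udom D" "uapp (scale_op e D) x = e *\<^sub>R uapp D x"
  by (simp_all add: scale_op_def)

lemma (in self_adjoint_operator) self_adjoint_scale_op:
  assumes "e \<noteq> 0"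
  shows "self_adjoint_operator (scale_op e D)"
proof (unfold_locales, rule self_adjoint_opI)
  show "linear_op (scale_op e D)"
    using self_adjoint
    by (simp add: linear_op_def self_adjoint_op_def scaleR_add_right scaleC_scaleR_commute)
  show "closure (udom (scale_op e D)) = UNIV"
    by (simp add: dense_dom)
  show "cinner (uapp (scale_op e D) x) y = cinner x (uapp (scale_op e D) y)"
    if "x \<in> udom (scale_op e D)" "y \<in> udom (scale_op e D)" for x y
    using that by (simp add: symmetric scaleR_scaleC cinner_scaleC_left cinner_scaleC_right)
  fix y z assume *: "\<And>x. x \<in> udom (scale_op e D) \<Longrightarrow> cinner (uapp (scale_op e D) x) y = cinner x z"
  have "cinner (uapp D x) y = cinner x (inverse e *\<^sub>R z)" if "x \<in> udom D" for x
    using *[of x] that assms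
    by (simp add: scaleR_scaleC cinner_scaleC_left cinner_scaleC_right field_simps)
  then show "y \<in> udom (scale_op e D)" using app_eqI(1) by simp
qed

section \<open>The bounded transform\<close>

context self_adjoint_operator
begin

text \<open>Because \<open>(1 + e^2 D^2) P = P + e^2 (1 - P)\<close>. This identifies the operators
  \<open>(1 + e^2 D^2)^-1\<close> with the rescalings of \<open>P\<close> for
  \<open>u = e^2\<close>.\<close>

lemma scaled_P_mult:
  assumes "e \<noteq> 0"
  shows "self_adjoint_operator.P (scale_op e D) * (e\<^sup>2 *\<^sub>R 1 + (1 - e\<^sup>2) *\<^sub>R P) = P"
proof -
  interpret E: self_adjoint_operator "scale_op e D"
    by (rule self_adjoint_scale_op[OF assms])
  show ?thesis
  proof (rule bop_eqI)
    fix y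
    have "bop_apply E.P (bop_apply (e\<^sup>2 *\<^sub>R 1 + (1 - e\<^sup>2) *\<^sub>R P) y) = bop_apply P y"
    proof (rule E.P_eqI)
      show "bop_apply P y + uapp (scale_op e D) (uapp (scale_op e D) (bop_apply P y))
          = bop_apply (e\<^sup>2 *\<^sub>R 1 + (1 - e\<^sup>2) *\<^sub>R P) y"
        by (simp add: app_scaleR P_dom2 app_app_P power2_eq_square algebra_simps)
    qed (simp_all add: P_dom P_dom2 dom_scaleR)
    then show "bop_apply (E.P * (e\<^sup>2 *\<^sub>R 1 + (1 - e\<^sup>2) *\<^sub>R P)) y = bop_apply P y" by simp
  qed
qed

text \<open>For \<open>x\<close> in the domain, \<open>(1 + e\<^sup>2D\<^sup>2)\<^sup>-\<^sup>1 x\<close> lies in the domain of \<open>D\<^sup>2\<close> and tends to \<open>x\<close> as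
  \<open>e\<close> tends to \<open>0\<close>.\<close>

lemma dense_range_P: "closure (range (bop_apply P)) = UNIV"
proof -
  have "x \<in> closure (range (bop_apply P))" if x: "x \<in> udom D" for x
    unfolding closure_sequential
  proof (intro exI conjI allI)
    define f where "f n = bop_apply (self_adjoint_operator.P (scale_op (inverse (Suc n)) D)) x" for n
    have *: "f n \<in> range (bop_apply P) \<and> norm (f n - x) \<le> inverse (Suc n) * norm (uapp D x)" for n
    proof -
      define e where "e = inverse (real (Suc n))"
      have e: "0 < e" by (simp add: e_def)
      interpret E: self_adjoint_operator "scale_op e D"
        by (rule self_adjoint_scale_op) (use e in simp)
      have fn: "f n = bop_apply E.P x" by (simp add: f_def e_def)
      have "inverse e *\<^sub>R uapp (scale_op e D) (f n) \<in> udom D"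
        using E.P_dom2[of x] by (simp add: fn dom_scaleR del: scale_op_simps(2) )
      then have "uapp D (f n) \<in> udom D" using e by simp
      moreover have "f n \<in> udom D" using E.P_dom[of x] by (simp add: fn)
      ultimately have "f n = bop_apply P (f n + uapp D (uapp D (f n)))"
        using P_eqI[of "f n"] by metis
      \<comment> \<open>\<open>x - E.P x\<close> equals \<open>(eD)^2 E.P x\<close>, and one factor
        \<open>eD\<close> can be moved onto \<open>x\<close>. As \<open>E.G\<close> is a
        contraction, the error is at most \<open>e\<close> times the norm of
        \<open>D x\<close>.\<close>
      moreover have "x - f n = bop_apply E.G (uapp (scale_op e D) x)"
        unfolding fn E.app_app_P[symmetric] E.G_apply by (subst E.P_app_commute) (use x in simp_all)
      then have "norm (x - f n) \<le> norm E.G * norm (uapp (scale_op e D) x)"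
        by (simp only: norm_bop_apply)
      then have "norm (x - f n) \<le> 1 * norm (uapp (scale_op e D) x)"
        using mult_right_mono[OF E.norm_G norm_ge_zero] order_trans by blast
      then have "norm (f n - x) \<le> e * norm (uapp D x)"
        using e by (simp add: norm_minus_commute)
      ultimately show ?thesis unfolding e_def by blast
    qed
    then show "f n \<in> range (bop_apply P)" for n by blast
    show "f \<longlonglongrightarrow> x"
    proof (rule LIM_zero_cancel, rule Lim_null_comparison)
      show "\<forall>\<^sub>F n in sequentially. norm (f n - x) \<le> inverse (real (Suc n)) * norm (uapp D x)"
        using * by (intro always_eventually) blast
      show "(\<lambda>n. inverse (real (Suc n)) * norm (uapp D x)) \<longlonglongrightarrow> 0"
        by (rule tendsto_mult_left_zero[OF LIMSEQ_inverse_real_of_nat])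
    qed
  qed
  then have "closure (udom D) \<subseteq> closure (range (bop_apply P))"
    by (intro closure_minimal) auto
  then show ?thesis unfolding dense_dom by (rule top_le)
qed

lemma range_P_sequence:
  obtains w where "(\<lambda>n. bop_apply P (w n)) \<longlonglongrightarrow> x"
proof -
  have "x \<in> closure (range (bop_apply P))" by (simp add: dense_range_P)
  then obtain f where f: "\<And>n. f n \<in> range (bop_apply P)" "f \<longlonglongrightarrow> x"
    unfolding closure_sequential by blast
  then have "\<forall>n. \<exists>w. f n = bop_apply P w" by blast
  from choice[OF this] obtain w where "\<And>n. f n = bop_apply P (w n)" by blast
  then have "f = (\<lambda>n. bop_apply P (w n))" by (rule ext)
  with f(2) show ?thesis by (intro that[of w]) simp
qed

lemma P_cancel_right:
  assumes "X * P = Y * P"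
  shows "X = Y"
proof (rule bop_eqI)
  fix x
  obtain w where w: "(\<lambda>n. bop_apply P (w n)) \<longlonglongrightarrow> x" by (rule range_P_sequence)
  have "bop_apply X (bop_apply P (w n)) = bop_apply Y (bop_apply P (w n))" for n
    using assms by (metis bop_apply_simps(7))
  then show "bop_apply X x = bop_apply Y x"
    using LIMSEQ_unique tendsto_bop_apply_right[OF w, of X] tendsto_bop_apply_right[OF w, of Y]
    by simp
qed

section \<open>The square root of \<open>P\<close> and the bounded transform\<close>

definition S :: "'h bop" where "S = positive_sqrt P"

lemma positive_S: "positive_op S"
  and S_square: "S * S = P"
  and S_double_commutant: "S \<in> commutant (commutant {P})"
  and S_closure: "S \<in> closure (convex hull (rescalings P))"
proof -
  obtain T where T: "positive_op T" "T * T = P" "T \<in> commutant (commutant {P})"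
    "T \<in> closure (convex hull (rescalings P))"
    using positive_sqrt_exists[OF positive_P positive_one_minus_P] by blast
  have "S = T" unfolding S_def by (rule positive_sqrt_eqI) (rule T)+
  then show "positive_op S" "S * S = P" "S \<in> commutant (commutant {P})"
    "S \<in> closure (convex hull (rescalings P))" using T by auto
qed

text \<open>Identities for \<open>F\<close> are checked after multiplication by \<open>S\<close> or
  \<open>P\<close>, where the unbounded \<open>D\<close> only occurs inside
  \<open>G\<close>.\<close>

lemma S_cancel_right: "X * S = Y * S \<Longrightarrow> X = Y"
  by (metis P_cancel_right S_square mult.assoc)

lemma S_cancel_left: "S * X = S * Y \<Longrightarrow> X = Y"
  by (metis P_cancel_left S_square mult.assoc)

text \<open>The form of \<open>P\<close> is the squared norm of \<open>S v\<close> on the one hand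
  and dominates that of \<open>G v\<close> on the other. In effect this is contractivity of
  \<open>F\<close> on the range of \<open>S\<close>, before \<open>F\<close> is known to
  exist.\<close>

lemma norm_G_le_S: "norm (bop_apply G v) \<le> norm (bop_apply S v)"
proof -
  have "(norm (bop_apply S v))\<^sup>2 = inner v (bop_apply P v)"
    using inner_self_adjoint[OF positive_op_self_adjoint[OF positive_S], of v "bop_apply S v"]
    by (simp add: power2_norm_eq_inner flip: S_square)
  also have "\<dots> = (norm (bop_apply P v))\<^sup>2 + (norm (bop_apply G v))\<^sup>2"
    by (subst P_form) (simp add: power2_norm_eq_inner)
  finally have "(norm (bop_apply G v))\<^sup>2 \<le> (norm (bop_apply S v))\<^sup>2" by simp
  then show ?thesis by (rule power2_le_imp_le) simp
qed

text \<open>For \<open>x = S v\<close> the claim is clear, as \<open>S x = P v\<close> and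
  \<open>D S x = G v\<close>. General \<open>x\<close> are limits of such vectors,
  \<open>norm_G_le_S\<close> makes the images under \<open>D\<close> a Cauchy sequence, and the
  graph of \<open>D\<close> is closed.\<close>

lemma S_dom: "bop_apply S x \<in> udom D" (is ?dom)
  and norm_app_S: "norm (uapp D (bop_apply S x)) \<le> norm x" (is ?norm)
proof -
  obtain w where w: "(\<lambda>n. bop_apply P (w n)) \<longlonglongrightarrow> x" by (rule range_P_sequence)
  define v where "v n = bop_apply S (w n)" for n
  have SS: "bop_apply S (bop_apply S y) = bop_apply P y" for y
    by (simp flip: S_square)
  have Sv: "(\<lambda>n. bop_apply S (v n)) \<longlonglongrightarrow> x"
    using w by (simp add: v_def SS)
  have "Cauchy (\<lambda>n. bop_apply G (v n))"
  proof (rule metric_CauchyI)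
    fix e :: real assume "0 < e"
    then obtain M where M: "\<And>m n. M \<le> m \<Longrightarrow> M \<le> n \<Longrightarrow>
        dist (bop_apply S (v m)) (bop_apply S (v n)) < e"
      using LIMSEQ_imp_Cauchy[OF Sv] unfolding Cauchy_def by metis
    have "dist (bop_apply G (v m)) (bop_apply G (v n)) \<le> dist (bop_apply S (v m)) (bop_apply S (v n))"
      for m n
      using norm_G_le_S[of "v m - v n"] by (simp add: dist_norm)
    then show "\<exists>M. \<forall>m\<ge>M. \<forall>n\<ge>M. dist (bop_apply G (v m)) (bop_apply G (v n)) < e"
      using M le_less_trans by blast
  qed
  then obtain z where z: "(\<lambda>n. bop_apply G (v n)) \<longlonglongrightarrow> z"
    using Cauchy_convergent_iff convergent_def by blast
  have "(\<lambda>n. bop_apply P (v n)) \<longlonglongrightarrow> bop_apply S x"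
    using tendsto_bop_apply_right[OF Sv, of S] by (simp add: SS)
  from closed_graph[OF P_dom this] z have Sx: "?dom" "uapp D (bop_apply S x) = z"
    by (simp_all add: G_apply)
  have "norm z \<le> norm x"
    by (rule LIMSEQ_le[OF tendsto_norm[OF z] tendsto_norm[OF Sv]]) (use norm_G_le_S in blast)
  then show ?dom ?norm using Sx by simp_all
qed

definition F :: "'h bop" where "F = bounded_transform D"

lemma F_apply: "bop_apply F x = uapp D (bop_apply S x)"
proof -
  have "\<exists>T. bop_apply T = (\<lambda>x. uapp D (bop_apply S x))"
  proof (rule bop_of_fun)
    show "bounded_linear (\<lambda>x. uapp D (bop_apply S x))"
      using norm_app_S by (intro bounded_linear_intro[of _ 1]) (simp_all add: S_dom app_add app_scaleR)
  qed (simp add: bop_apply_scaleC S_dom app_scaleC)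
  then have "\<exists>!T. \<forall>x. bop_apply S x \<in> udom D \<and> bop_apply T x = uapp D (bop_apply S x)"
    using S_dom by (metis bop_eqI)
  from theI'[OF this] show ?thesis
    unfolding F_def bounded_transform_def Let_def S_def P_def by blast
qed

lemma F_S: "F * S = G"
proof (rule bop_eqI)
  fix x
  show "bop_apply (F * S) x = bop_apply G x"
    by (simp add: F_apply G_apply flip: S_square)
qed

lemma G_commutant: "G \<in> commutant {P}"
  using G_P_commute by (simp add: commutant_def)

lemma S_F_commute: "S * F = F * S"
proof (rule S_cancel_right)
  have "S * G = G * S"
    by (rule commutantD[OF S_double_commutant G_commutant])
  then show "S * F * S = F * S * S"
    by (simp add: mult.assoc F_S)
qed

lemma self_adjoint_F: "star F = F"
proof (rule S_cancel_left)
  have "S * star F = star (F * S)"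
    by (simp add: star_mult positive_op_self_adjoint[OF positive_S])
  then show "S * star F = S * F"
    by (simp add: F_S self_adjoint_G S_F_commute)
qed

lemma F_commutant: "F \<in> commutant {P}"
  using S_F_commute S_square by (simp add: commutant_def) (metis mult.assoc)

lemma F_square: "F * F = 1 - P"
proof (rule P_cancel_right)
  have "F * F * P = F * (F * S) * S" by (simp add: mult.assoc flip: S_square)
  also have "\<dots> = F * (S * F) * S" by (simp only: S_F_commute)
  also have "\<dots> = G * G" by (simp add: mult.assoc F_S) (simp add: F_S flip: mult.assoc)
  finally show "F * F * P = (1 - P) * P" by (simp add: G_square)
qed

section \<open>The commutator bound for the bounded transform\<close>

lemma rescalings_scaled_P:
  assumes "X \<in> rescalings P"
  obtains e where "0 < e" "X = self_adjoint_operator.P (scale_op e D)"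
proof -
  obtain u where u: "0 < u" "u \<le> 1" and X: "X * (u *\<^sub>R 1 + (1 - u) *\<^sub>R P) = P"
    using assms by (auto simp: rescalings_def)
  have "self_adjoint_operator.P (scale_op (sqrt u) D) * (u *\<^sub>R 1 + (1 - u) *\<^sub>R P) = P"
    using scaled_P_mult[of "sqrt u"] u by simp
  moreover obtain V where "(u *\<^sub>R 1 + (1 - u) *\<^sub>R P) * V = 1"
    using convex_combination_invertible[OF positive_P u] by blast
  ultimately have "X = self_adjoint_operator.P (scale_op (sqrt u) D)"
    using X by (metis mult.assoc mult.right_neutral)
  then show ?thesis using that[of "sqrt u"] u by simp
qed

text \<open>The range of \<open>P\<close> is dense, so sandwiching by \<open>P\<close> loses no
  information about the norm. The sandwich is needed because \<open>D y\<close> converges in norm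
  only after multiplication by \<open>P\<close>.\<close>

lemma norm_le_dense_form:
  assumes "0 \<le> c"
    and le: "\<And>x y. inner (bop_apply P x) (bop_apply T (bop_apply P y))
      \<le> c * norm (bop_apply P x) * norm (bop_apply P y)"
  shows "norm T \<le> c"
proof (rule norm_bop_bound[OF assms(1)])
  fix y
  define x where "x = bop_apply T y"
  obtain v where v: "(\<lambda>n. bop_apply P (v n)) \<longlonglongrightarrow> x" by (rule range_P_sequence)
  obtain w where w: "(\<lambda>n. bop_apply P (w n)) \<longlonglongrightarrow> y" by (rule range_P_sequence)
  have "inner x (bop_apply T y) \<le> c * norm x * norm y"
  proof (rule LIMSEQ_le)
    show "(\<lambda>n. inner (bop_apply P (v n)) (bop_apply T (bop_apply P (w n))))
        \<longlonglongrightarrow> inner x (bop_apply T y)"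
      by (intro tendsto_inner v tendsto_bop_apply_right w)
    show "(\<lambda>n. c * norm (bop_apply P (v n)) * norm (bop_apply P (w n))) \<longlonglongrightarrow> c * norm x * norm y"
      by (intro tendsto_intros v w)
  qed (use le in blast)
  then have "norm x * norm x \<le> norm x * (c * norm y)"
    by (simp add: x_def power2_norm_eq_inner[symmetric] power2_eq_square mult_ac)
  then show "norm (bop_apply T y) \<le> c * norm y"
    using assms(1) by (cases "x = 0") (auto simp: x_def mult_le_cancel_left)
qed

text \<open>If \<open>y\<close> runs through convex combinations of the \<open>(1 + e\<^sup>2D\<^sup>2)\<^sup>-\<^sup>1\<close> converging to \<open>S\<close> in norm, then
  \<open>Dy\<close> converges to \<open>F\<close> only strongly; this still preserves the norm bound on the commutators.\<close>

lemma norm_F_commutator_le: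
  assumes a: "\<And>x. x \<in> udom D \<Longrightarrow> bop_apply a x \<in> udom D"
    and B: "\<And>x. x \<in> udom D \<Longrightarrow> bop_apply B x = uapp D (bop_apply a x) - bop_apply a (uapp D x)"
  shows "norm (F * a - a * F) \<le> 2 * norm B"
proof -
  define c where "c = 2 * norm B"
  \<comment> \<open>The witness \<open>Y\<close> is \<open>D X\<close>. Collecting the bound in a
    convex set reduces the hull to single rescalings; self-adjointness of \<open>Y\<close> is kept
    to pass from \<open>Y * P\<close> to \<open>P * Y\<close> below.\<close>
  define \<G> where "\<G> = {X. \<exists>Y. (\<forall>x. bop_apply X x \<in> udom D \<and> bop_apply Y x = uapp D (bop_apply X x)) \<and>
    star Y = Y \<and> norm (Y * a - a * Y) \<le> c}"
  have "convex \<G>"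
  proof (rule convexI)
    fix X1 X2 and s t :: real
    assume "X1 \<in> \<G>" "X2 \<in> \<G>" and st: "0 \<le> s" "0 \<le> t" "s + t = 1"
    then obtain Y1 Y2 where
      Y1: "\<And>x. bop_apply X1 x \<in> udom D \<and> bop_apply Y1 x = uapp D (bop_apply X1 x)" "star Y1 = Y1"
        "norm (Y1 * a - a * Y1) \<le> c" and
      Y2: "\<And>x. bop_apply X2 x \<in> udom D \<and> bop_apply Y2 x = uapp D (bop_apply X2 x)" "star Y2 = Y2"
        "norm (Y2 * a - a * Y2) \<le> c"
      unfolding \<G>_def by auto
    let ?Y = "s *\<^sub>R Y1 + t *\<^sub>R Y2"
    have "?Y * a - a * ?Y = s *\<^sub>R (Y1 * a - a * Y1) + t *\<^sub>R (Y2 * a - a * Y2)"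
      by (simp add: algebra_simps)
    then have "norm (?Y * a - a * ?Y) \<le> s * norm (Y1 * a - a * Y1) + t * norm (Y2 * a - a * Y2)"
      using norm_triangle_ineq[of "s *\<^sub>R (Y1 * a - a * Y1)" "t *\<^sub>R (Y2 * a - a * Y2)"] st by simp
    also have "\<dots> \<le> s * c + t * c"
      using st Y1(3) Y2(3) by (intro add_mono mult_left_mono) auto
    also have "\<dots> = c" using st by (simp flip: distrib_right)
    finally show "s *\<^sub>R X1 + t *\<^sub>R X2 \<in> \<G>"
      unfolding \<G>_def using Y1(1,2) Y2(1,2)
      by (auto intro!: exI[of _ ?Y] simp: dom_add dom_scaleR app_add app_scaleR star_add star_scaleR)
  qed
  moreover have "rescalings P \<subseteq> \<G>"
  proof
    fix X assume "X \<in> rescalings P"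
    then obtain e where e: "0 < e" and X: "X = self_adjoint_operator.P (scale_op e D)"
      by (rule rescalings_scaled_P)
    interpret E: self_adjoint_operator "scale_op e D"
      by (rule self_adjoint_scale_op) (use e in simp)
    \<comment> \<open>\<open>D = (1/e) (eD)\<close>, and the commutator of \<open>eD\<close> with
      \<open>a\<close> is \<open>e B\<close>; the two factors cancel, so the bound does not depend
      on \<open>e\<close>.\<close>
    define Y where "Y = (1/e) *\<^sub>R E.G"
    have "norm (E.G * a - a * E.G) \<le> 2 * norm (e *\<^sub>R B)"
      by (rule E.norm_G_commutator_le) (simp_all add: a B scaleR_right_diff_distrib)
    moreover have "Y * a - a * Y = (1/e) *\<^sub>R (E.G * a - a * E.G)"
      by (simp add: Y_def scaleR_right_diff_distrib)
    ultimately have "norm (Y * a - a * Y) \<le> c"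
      using e by (simp only: norm_scaleR) (simp add: c_def field_simps)
    moreover have "bop_apply X x \<in> udom D \<and> bop_apply Y x = uapp D (bop_apply X x)" for x
      using E.P_dom[of x] e by (simp add: X Y_def E.G_apply)
    moreover have "star Y = Y"
      by (simp add: Y_def star_scaleR E.self_adjoint_G)
    ultimately show "X \<in> \<G>" unfolding \<G>_def by blast
  qed
  ultimately have sub: "convex hull (rescalings P) \<subseteq> \<G>" by (intro hull_minimal)
  obtain y where yh: "\<And>n. y n \<in> convex hull (rescalings P)" and lim: "y \<longlonglongrightarrow> S"
    using S_closure unfolding closure_sequential by blast
  have "\<forall>n. \<exists>Y. (\<forall>x. bop_apply (y n) x \<in> udom D \<and> bop_apply Y x = uapp D (bop_apply (y n) x)) \<and>
    star Y = Y \<and> norm (Y * a - a * Y) \<le> c"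
    using sub yh unfolding \<G>_def by blast
  then obtain Y where Y: "\<And>n x. bop_apply (Y n) x = uapp D (bop_apply (y n) x)"
    "\<And>n. star (Y n) = Y n" "\<And>n. norm (Y n * a - a * Y n) \<le> c"
    by metis
  have yc: "y n * P = P * y n" for n
  proof -
    have "y n \<in> commutant (commutant {P})"
      using yh[of n] hull_minimal[OF rescalings_double_commutant[OF positive_P], of convex]
        convex_commutant by blast
    then show ?thesis by (rule double_commutant_commute) (rule double_commutant_self)
  qed
  \<comment> \<open>Trading \<open>D y\<close> for \<open>G * y\<close> makes the convergence a norm
    convergence.\<close>
  have YP: "Y n * P = G * y n" for n
  proof (rule bop_eqI)
    fix x
    have "bop_apply (y n) (bop_apply P x) = bop_apply P (bop_apply (y n) x)"
      using yc[of n] by (metis bop_apply_simps(7))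
    then show "bop_apply (Y n * P) x = bop_apply (G * y n) x"
      by (simp add: Y(1) G_apply)
  qed
  have "G * S = F * P" by (simp add: mult.assoc flip: F_S S_square)
  then have limYP: "(\<lambda>n. Y n * P) \<longlonglongrightarrow> F * P"
    unfolding YP using tendsto_mult[OF tendsto_const lim, of G] by simp
  have limPY: "(\<lambda>n. P * Y n) \<longlonglongrightarrow> P * F"
    using bounded_linear.tendsto[OF bounded_linear_star limYP]
    by (simp add: star_mult Y(2) self_adjoint_F positive_op_self_adjoint[OF positive_P])
  have limc: "(\<lambda>n. P * (Y n * a - a * Y n) * P) \<longlonglongrightarrow> P * (F * a - a * F) * P"
  proof -
    have "(\<lambda>n. (P * Y n) * (a * P) - (P * a) * (Y n * P)) \<longlonglongrightarrow> (P * F) * (a * P) - (P * a) * (F * P)"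
      by (intro tendsto_intros limPY limYP)
    then show ?thesis
      by (simp add: mult.assoc left_diff_distrib right_diff_distrib)
  qed
  have "norm (F * a - a * F) \<le> c"
  proof (rule norm_le_dense_form)
    fix x z
    have form: "inner x (bop_apply (P * T * P) z) = inner (bop_apply P x) (bop_apply T (bop_apply P z))" for T
      using inner_self_adjoint[OF positive_op_self_adjoint[OF positive_P]] by simp
    have "inner x (bop_apply (P * (F * a - a * F) * P) z)
        \<le> c * norm (bop_apply P x) * norm (bop_apply P z)"
    proof (rule LIMSEQ_le_const2)
      show "(\<lambda>n. inner x (bop_apply (P * (Y n * a - a * Y n) * P) z))
          \<longlonglongrightarrow> inner x (bop_apply (P * (F * a - a * F) * P) z)"
        by (intro tendsto_intros limc)
      have "inner x (bop_apply (P * (Y n * a - a * Y n) * P) z)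
          \<le> c * norm (bop_apply P x) * norm (bop_apply P z)" for n
      proof -
        have "inner x (bop_apply (P * (Y n * a - a * Y n) * P) z)
            \<le> norm (bop_apply P x) * norm (bop_apply (Y n * a - a * Y n) (bop_apply P z))"
          unfolding form by (rule norm_cauchy_schwarz)
        also have "\<dots> \<le> norm (bop_apply P x) * (norm (Y n * a - a * Y n) * norm (bop_apply P z))"
          by (intro mult_left_mono norm_bop_apply) simp
        also have "\<dots> \<le> norm (bop_apply P x) * (c * norm (bop_apply P z))"
          by (intro mult_left_mono mult_right_mono Y(3)) simp_all
        finally show ?thesis by (simp add: mult_ac)
      qed
      then show "\<exists>M. \<forall>n\<ge>M. inner x (bop_apply (P * (Y n * a - a * Y n) * P) z)
          \<le> c * norm (bop_apply P x) * norm (bop_apply P z)" by blast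
    qed
    then show "inner (bop_apply P x) (bop_apply (F * a - a * F) (bop_apply P z))
        \<le> c * norm (bop_apply P x) * norm (bop_apply P z)"
      by (simp only: form)
  qed (simp add: c_def)
  then show ?thesis by (simp add: c_def)
qed

text \<open>Let \<open>Q = e^2 + (1 - e^2) P\<close> and \<open>K\<close> its positive root. Then
  \<open>S = E.S * K\<close>, so \<open>E.F\<close> is \<open>e F\<close> times the inverse of
  \<open>K\<close>, and \<open>E.F - F\<close> is \<open>F\<close> times that inverse times
  \<open>e - K\<close>. The factor \<open>P\<close> appears from
  \<open>(e + K) (e - K) = e^2 - Q = (e^2 - 1) P\<close>.\<close>

lemma scaled_F_diff:
  assumes e: "0 < e" "e \<le> 1"
  shows "\<exists>X \<in> commutant (commutant {P, F}).
    self_adjoint_operator.F (scale_op e D) - F = X * P \<and> X * P = P * X"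
proof -
  interpret E: self_adjoint_operator "scale_op e D"
    by (rule self_adjoint_scale_op) (use e in simp)
  define u where "u = e\<^sup>2"
  have u: "0 < u" "u \<le> 1" using e by (simp_all add: u_def power_le_one)
  define Q where "Q = u *\<^sub>R 1 + (1 - u) *\<^sub>R P"
  obtain V where V: "Q * V = 1" "V * Q = 1" "V \<in> commutant (commutant {P})"
    using convex_combination_invertible[OF positive_P u] by (metis Q_def)
  have EPQ: "E.P * Q = P"
    using scaled_P_mult[of e] e by (simp add: Q_def u_def)
  have Qc: "Q \<in> commutant (commutant {P})"
    unfolding Q_def by (intro commutant_intros double_commutant_self)
  have posQ: "positive_op Q"
    unfolding Q_def using u by (intro positive_op_add positive_op_scaleR positive_op_one positive_P) auto
  have "1 - Q = (1 - u) *\<^sub>R (1 - P)"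
    by (simp add: Q_def algebra_simps)
  then have pos1Q: "positive_op (1 - Q)"
    using u positive_one_minus_P by (simp add: positive_op_scaleR)
  obtain K where K: "positive_op K" "K * K = Q" "K \<in> commutant (commutant {Q})"
    using positive_sqrt_exists[OF posQ pos1Q] by blast
  note saK = positive_op_self_adjoint[OF K(1)]
  have Kc: "K \<in> commutant (commutant {P})"
    using K(3) double_commutant_singleton_subset[OF Qc] by blast
  have "(norm K)\<^sup>2 \<le> 1\<^sup>2"
    using norm_star_mult[of K] norm_positive_op_le[OF posQ, of 1] pos1Q by (simp add: saK K(2))
  then have "norm K \<le> 1" by (rule power2_le_imp_le) simp
  then have "positive_op (1 - K)" by (rule positive_op_one_minus[OF saK])
  \<comment> \<open>The root \<open>L\<close> of \<open>K\<close> shows that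
    \<open>E.S * K = L * E.S * L\<close> is positive, which uniqueness of the positive root of
    \<open>P\<close> requires.\<close>
  from positive_sqrt_exists[OF K(1) this] obtain L
    where L: "positive_op L" "L * L = K" "L \<in> commutant (commutant {K})" by blast
  have Lc: "L \<in> commutant (commutant {P})"
    using L(3) double_commutant_singleton_subset[OF Kc] by blast
  note com = double_commutant_commute[of _ P]
  have "E.P = P * V"
    using EPQ V(1) by (metis mult.assoc mult.right_neutral)
  then have EPc: "E.P \<in> commutant (commutant {P})"
    by (simp add: commutant_mult double_commutant_self V(3))
  then have ESc: "E.S \<in> commutant (commutant {P})"
    using E.S_double_commutant double_commutant_singleton_subset by blast
  have "S = E.S * K"
  proof (rule positive_sqrt_unique[OF positive_S])
    have "E.S * K = L * E.S * L"
      using com[OF ESc Lc] L(2) by (metis mult.assoc)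
    then show "positive_op (E.S * K)"
      using positive_op_conj_self_adjoint[OF E.positive_S positive_op_self_adjoint[OF L(1)]] by simp
    have "E.S * K * (E.S * K) = (E.S * E.S) * (K * K)"
      using com[OF ESc Kc] by (metis mult.assoc)
    then show "S * S = E.S * K * (E.S * K)"
      by (simp add: S_square E.S_square K(2) EPQ)
  qed
  then have "e *\<^sub>R F = E.F * K"
    by (intro bop_eqI) (simp add: F_apply E.F_apply)
  then have "e *\<^sub>R F * (K * V) = E.F * (K * K * V)" by (simp add: mult.assoc)
  then have EF: "E.F = e *\<^sub>R (F * (K * V))" by (simp add: K(2) V(1))
  have "positive_op ((e *\<^sub>R 1 + K) - e *\<^sub>R 1)" using K(1) by simp
  from strictly_positive_op_invertible[OF this e(1)]
  obtain Z where Z: "(e *\<^sub>R 1 + K) * Z = 1" "Z * (e *\<^sub>R 1 + K) = 1" by blast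
  have Zc: "Z \<in> commutant (commutant {P})"
    by (rule commutant_inverse[OF _ Z]) (intro commutant_intros Kc)
  define X where "X = (u - 1) *\<^sub>R (F * (K * V * Z))"
  have KVZ: "K * V * Z \<in> commutant (commutant {P})"
    by (intro commutant_intros Kc V Zc)
  have eK: "e *\<^sub>R 1 - K = (u - 1) *\<^sub>R (Z * P)"
  proof -
    have "(e *\<^sub>R 1 + K) * (e *\<^sub>R 1 - K) = u *\<^sub>R 1 - Q"
      by (simp add: algebra_simps K(2) u_def power2_eq_square)
    also have "\<dots> = (u - 1) *\<^sub>R P" by (simp add: Q_def algebra_simps)
    finally have "Z * ((e *\<^sub>R 1 + K) * (e *\<^sub>R 1 - K)) = (u - 1) *\<^sub>R (Z * P)" by simp
    then show ?thesis using Z(2) by (simp flip: mult.assoc)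
  qed
  have "E.F - F = F * (e *\<^sub>R (K * V) - K * K * V)"
    by (simp add: EF right_diff_distrib K(2) V(1))
  also have "e *\<^sub>R (K * V) - K * K * V = (K * V) * (e *\<^sub>R 1 - K)"
    using com[OF Kc commutant_mult[OF Kc V(3)]]
    by (simp add: right_diff_distrib mult.assoc)
  also have "F * \<dots> = X * P"
    unfolding eK X_def by (simp add: mult.assoc)
  finally have diff: "E.F - F = X * P" .
  have "K * V * Z * P = P * (K * V * Z)"
    by (rule com[OF KVZ double_commutant_self])
  then have "F * (K * V * Z) * P = P * (F * (K * V * Z))"
    using F_commutant by (simp add: commutant_def) (metis mult.assoc)
  then have "X * P = P * X"
    by (simp add: X_def)
  \<comment> \<open>\<open>F\<close> is odd in \<open>D\<close> and in general not in the
    bicommutant of \<open>P\<close> alone; hence the larger generating set.\<close>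
  moreover have "X \<in> commutant (commutant {P, F})"
  proof -
    have "commutant (commutant {P}) \<subseteq> commutant (commutant {P, F})"
      by (intro commutant_antimono) auto
    then have "K * V * Z \<in> commutant (commutant {P, F})" using KVZ by blast
    moreover have "F \<in> commutant (commutant {P, F})"
      using subset_double_commutant[of "{P, F}"] by simp
    ultimately show ?thesis unfolding X_def by (intro commutant_scaleR commutant_mult[of F])
  qed
  ultimately show ?thesis using diff by blast
qed

lemma commuting_P_G_F:
  assumes dom: "\<And>x. x \<in> udom D \<Longrightarrow> bop_apply U x \<in> udom D"
    and app: "\<And>x. x \<in> udom D \<Longrightarrow> uapp D (bop_apply U x) = bop_apply U (uapp D x)"
  shows "P * U = U * P" "G * U = U * G" "F * U = U * F"
proof -
  show PU: "P * U = U * P"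
  proof (rule bop_eqI)
    fix x
    have "bop_apply P (bop_apply U x) = bop_apply U (bop_apply P x)"
      by (rule P_eqI) (simp_all add: dom app P_dom P_dom2 P_right flip: bop_apply_add_right)
    then show "bop_apply (P * U) x = bop_apply (U * P) x" by simp
  qed
  show GU: "G * U = U * G"
  proof (rule bop_eqI)
    fix x
    have "bop_apply P (bop_apply U x) = bop_apply U (bop_apply P x)"
      using PU by (metis bop_apply_simps(7))
    then show "bop_apply (G * U) x = bop_apply (U * G) x" by (simp add: G_apply app P_dom)
  qed
  have "U \<in> commutant {P}" using PU by (simp add: commutant_def)
  then have SU: "S * U = U * S"
    by (rule commutantD[OF S_double_commutant])
  show "F * U = U * F"
  proof (rule S_cancel_right)
    have "F * U * S = G * U" by (metis F_S SU mult.assoc)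
    also have "\<dots> = U * F * S" by (metis F_S GU mult.assoc)
    finally show "F * U * S = U * F * S" .
  qed
qed

text \<open>\<open>(i - D)\<^sup>-\<^sup>1 = -(i + D)(1 + D\<^sup>2)\<^sup>-\<^sup>1\<close>\<close>

lemma P_resolvent: "P = resolvent D \<i> * (\<i> *\<^sub>C P - G)"
proof -
  define R where "R = - (\<i> *\<^sub>C P) - G"
  have ii: "\<i> *\<^sub>C \<i> *\<^sub>C x = - x" for x :: 'h
    by (simp add: scaleC_scaleC scaleC_minus1)
  have R: "bop_apply R y = - (\<i> *\<^sub>C bop_apply P y) - uapp D (bop_apply P y)" for y
    by (simp add: R_def bop_apply_scaleC_left G_apply)
  have neg: "- x \<in> udom D \<and> uapp D (- x) = - uapp D x" if "x \<in> udom D" for x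
    using dom_scaleR[OF that, of "-1"] app_scaleR[OF that, of "-1"] by simp
  have Rdom: "bop_apply R y \<in> udom D" for y
    unfolding R by (intro dom_diff P_dom2) (use neg dom_scaleC P_dom in blast)
  have right: "\<i> *\<^sub>C bop_apply R y - uapp D (bop_apply R y) = y" for y
  proof -
    have "uapp D (bop_apply R y) = - (\<i> *\<^sub>C uapp D (bop_apply P y)) - (y - bop_apply P y)"
      unfolding R using neg[OF dom_scaleC[OF P_dom]]
      by (simp add: app_diff P_dom2 app_scaleC P_dom app_app_P)
    then show ?thesis
      by (simp add: R scaleC_diff_right scaleC_minus_right ii)
  qed
  have left: "bop_apply R (\<i> *\<^sub>C x - uapp D x) = x" if x: "x \<in> udom D" for x
    by (simp add: R P_app_commute[OF x] bop_apply_scaleC scaleC_diff_right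
        scaleC_minus_right ii app_diff dom_scaleC P_dom P_dom2 app_scaleC app_app_P)
  have "resolvent D \<i> = R"
    unfolding resolvent_def bounded_inverse_def unbounded_op.simps
  proof (rule the_equality)
    fix T assume T: "(\<forall>y. bop_apply T y \<in> udom D \<and> \<i> *\<^sub>C bop_apply T y - uapp D (bop_apply T y) = y) \<and>
        (\<forall>x\<in>udom D. bop_apply T (\<i> *\<^sub>C x - uapp D x) = x)"
    show "T = R"
      by (rule bop_eqI) (metis T Rdom right)
  qed (use Rdom right left in auto)
  then show ?thesis
    by (intro bop_eqI) (simp add: bop_apply_scaleC_left G_apply left P_dom
        del: bop_apply_diff_right)
qed

end

section \<open>Affiliated operators\<close>

lemma commutant_star:
  assumes "\<And>X. X \<in> S \<Longrightarrow> star X \<in> S" "T \<in> commutant S"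
  shows "star T \<in> commutant S"
  unfolding commutant_def
proof (intro CollectI ballI)
  fix X assume "X \<in> S"
  then have "T * star X = star X * T"
    using assms by (blast intro: commutantD)
  then have "star (T * star X) = star (star X * T)" by simp
  then show "star T * X = X * star T" by (simp add: star_mult star_star)
qed

text \<open>\<open>T\<close> is the real part of the unitary \<open>T + i C\<close> with
  \<open>C\<close> the positive root of \<open>1 - T^2\<close>. As \<open>C\<close> lies in the
  bicommutant of \<open>1 - T^2\<close>, whatever commutes with \<open>T\<close> commutes with the
  unitary.\<close>

lemma self_adjoint_half_unitary_sum:
  fixes T :: "'h::chilbert_space bop"
  assumes sa: "star T = T" and "norm T \<le> 1"
  obtains U where "unitary U" "U + star U = 2 *\<^sub>R T" "\<And>X. X * T = T * X \<Longrightarrow> X * U = U * X"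
proof -
  have saTT: "star (T * T) = T * T" by (simp add: star_mult sa)
  have "norm (T * T) \<le> 1"
    using norm_power_bop_le[OF assms(2), of 2] by (simp add: power2_eq_square)
  then have pos: "positive_op (1 - T * T)" by (rule positive_op_one_minus[OF saTT])
  have "positive_op (1 - (1 - T * T))" using positive_op_square[OF sa] by simp
  from positive_sqrt_exists[OF pos this] obtain C
    where C: "positive_op C" "C * C = 1 - T * T" "C \<in> commutant (commutant {1 - T * T})" by blast
  have com: "X * C = C * X" if "X * T = T * X" for X
  proof -
    have "X * (T * T) = T * T * X" using that by (metis mult.assoc)
    then have "X \<in> commutant {1 - T * T}"
      by (simp add: commutant_def right_diff_distrib left_diff_distrib)
    then show ?thesis using commutantD[OF C(3)] by simp
  qed
  have TC: "T * C = C * T" by (rule com) simp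
  have ii: "\<i> *\<^sub>C \<i> *\<^sub>C X = - X" for X :: "'h bop"
    by (simp add: scaleC_scaleC scaleC_minus1)
  define U where "U = T + \<i> *\<^sub>C C"
  have "star U = T + (- \<i>) *\<^sub>C C"
    by (simp add: U_def star_add star_scaleC sa positive_op_self_adjoint[OF C(1)])
  also have "(- \<i>) *\<^sub>C C = - (\<i> *\<^sub>C C)"
    using scaleC_scaleC[of "- 1" \<i> C] by (simp add: scaleC_minus1)
  finally have sU: "star U = T - \<i> *\<^sub>C C" by simp
  have "unitary U"
    unfolding unitary_def sU unfolding U_def
    by (simp add: algebra_simps scaleC_mult_left scaleC_mult_right scaleC_add_right
        scaleC_diff_right ii TC C(2))
  moreover have "U + star U = 2 *\<^sub>R T"
    unfolding sU by (simp add: U_def scaleR_2)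
  moreover have "X * U = U * X" if "X * T = T * X" for X
    using that com[OF that]
    by (simp add: U_def distrib_left distrib_right scaleC_mult_left scaleC_mult_right)
  ultimately show ?thesis using that by blast
qed

text \<open>The unitaries span the commutant of a star-closed set. Affiliation is a condition on
  such unitaries, and this converts it into membership in \<open>N\<close>.\<close>

lemma double_commutantI_unitary:
  assumes N: "\<And>X. X \<in> N \<Longrightarrow> star X \<in> N"
    and com: "\<And>U. U \<in> commutant N \<Longrightarrow> unitary U \<Longrightarrow> X * U = U * X"
  shows "X \<in> commutant (commutant N)"
proof -
  have contr: "X * T = T * X" if T: "T \<in> commutant N" "star T = T" "norm T \<le> 1" for T
  proof -
    obtain U where U: "unitary U" "U + star U = 2 *\<^sub>R T" "\<And>Y. Y * T = T * Y \<Longrightarrow> Y * U = U * Y"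
      using self_adjoint_half_unitary_sum[OF T(2,3)] by blast
    have UN: "U \<in> commutant N"
      using U(3) commutantD[OF T(1)] by (simp add: commutant_def)
    have "star U \<in> commutant N" by (rule commutant_star[OF N UN])
    moreover have "unitary (star U)" using U(1) by (simp add: unitary_def star_star)
    ultimately have "X * star U = star U * X" by (rule com)
    then have "X * (U + star U) = (U + star U) * X"
      using com[OF UN U(1)] by (simp add: distrib_left distrib_right)
    then show ?thesis unfolding U(2) by simp
  qed
  have sa: "X * T = T * X" if T: "T \<in> commutant N" "star T = T" for T
  proof (cases "T = 0")
    case False
    have "X * ((1 / norm T) *\<^sub>R T) = ((1 / norm T) *\<^sub>R T) * X"
      by (rule contr) (use T False in \<open>simp_all add: commutant_scaleR star_scaleR\<close>)
    then show ?thesis using False by simp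
  qed simp
  have "X * T = T * X" if T: "T \<in> commutant N" for T
  proof -
    have sT: "star T \<in> commutant N" by (rule commutant_star[OF N T])
    \<comment> \<open>\<open>T + star T\<close> and \<open>\<i> *\<^sub>C (T - star T)\<close> are
      self-adjoint, and together they recover \<open>T\<close>.\<close>
    have "X * (T + star T) = (T + star T) * X"
      by (rule sa) (use T sT in \<open>simp_all add: commutant_add star_add star_star add.commute\<close>)
    moreover have "X * (\<i> *\<^sub>C (T - star T)) = (\<i> *\<^sub>C (T - star T)) * X"
    proof (rule sa)
      show "\<i> *\<^sub>C (T - star T) \<in> commutant N"
        by (intro commutant_scaleC commutant_diff T sT)
      have "star (\<i> *\<^sub>C (T - star T)) = (\<i> * (-1)) *\<^sub>C (star T - T)"
        by (simp add: star_scaleC star_diff star_star)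
      also have "\<dots> = \<i> *\<^sub>C (T - star T)"
        unfolding scaleC_scaleC[symmetric] scaleC_minus1 by simp
      finally show "star (\<i> *\<^sub>C (T - star T)) = \<i> *\<^sub>C (T - star T)" .
    qed
    then have "(- \<i>) *\<^sub>C \<i> *\<^sub>C (X * (T - star T)) = (- \<i>) *\<^sub>C \<i> *\<^sub>C ((T - star T) * X)"
      by (simp only: scaleC_mult_left scaleC_mult_right)
    then have "X * (T - star T) = (T - star T) * X"
      by (simp add: scaleC_scaleC)
    ultimately have "X * (T + star T) + X * (T - star T) = (T + star T) * X + (T - star T) * X"
      by simp
    then have "2 *\<^sub>R (X * T) = 2 *\<^sub>R (T * X)"
      by (simp add: algebra_simps scaleR_2)
    then show ?thesis by simp
  qed
  then show ?thesis by (simp add: commutant_def)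
qed

lemma (in self_adjoint_operator) affiliated_P_G_F:
  assumes N: "von_neumann_algebra N" and aff: "affiliated D N"
  shows "P \<in> N" "G \<in> N" "F \<in> N"
proof -
  have st: "star X \<in> N" if "X \<in> N" for X
    using N that by (simp add: von_neumann_algebra_def star_subalgebra_def)
  have cc: "commutant (commutant N) = N"
    using N by (simp add: von_neumann_algebra_def)
  have "P * U = U * P \<and> G * U = U * G \<and> F * U = U * F" if "U \<in> commutant N" "unitary U" for U
  proof -
    have "bop_apply U ` udom D = udom D"
      and "\<And>x. x \<in> udom D \<Longrightarrow> uapp D (bop_apply U x) = bop_apply U (uapp D x)"
      using aff that by (auto simp: affiliated_def)
    then show ?thesis using commuting_P_G_F[of U] by blast
  qed
  then show "P \<in> N" "G \<in> N" "F \<in> N"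
    using double_commutantI_unitary[OF st] unfolding cc by blast+
qed

section \<open>Ideals\<close>

lemma csubspace_diff: "csubspace S \<Longrightarrow> x \<in> S \<Longrightarrow> y \<in> S \<Longrightarrow> x - y \<in> S"
  unfolding csubspace_def using scaleC_minus1[of y] by (metis add_uminus_conv_diff)

lemma csubspace_minus: "csubspace S \<Longrightarrow> x \<in> S \<Longrightarrow> - x \<in> S"
  unfolding csubspace_def using scaleC_minus1[of x] by metis

text \<open>For an approximate unit \<open>e\<close> the products \<open>x e_n\<close> tend to
  \<open>x\<close>, so \<open>e_n (star x)\<close> tends to \<open>star x\<close>; these lie in
  \<open>J\<close> because \<open>e_n\<close> does and \<open>star x\<close> is in
  \<open>N\<close>.\<close>

lemma sigma_unital_ideal_star:
  assumes N: "star_subalgebra N" and J: "closed_ideal N J" "sigma_unital J" and x: "x \<in> J"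
  shows "star x \<in> J"
proof -
  obtain e :: "nat \<Rightarrow> 'a" where e: "\<And>n. e n \<in> J" "\<And>n. positive_in J (e n)"
    "\<And>x. x \<in> J \<Longrightarrow> (\<lambda>n. x * e n) \<longlonglongrightarrow> x"
    using J(2) unfolding sigma_unital_def by blast
  have "star (e n) = e n" for n
    using e(2)[of n] by (auto simp: positive_in_def star_mult star_star)
  then have lim: "(\<lambda>n. e n * star x) \<longlonglongrightarrow> star x"
    using bounded_linear.tendsto[OF bounded_linear_star e(3)[OF x]] by (simp add: star_mult)
  have mem: "e n * star x \<in> J" for n
    using N J(1) x e(1) by (auto simp: closed_ideal_def star_subalgebra_def)
  have "closed J" using J(1) by (simp add: closed_ideal_def)
  then show ?thesis by (rule closed_sequentially[OF _ mem lim])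
qed

lemma closure_star_subalgebra:
  fixes A :: "'a::cstar_algebra set"
  assumes A: "star_subalgebra A"
  shows "cstar_subalgebra (closure A)"
proof -
  have bl: "bounded_linear (\<lambda>x::'a. c *\<^sub>C x)" for c
    by (rule bounded_linear_intro[of _ "cmod c"])
      (auto simp: scaleC_add_right scaleC_scaleR_commute norm_scaleC mult.commute)
  have lim: "\<exists>f. (\<forall>n. f n \<in> A) \<and> f \<longlonglongrightarrow> x" if "x \<in> closure A" for x
    using that by (simp add: closure_sequential)
  have cl: "x \<in> closure A" if "\<And>n. f n \<in> A" "f \<longlonglongrightarrow> x" for f x
    unfolding closure_sequential using that by blast
  have "0 \<in> closure A"
    using A closure_subset by (auto simp: star_subalgebra_def csubspace_def)
  moreover have "x + y \<in> closure A \<and> x * y \<in> closure A" if xy: "x \<in> closure A" "y \<in> closure A" for x y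
  proof -
    obtain f g where f: "\<And>n. f n \<in> A" "f \<longlonglongrightarrow> x" and g: "\<And>n. g n \<in> A" "g \<longlonglongrightarrow> y"
      using lim[OF xy(1)] lim[OF xy(2)] by blast
    have "f n + g n \<in> A" "f n * g n \<in> A" for n
      using A f(1) g(1) by (auto simp: star_subalgebra_def csubspace_def)
    then show ?thesis
      using cl[OF _ tendsto_add[OF f(2) g(2)]] cl[OF _ tendsto_mult[OF f(2) g(2)]] by blast
  qed
  moreover have "c *\<^sub>C x \<in> closure A \<and> star x \<in> closure A" if x: "x \<in> closure A" for c x
  proof -
    obtain f where f: "\<And>n. f n \<in> A" "f \<longlonglongrightarrow> x"
      using lim[OF x] by blast
    have "c *\<^sub>C f n \<in> A" "star (f n) \<in> A" for n
      using A f(1) by (auto simp: star_subalgebra_def csubspace_def)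
    then show ?thesis
      using cl[OF _ bounded_linear.tendsto[OF bl f(2)]]
        cl[OF _ bounded_linear.tendsto[OF bounded_linear_star f(2)]] by blast
  qed
  ultimately show ?thesis
    by (simp add: cstar_subalgebra_def star_subalgebra_def csubspace_def)
qed

lemma star_subalgebra_image:
  assumes "star_subalgebra \<A>" "star_hom_on \<A> \<pi>"
  shows "star_subalgebra (\<pi> ` \<A>)"
proof -
  have zero: "0 \<in> \<A>" using assms(1) by (simp add: star_subalgebra_def csubspace_def)
  have "\<pi> (0 *\<^sub>C 0) = 0 *\<^sub>C \<pi> 0" using assms(2) zero unfolding star_hom_on_def by blast
  then have "0 \<in> \<pi> ` \<A>" using zero by (metis image_eqI scaleC_zero_left)
  moreover have "x + y \<in> \<pi> ` \<A> \<and> x * y \<in> \<pi> ` \<A>" if xy: "x \<in> \<pi> ` \<A>" "y \<in> \<pi> ` \<A>" for x y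
  proof -
    obtain a b where ab: "a \<in> \<A>" "b \<in> \<A>" "x = \<pi> a" "y = \<pi> b" using xy by blast
    then have "x + y = \<pi> (a + b)" "x * y = \<pi> (a * b)" "a + b \<in> \<A>" "a * b \<in> \<A>"
      using assms by (simp_all add: star_hom_on_def star_subalgebra_def csubspace_def)
    then show ?thesis by simp
  qed
  moreover have "c *\<^sub>C x \<in> \<pi> ` \<A> \<and> star x \<in> \<pi> ` \<A>" if x: "x \<in> \<pi> ` \<A>" for c x
  proof -
    obtain a where a: "a \<in> \<A>" "x = \<pi> a" using x by blast
    then have "c *\<^sub>C x = \<pi> (c *\<^sub>C a)" "star x = \<pi> (star a)" "c *\<^sub>C a \<in> \<A>" "star a \<in> \<A>"
      using assms by (simp_all add: star_hom_on_def star_subalgebra_def csubspace_def)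
    then show ?thesis by simp
  qed
  ultimately show ?thesis by (simp add: star_subalgebra_def csubspace_def)
qed

section \<open>The ideal as a Hilbert module\<close>

lemma ideal_module_simps [simp]:
  "mcarrier (ideal_module J) = J" "ract (ideal_module J) x b = x * b"
  "minner (ideal_module J) x y = star x * y" "mnorm (ideal_module J) x = norm x"
  by (simp_all add: ideal_module_def mnorm_def norm_star_mult)

lemma star_mult_self_eq_0_iff: "star x * x = 0 \<longleftrightarrow> x = (0 :: 'a::cstar_algebra)"
  by (metis norm_eq_zero norm_star_mult power2_eq_iff_nonneg zero_power2 mult_zero_right norm_ge_zero)

text \<open>By the C*-identity the module norm is the norm of \<open>J\<close>, so completeness is
  closedness of \<open>J\<close>.\<close>

lemma hilbert_module_ideal:
  assumes J: "cstar_subalgebra J"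
  shows "hilbert_module J (ideal_module J)"
proof -
  have sub: "csubspace J" "\<And>x y. x \<in> J \<Longrightarrow> y \<in> J \<Longrightarrow> x * y \<in> J" "\<And>x. x \<in> J \<Longrightarrow> star x \<in> J" "closed J"
    using J by (auto simp: cstar_subalgebra_def star_subalgebra_def)
  have "right_module J (ideal_module J)"
    using sub by (simp add: right_module_def algebra_simps scaleC_mult_left scaleC_mult_right)
  moreover have "\<exists>x\<in>J. (\<lambda>n. norm (s n - x)) \<longlonglongrightarrow> 0"
    if s: "\<forall>n. s n \<in> J" "\<forall>\<epsilon>>0. \<exists>M. \<forall>m\<ge>M. \<forall>n\<ge>M. norm (s m - s n) < \<epsilon>" for s :: "nat \<Rightarrow> 'a"
  proof -
    have "Cauchy s" using s(2) by (simp add: Cauchy_def dist_norm)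
    then obtain x where x: "s \<longlonglongrightarrow> x" using Cauchy_convergent_iff convergent_def by blast
    then have "x \<in> J" using sub(4) s(1) closed_sequentially by blast
    then show ?thesis using tendsto_norm_zero[OF LIM_zero[OF x]] by blast
  qed
  ultimately show ?thesis
    using sub unfolding hilbert_module_def
    by (simp add: star_mult star_star algebra_simps scaleC_mult_right star_mult_self_eq_0_iff
        positive_in_def) blast
qed

lemma countably_generated_ideal:
  assumes "sigma_unital J"
  shows "countably_generated J (ideal_module J)"
proof -
  obtain e :: "nat \<Rightarrow> 'a" where e: "\<And>n. e n \<in> J" "\<And>x. x \<in> J \<Longrightarrow> (\<lambda>n. e n * x) \<longlonglongrightarrow> x"
    using assms unfolding sigma_unital_def by blast
  have "\<exists>y\<in>csubspace hull {g * b | g b. g \<in> range e \<and> b \<in> J}. norm (x - y) < \<epsilon>"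
    if x: "x \<in> J" "0 < \<epsilon>" for x \<epsilon>
  proof -
    obtain n where "norm (e n * x - x) < \<epsilon>"
      using e(2)[OF x(1)] x(2) unfolding LIMSEQ_iff by blast
    moreover have "e n * x \<in> csubspace hull {g * b | g b. g \<in> range e \<and> b \<in> J}"
      by (rule hull_inc) (use x in blast)
    ultimately show ?thesis
      by (intro bexI[of _ "e n * x"]) (simp_all add: norm_minus_commute)
  qed
  then show ?thesis
    unfolding countably_generated_def using e(1)
    by (intro exI[of _ "range e"]) auto
qed

lemma is_madjoint_left_mult:
  assumes "\<And>x. x \<in> J \<Longrightarrow> star a * x \<in> J"
  shows "is_madjoint (ideal_module J) (left_mult J a) (left_mult J (star a))"
  using assms by (auto simp: is_madjoint_def left_mult_def star_mult mult.assoc)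

lemma is_madjoint_ideal_unique:
  assumes J: "csubspace J"
    and S: "is_madjoint (ideal_module J) T S" "is_madjoint (ideal_module J) T S'"
  shows "S = S'"
proof (rule PiE_ext)
  show "S \<in> J \<rightarrow>\<^sub>E J" "S' \<in> J \<rightarrow>\<^sub>E J"
    using S by (simp_all add: is_madjoint_def)
  fix y assume y: "y \<in> J"
  \<comment> \<open>The difference lies in \<open>J\<close> and may itself be used as test
    vector.\<close>
  define z where "z = S y - S' y"
  have "S y \<in> J" "S' y \<in> J"
    using y S by (auto simp: is_madjoint_def)
  then have "z \<in> J" unfolding z_def by (rule csubspace_diff[OF J])
  then have "star z * S y = star z * S' y"
    using S y by (simp add: is_madjoint_def)
  then have "star z * z = 0" by (simp add: z_def right_diff_distrib)
  then show "S y = S' y" by (simp add: star_mult_self_eq_0_iff z_def)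
qed

lemma madjoint_left_mult:
  assumes "csubspace J" "\<And>x. x \<in> J \<Longrightarrow> star a * x \<in> J"
  shows "madjoint (ideal_module J) (left_mult J a) = left_mult J (star a)"
  unfolding madjoint_def
  using is_madjoint_left_mult[of J a] is_madjoint_ideal_unique[OF assms(1)] assms(2)
  by (intro the_equality) auto

lemma left_mult_adjointable:
  assumes "\<And>x. x \<in> J \<Longrightarrow> a * x \<in> J" "\<And>x. x \<in> J \<Longrightarrow> star a * x \<in> J"
  shows "left_mult J a \<in> adjointable (ideal_module J)"
proof -
  have "is_madjoint (ideal_module J) (left_mult J a) (left_mult J (star a))"
    by (rule is_madjoint_left_mult) (rule assms)
  then show ?thesis
    using assms(1) unfolding adjointable_def by (auto simp: left_mult_def)
qed

text \<open>With an approximate unit \<open>e\<close> of \<open>J\<close>, left multiplication by \<open>t\<close> is approximated by the rank one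
  operators \<open>z \<mapsto> t \<langle>e\<^sub>n, z\<rangle> = t e\<^sub>n z\<close>.\<close>

lemma left_mult_compact:
  assumes J: "cstar_subalgebra J" "sigma_unital J" and t: "t \<in> J"
  shows "left_mult J t \<in> compact_ops (ideal_module J)"
proof -
  have sub: "\<And>x y. x \<in> J \<Longrightarrow> y \<in> J \<Longrightarrow> x * y \<in> J" "\<And>x. x \<in> J \<Longrightarrow> star x \<in> J"
    using J(1) by (auto simp: cstar_subalgebra_def star_subalgebra_def)
  obtain e :: "nat \<Rightarrow> 'a" where e: "\<And>n. e n \<in> J" "\<And>n. positive_in J (e n)"
    "\<And>x. x \<in> J \<Longrightarrow> (\<lambda>n. x * e n) \<longlonglongrightarrow> x"
    using J(2) unfolding sigma_unital_def by blast
  have sa: "star (e n) = e n" for n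
    using e(2)[of n] by (auto simp: positive_in_def star_mult star_star)
  have "\<exists>S\<in>finite_rank (ideal_module J). \<forall>x\<in>J. norm x \<le> 1 \<longrightarrow> norm (left_mult J t x - S x) \<le> \<epsilon>"
    if \<epsilon>: "0 < \<epsilon>" for \<epsilon>
  proof -
    obtain n where n: "norm (t * e n - t) < \<epsilon>"
      using e(3)[OF t] \<epsilon> unfolding LIMSEQ_iff by blast
    define S where "S = (\<lambda>z\<in>J. \<Sum>i<(1::nat). t * (star (e n) * z))"
    have "S \<in> finite_rank (ideal_module J)"
      unfolding finite_rank_def
      by (rule CollectI, rule exI[of _ 1], rule exI[of _ "\<lambda>_. t"], rule exI[of _ "\<lambda>_. e n"])
        (simp add: S_def t e(1))
    moreover have "norm (left_mult J t x - S x) \<le> \<epsilon>" if x: "x \<in> J" "norm x \<le> 1" for x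
    proof -
      have "left_mult J t x - S x = - ((t * e n - t) * x)"
        using x by (simp add: left_mult_def S_def sa algebra_simps)
      then have "norm (left_mult J t x - S x) \<le> norm (t * e n - t) * norm x"
        by (simp only: norm_minus_cancel norm_mult_ineq)
      also have "\<dots> \<le> \<epsilon> * 1"
        using n x(2) \<epsilon> by (intro mult_mono) auto
      finally show ?thesis by simp
    qed
    ultimately show ?thesis by blast
  qed
  moreover have "left_mult J t \<in> adjointable (ideal_module J)"
    by (rule left_mult_adjointable) (use sub t in auto)
  ultimately show ?thesis by (simp add: compact_ops_def)
qed

text \<open>Each of the three defects is left multiplication by an element of \<open>J\<close>, and
  such operators are compact by \<open>left_mult_compact\<close>.\<close>

lemma kasparov_module_ideal:
  fixes N J A :: "'b::cstar_algebra set"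
  assumes N: "star_subalgebra N" and J: "closed_ideal N J" "sigma_unital J"
    and A: "cstar_subalgebra A" "A \<subseteq> N" and F: "F \<in> N"
    and comp: "\<And>a. a \<in> A \<Longrightarrow> a * (F * F) - a \<in> J" "\<And>a. a \<in> A \<Longrightarrow> a * (F - star F) \<in> J"
      "\<And>a. a \<in> A \<Longrightarrow> F * a - a * F \<in> J"
  shows "kasparov_module A J (ideal_module J) (left_mult J) (left_mult J F)"
proof -
  have Jsub: "J \<subseteq> N" "csubspace J" "closed J"
    and NJ: "\<And>n x. n \<in> N \<Longrightarrow> x \<in> J \<Longrightarrow> n * x \<in> J"
    using J(1) by (auto simp: closed_ideal_def)
  have Nstar: "\<And>n. n \<in> N \<Longrightarrow> star n \<in> N"
    using N by (simp add: star_subalgebra_def)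
  have cJ: "cstar_subalgebra J"
    using Jsub NJ sigma_unital_ideal_star[OF N J]
    by (auto simp: cstar_subalgebra_def star_subalgebra_def)
  have adj: "left_mult J n \<in> adjointable (ideal_module J)" if "n \<in> N" for n
    by (rule left_mult_adjointable) (use that NJ Nstar in auto)
  have madj: "madjoint (ideal_module J) (left_mult J n) = left_mult J (star n)" if "n \<in> N" for n
    by (rule madjoint_left_mult[OF Jsub(2)]) (use that NJ Nstar in auto)
  have rep: "module_rep A (ideal_module J) (left_mult J)"
    unfolding module_rep_def
  proof (intro conjI ballI allI)
    show "left_mult J ` A \<subseteq> adjointable (ideal_module J)" using adj A(2) by blast
    fix a assume a: "a \<in> A"
    then have aJ: "a * x \<in> J" if "x \<in> J" for x using NJ A(2) that by blast
    show "left_mult J (star a) = madjoint (ideal_module J) (left_mult J a)"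
      using madj a A(2) by auto
    show "left_mult J (c *\<^sub>C a) = mscale (ideal_module J) c (left_mult J a)" for c
      by (auto simp: left_mult_def mscale_def scaleC_mult_left restrict_def)
    fix b assume b: "b \<in> A"
    then have bJ: "b * x \<in> J" if "x \<in> J" for x using NJ A(2) that by blast
    show "left_mult J (a + b) = mplus (ideal_module J) (left_mult J a) (left_mult J b)"
      by (auto simp: left_mult_def mplus_def distrib_right restrict_def)
    show "left_mult J (a * b) = mtimes (ideal_module J) (left_mult J a) (left_mult J b)"
      using bJ by (auto simp: left_mult_def mtimes_def mult.assoc restrict_def)
  qed
  have cpt: "left_mult J t \<in> compact_ops (ideal_module J)" if "t \<in> J" for t
    by (rule left_mult_compact[OF cJ J(2) that])
  have "mtimes (ideal_module J) (left_mult J a)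
      (mminus (ideal_module J) (mtimes (ideal_module J) (left_mult J F) (left_mult J F)) (mone (ideal_module J)))
      = left_mult J (a * (F * F) - a)" for a
    using NJ[OF F] csubspace_diff[OF Jsub(2)]
    by (auto simp: mtimes_def mminus_def mone_def left_mult_def restrict_def fun_eq_iff algebra_simps)
  moreover have "mtimes (ideal_module J) (left_mult J a) (mminus (ideal_module J) (left_mult J F)
      (madjoint (ideal_module J) (left_mult J F))) = left_mult J (a * (F - star F))" for a
    using NJ[OF F] NJ[OF Nstar[OF F]] csubspace_diff[OF Jsub(2)] madj[OF F]
    by (auto simp: mtimes_def mminus_def left_mult_def restrict_def fun_eq_iff algebra_simps)
  moreover have "mminus (ideal_module J) (mtimes (ideal_module J) (left_mult J F) (left_mult J a))
      (mtimes (ideal_module J) (left_mult J a) (left_mult J F)) = left_mult J (F * a - a * F)"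
    if "a \<in> A" for a
    using NJ[OF F] NJ[of a] that A(2)
    by (auto simp: mtimes_def mminus_def left_mult_def restrict_def fun_eq_iff algebra_simps)
  ultimately show ?thesis
    unfolding kasparov_module_def
    using A(1) cJ hilbert_module_ideal[OF cJ] countably_generated_ideal[OF J(2)] rep adj[OF F] cpt comp
    by simp
qed

text \<open>\<open>F\<close> is replaced by the transform \<open>E.F\<close> of \<open>eD\<close>.
  The difference can be written as \<open>X * P\<close> to the left of \<open>a\<close> and as
  \<open>P * X\<close> to its right, so \<open>P * a\<close> and \<open>a * P\<close> both have to
  lie in \<open>J\<close>.\<close>

lemma (in self_adjoint_operator) F_commutator_mem_ideal:
  assumes N: "von_neumann_algebra N" and J: "closed_ideal N J" and aff: "affiliated D N"
    and a: "\<And>x. x \<in> udom D \<Longrightarrow> bop_apply a x \<in> udom D"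
    and B: "\<And>x. x \<in> udom D \<Longrightarrow> bop_apply B x = uapp D (bop_apply a x) - bop_apply a (uapp D x)"
    and aP: "a * P \<in> J" "P * a \<in> J"
  shows "F * a - a * F \<in> J"
proof -
  have sub: "csubspace J" "closed J" and ideal: "\<And>n x. n \<in> N \<Longrightarrow> x \<in> J \<Longrightarrow> n * x \<in> J \<and> x * n \<in> J"
    using J by (auto simp: closed_ideal_def)
  have PF: "commutant (commutant {P, F}) \<subseteq> N"
  proof -
    have "{P, F} \<subseteq> N" using affiliated_P_G_F[OF N aff] by simp
    then have "commutant (commutant {P, F}) \<subseteq> commutant (commutant N)"
      by (intro commutant_antimono)
    then show ?thesis using N by (simp add: von_neumann_algebra_def)
  qed
  have "\<exists>j\<in>J. norm (j - (F * a - a * F)) \<le> inverse (Suc n) * (2 * norm B)" for n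
  proof -
    define e where "e = inverse (real (Suc n))"
    have e: "0 < e" "e \<le> 1" by (simp_all add: e_def field_simps)
    interpret E: self_adjoint_operator "scale_op e D"
      by (rule self_adjoint_scale_op) (use e in simp)
    obtain X where X: "X \<in> commutant (commutant {P, F})" "E.F - F = X * P" "X * P = P * X"
      using scaled_F_diff[OF e] by blast
    have XN: "X \<in> N" using X(1) PF by blast
    have "(E.F - F) * a \<in> J" "a * (E.F - F) \<in> J"
      using ideal[OF XN aP(1)] ideal[OF XN aP(2)] by (simp_all add: X(2) mult.assoc) (simp add: X(3) flip: mult.assoc)
    then have "a * (E.F - F) - (E.F - F) * a \<in> J"
      by (intro csubspace_diff[OF sub(1)])
    moreover have "norm (E.F * a - a * E.F) \<le> 2 * norm (e *\<^sub>R B)"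
      by (rule E.norm_F_commutator_le) (simp_all add: a B scaleR_right_diff_distrib)
    \<comment> \<open>The element of \<open>J\<close> differs from \<open>[F, a]\<close> by
      \<open>- [E.F, a]\<close>, whose norm is at most \<open>2 e\<close> times that of
      \<open>B\<close>.\<close>
    moreover have "(a * (E.F - F) - (E.F - F) * a) - (F * a - a * F) = - (E.F * a - a * E.F)"
      by (simp add: algebra_simps)
    ultimately show ?thesis
      using e(1) by (intro bexI[of _ "a * (E.F - F) - (E.F - F) * a"])
        (simp_all only: norm_minus_cancel norm_scaleR, simp add: e_def)
  qed
  then obtain j where j: "\<And>n. j n \<in> J"
    and nj: "\<And>n. norm (j n - (F * a - a * F)) \<le> inverse (Suc n) * (2 * norm B)" by metis
  have "j \<longlonglongrightarrow> F * a - a * F"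
  proof (rule LIM_zero_cancel, rule Lim_null_comparison)
    show "\<forall>\<^sub>F n in sequentially. norm (j n - (F * a - a * F)) \<le> inverse (Suc n) * (2 * norm B)"
      using nj by (intro always_eventually) blast
    show "(\<lambda>n. inverse (real (Suc n)) * (2 * norm B)) \<longlonglongrightarrow> 0"
      by (rule tendsto_mult_left_zero[OF LIMSEQ_inverse_real_of_nat])
  qed
  then show ?thesis using sub(2) j closed_sequentially by blast
qed

theorem theorem4p1:
  fixes N J :: "'h::chilbert_space bop set"
    and \<A> :: "'a::star_algebra set" and \<pi> :: "'a \<Rightarrow> 'h bop"
    and D :: "'h unbounded_op"
    and A :: "'h bop set" and F :: "'h bop"
  assumes "von_neumann_spectral_triple N J \<A> \<pi> D"
    and "sigma_unital J"
    and "A = closure (\<pi> ` \<A>)"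
    and "F = bounded_transform D"
  shows "F \<in> N \<and>
    (\<forall>a\<in>A. F * a - a * F \<in> J \<and> a * (1 - F\<^sup>2) \<in> J \<and> a * (F - star F) \<in> J) \<and>
    kasparov_module A J (ideal_module J) (left_mult J) (left_mult J F)"
proof -
  have N: "von_neumann_algebra N" and J: "closed_ideal N J" and \<A>: "star_subalgebra \<A>"
    and \<pi>: "star_hom_on \<A> \<pi>" "\<pi> ` \<A> \<subseteq> N" and sa: "self_adjoint_op D" and aff: "affiliated D N"
    and bdd: "\<And>a. a \<in> \<A> \<Longrightarrow> bop_apply (\<pi> a) ` udom D \<subseteq> udom D \<and>
        (\<exists>B :: 'h bop. \<forall>x\<in>udom D.
           bop_apply B x = uapp D (bop_apply (\<pi> a) x) - bop_apply (\<pi> a) (uapp D x))"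
    and res: "\<And>a w. a \<in> \<A> \<Longrightarrow> w \<notin> \<real> \<Longrightarrow> \<pi> a * resolvent D w \<in> J"
    using assms(1) unfolding von_neumann_spectral_triple_def by auto
  interpret D: self_adjoint_operator D by unfold_locales (rule sa)
  have F: "F = D.F" by (simp add: assms(4) D.F_def)
  have Ns: "star_subalgebra N" and Ncc: "commutant (commutant N) = N"
    using N by (simp_all add: von_neumann_algebra_def)
  \<comment> \<open>\<open>N\<close> is a commutant, hence norm closed; this keeps the closure
    \<open>A\<close> inside \<open>N\<close>.\<close>
  have closedN: "closed N" using closed_commutant[of "commutant N"] by (simp add: Ncc)
  have PN: "D.P \<in> N" "D.G \<in> N" "D.F \<in> N" by (rule D.affiliated_P_G_F[OF N aff])+
  have sub: "csubspace J" "closed J" and ideal: "\<And>n x. n \<in> N \<Longrightarrow> x \<in> J \<Longrightarrow> n * x \<in> J \<and> x * n \<in> J"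
    using J by (auto simp: closed_ideal_def)
  have aP: "\<pi> a * D.P \<in> J" if "a \<in> \<A>" for a
  proof -
    have "\<i> *\<^sub>C D.P - D.G \<in> N"
      using commutant_diff[OF commutant_scaleC] PN Ncc by metis
    moreover have "\<pi> a * resolvent D \<i> \<in> J"
      by (rule res[OF that]) (simp add: complex_is_Real_iff)
    ultimately have "\<pi> a * resolvent D \<i> * (\<i> *\<^sub>C D.P - D.G) \<in> J" using ideal by blast
    then show ?thesis by (metis D.P_resolvent mult.assoc)
  qed
  \<comment> \<open>The spectral triple controls only \<open>a\<close> times the resolvent; the
    other order is the adjoint of the case \<open>star a\<close>.\<close>
  have Pa: "D.P * \<pi> a \<in> J" if a: "a \<in> \<A>" for a
  proof -
    have a': "star a \<in> \<A>" "\<pi> (star a) = star (\<pi> a)"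
      using a \<A> \<pi>(1) by (simp_all add: star_subalgebra_def star_hom_on_def)
    have "star (\<pi> (star a) * D.P) \<in> J"
      by (rule sigma_unital_ideal_star[OF Ns J assms(2) aP[OF a'(1)]])
    then show ?thesis
      by (simp add: a'(2) star_mult star_star positive_op_self_adjoint[OF D.positive_P])
  qed
  have "D.F * \<pi> a - \<pi> a * D.F \<in> J" if a: "a \<in> \<A>" for a
  proof -
    obtain B where "\<forall>x\<in>udom D. bop_apply B x = uapp D (bop_apply (\<pi> a) x) - bop_apply (\<pi> a) (uapp D x)"
      using bdd[OF a] by blast
    then show ?thesis
      using bdd[OF a] by (intro D.F_commutator_mem_ideal[OF N J aff _ _ aP[OF a] Pa[OF a], of B]) auto
  qed
  \<comment> \<open>A bounded commutator with \<open>D\<close> is available only for elements of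
    \<open>\<A>\<close>. Since \<open>F\<close> is bounded, \<open>a \<mapsto> [F, a]\<close> is
    continuous and the closed set \<open>J\<close> also receives the closure.\<close>
  then have "\<pi> ` \<A> \<subseteq> (\<lambda>a. D.F * a - a * D.F) -` J" by blast
  moreover have "closed ((\<lambda>a. D.F * a - a * D.F) -` J)"
    by (intro closed_vimage sub continuous_intros)
  ultimately have comm: "F * a - a * F \<in> J" if "a \<in> A" for a
    using closure_minimal that unfolding assms(3) F by blast
  have "\<pi> ` \<A> \<subseteq> (\<lambda>a. a * D.P) -` J" using aP by blast
  moreover have "closed ((\<lambda>a. a * D.P) -` J)"
    by (intro closed_vimage sub continuous_intros)
  ultimately have AP: "a * D.P \<in> J" if "a \<in> A" for a
    using closure_minimal that unfolding assms(3) by blast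
  have FF: "1 - F\<^sup>2 = D.P" by (simp add: power2_eq_square F D.F_square)
  have sF: "F - star F = 0" by (simp add: F D.self_adjoint_F)
  have J0: "0 \<in> J" using sub(1) by (simp add: csubspace_def)
  have "kasparov_module A J (ideal_module J) (left_mult J) (left_mult J F)"
  proof (rule kasparov_module_ideal[OF Ns J assms(2)])
    show "cstar_subalgebra A"
      unfolding assms(3) by (rule closure_star_subalgebra[OF star_subalgebra_image[OF \<A> \<pi>(1)]])
    show "A \<subseteq> N"
      unfolding assms(3) by (rule closure_minimal[OF \<pi>(2) closedN])
    show "F \<in> N" using PN by (simp add: F)
    fix a assume a: "a \<in> A"
    \<comment> \<open>This is \<open>- (a * D.P)\<close>: the Kasparov condition is stated for
      \<open>V^2 - 1\<close>, with the sign opposite to \<open>1 - F^2\<close>.\<close>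
    show "a * (F * F) - a \<in> J"
      using csubspace_minus[OF sub(1) AP[OF a]] by (simp add: F D.F_square right_diff_distrib)
    show "a * (F - star F) \<in> J" by (simp add: sF J0)
    show "F * a - a * F \<in> J" by (rule comm[OF a])
  qed
  then show ?thesis using PN comm AP by (simp add: F FF[unfolded F] sF[unfolded F] J0)
qed

end
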